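(* For $k\ge 13$ and $n\ge 18k$, $$f(n,k,3)=|\mathcal G(n,k)|=\binom{n-1}{k-1}-\binom{n-k}{k-1}-\binom{n-k-1}{k-1}+\binom{n-2k}{k-1}+\binom{n-k-2}{k-3}+3.$$
   Context: For a family $\mathcal F\subset\binom{[n]}{k}$, the covering number $\tau(\mathcal F)$ is the minimum size of a set $T\subset[n]$ with $T\cap F\ne\emptyset$ for all $F\in\mathcal F$. A family is intersecting if any two of its members intersect. Define $f(n,k,s)=\max\{|\mathcal F|:\mathcal F\subset\binom{[n]}{k}\text{ intersecting},\ \tau(\mathcal F)\ge s\}$. Let $[a,b]=\{a,a+1,\dots,b\}$, $\mathcal B=\{[2,k+1],\ \{2\}\cup[k+2,2k],\ \{3\}\cup[k+2,2k]\}$, $\mathcal A=\{A\in\binom{[n]}{k}: 1\in A,\ A\cap B\ne\emptyset\ \forall B\in\mathcal B\}$, and $\mathcal G(n,k)=\mathcal A\cup\mathcal B$ (an intersecting family with $\tau=3$ for $n\ge 2k$). *)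

theory Defs
  imports Main
begin

definition k_subsets :: "nat \<Rightarrow> nat \<Rightarrow> nat set set" where
  "k_subsets n k = {A. A \<subseteq> {1..n} \<and> card A = k}"

definition intersecting :: "nat set set \<Rightarrow> bool" where
  "intersecting F \<longleftrightarrow> (\<forall>A\<in>F. \<forall>B\<in>F. A \<inter> B \<noteq> {})"

definition covering_number :: "nat \<Rightarrow> nat set set \<Rightarrow> nat" where
  "covering_number n F =
     (LEAST s. \<exists>T. T \<subseteq> {1..n} \<and> card T = s \<and> (\<forall>A\<in>F. T \<inter> A \<noteq> {}))"

definition f_max :: "nat \<Rightarrow> nat \<Rightarrow> nat \<Rightarrow> nat" where
  "f_max n k s = Max {card F | F. F \<subseteq> k_subsets n k \<and> intersecting F
                                 \<and> covering_number n F \<ge> s}"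

definition B_fam :: "nat \<Rightarrow> nat set set" where
  "B_fam k = {{2..k+1}, insert 2 {k+2..2*k}, insert 3 {k+2..2*k}}"

definition A_fam :: "nat \<Rightarrow> nat \<Rightarrow> nat set set" where
  "A_fam n k = {A \<in> k_subsets n k. 1 \<in> A \<and> (\<forall>B\<in>B_fam k. A \<inter> B \<noteq> {})}"

definition G_fam :: "nat \<Rightarrow> nat \<Rightarrow> nat set set" where
  "G_fam n k = A_fam n k \<union> B_fam k"

end

theory Submission
  imports Defs Complex_Main
begin

text \<open>
  Let \<open>F\<close> be intersecting with covering number at least 3. Any two vertices lie together in at most
  \<open>H = pair_bound n k\<close> members, because some member avoids both, and the bound to be proved is at
  least \<open>9 H\<close>. Shift towards one vertex \<open>c\<close> as long as the covering number stays at least 3. If this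
  ends in a stable family, then the shadow of the members avoiding \<open>c\<close> lies in the link of \<open>c\<close>, so by
  Katona's shadow theorem at most half of \<open>F\<close> avoids \<open>c\<close>. Otherwise \<open>F\<close> has a cover \<open>{x, y, z}\<close>, and
  the three families of members meeting it in exactly one point are pairwise cross-intersecting. In
  both cases a relative form of the Kruskal--Katona bound shows that either \<open>card F \<le> 9 H\<close> or all but
  about \<open>n choose (k - 4)\<close> members contain one vertex \<open>c\<close>.

  The members avoiding \<open>c\<close> intersect pairwise and have no common element, and those through \<open>c\<close> are
  transversals of them. Two members \<open>P\<close>, \<open>Q\<close> avoiding \<open>c\<close> with \<open>card (P \<inter> Q) = t\<close> bound the number of
  transversals by a quantity convex in \<open>t\<close>; the value at \<open>t = 1\<close> is attained by \<open>G(n, k)\<close>, and every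
  other configuration loses more transversals than it gains in members avoiding \<open>c\<close>.
\<close>

section \<open>Shadows and shifting\<close>

text \<open>The factor 9 is what either route spends. A cover \<open>{x, y, z}\<close> costs at most
  2H for each of the three one-point classes and H for each of the three pairs. A vertex
  \<open>c\<close> costs at most 7H through it and 2H away from it, or 4H and 4H. That G(n, k)
  outweighs 9H is the estimate behind k >= 13: it compares 8H with a sum of at most k - 1 decreasing
  terms, each somewhat below H. The obstacle at the end is a window. Any departure from the pattern
  of G(n, k) loses at least C(n-k-4, k-3) transversals, so the exchange pays while at most that many
  plus 3 members avoid \<open>c\<close>; concentration only gives fewer than 5 C(n-5, k-4). The
  first number is at least the second once n exceeds roughly 5k^2/6. Below that k is at least 24,
  and if the exchange fails then so many members avoid \<open>c\<close> that their number alone,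
  through \<open>cross_bound\<close>, keeps the star of \<open>c\<close> small enough.\<close>

definition ksets :: "'a set \<Rightarrow> nat \<Rightarrow> 'a set set" where
  "ksets X r = {A. A \<subseteq> X \<and> card A = r}"

definition cross :: "'a set set \<Rightarrow> 'a set set \<Rightarrow> bool" where
  "cross F G \<longleftrightarrow> (\<forall>A\<in>F. \<forall>B\<in>G. A \<inter> B \<noteq> {})"

definition shadow :: "'a set set \<Rightarrow> 'a set set" where
  "shadow F = {E - {x} | E x. E \<in> F \<and> x \<in> E}"

definition del :: "'a \<Rightarrow> 'a set set \<Rightarrow> 'a set set" where
  "del x F = {E \<in> F. x \<notin> E}"

definition link :: "'a \<Rightarrow> 'a set set \<Rightarrow> 'a set set" where
  "link x F = {E. x \<notin> E \<and> insert x E \<in> F}"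

definition shift_set :: "'a \<Rightarrow> 'a \<Rightarrow> 'a set set \<Rightarrow> 'a set \<Rightarrow> 'a set" where
  "shift_set a b F E =
     (if b \<in> E \<and> a \<notin> E \<and> insert a (E - {b}) \<notin> F then insert a (E - {b}) else E)"

definition shift :: "'a \<Rightarrow> 'a \<Rightarrow> 'a set set \<Rightarrow> 'a set set" where
  "shift a b F = shift_set a b F ` F"

lemma finite_ksets [simp]: "finite X \<Longrightarrow> finite (ksets X r)"
  by (simp add: ksets_def)

lemma card_ksets: "finite X \<Longrightarrow> card (ksets X r) = card X choose r"
  by (simp add: ksets_def n_subsets)

lemma finite_fam: "finite X \<Longrightarrow> F \<subseteq> ksets X r \<Longrightarrow> finite F"
  using finite_ksets finite_subset by blast

lemma link_eq_image: "link x F = (\<lambda>E. E - {x}) ` {E \<in> F. x \<in> E}"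
proof -
  have "E \<in> (\<lambda>E. E - {x}) ` {E \<in> F. x \<in> E}" if "E \<in> link x F" for E
    using that by (intro image_eqI[of _ _ "insert x E"]) (auto simp: link_def)
  moreover have "E - {x} \<in> link x F" if "E \<in> F" "x \<in> E" for E
    using that by (simp add: link_def insert_absorb)
  ultimately show ?thesis by blast
qed

lemma card_link: "card (link x F) = card {E \<in> F. x \<in> E}"
proof -
  have "inj_on (\<lambda>E. E - {x}) {E \<in> F. x \<in> E}"
    by (rule inj_onI) (metis (no_types, lifting) insert_Diff mem_Collect_eq)
  then show ?thesis by (simp add: link_eq_image card_image)
qed

lemma card_link_del: "finite F \<Longrightarrow> card F = card (link x F) + card (del x F)"
proof -
  assume f: "finite F"
  have "F = {E \<in> F. x \<in> E} \<union> del x F" by (auto simp: del_def)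
  then have "card F = card {E \<in> F. x \<in> E} + card (del x F)"
    by (metis (no_types, lifting) card_Un_disjoint del_def disjoint_iff f finite_Un mem_Collect_eq)
  then show ?thesis by (simp add: card_link)
qed

lemma link_ksets:
  assumes "finite X" "F \<subseteq> ksets X r" shows "link x F \<subseteq> ksets (X - {x}) (r - 1)"
proof
  fix E assume "E \<in> link x F"
  then have E: "x \<notin> E" "insert x E \<in> ksets X r" using assms by (auto simp: link_def)
  then have "finite E" using assms(1) by (auto simp: ksets_def intro: finite_subset)
  then show "E \<in> ksets (X - {x}) (r - 1)" using E by (auto simp: ksets_def)
qed

lemma del_ksets: "F \<subseteq> ksets X r \<Longrightarrow> del x F \<subseteq> ksets (X - {x}) r"
  by (auto simp: del_def ksets_def)

lemma shadow_ksets: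
  assumes "finite X" "F \<subseteq> ksets X r" shows "shadow F \<subseteq> ksets X (r - 1)"
  using assms by (auto simp: shadow_def ksets_def card_Diff_singleton)

section \<open>Properties of the shifting operation\<close>

lemma inj_on_shift_set: "inj_on (shift_set a b F) F"
proof (rule inj_onI)
  fix E E' assume E: "E \<in> F" "E' \<in> F" "shift_set a b F E = shift_set a b F E'"
  have "E = insert b (insert a (E - {b}) - {a})" if "b \<in> E" "a \<notin> E" for E
    using that by auto
  then show "E = E'" using E unfolding shift_set_def by metis
qed

lemma card_shift: "card (shift a b F) = card F"
  by (simp add: shift_def card_image inj_on_shift_set)

lemma shift_ksets:
  assumes "finite X" "a \<in> X" "F \<subseteq> ksets X r" shows "shift a b F \<subseteq> ksets X r"
proof
  fix E assume "E \<in> shift a b F"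
  then obtain E' where E': "E' \<in> F" "E = shift_set a b F E'" by (auto simp: shift_def)
  then have k: "E' \<subseteq> X" "card E' = r" using assms by (auto simp: ksets_def)
  then have fin: "finite E'" using assms finite_subset by auto
  have "card (insert a (E' - {b})) = card E'" if "b \<in> E'" "a \<notin> E'"
    using that fin card_Suc_Diff1[of E' b] by simp
  then show "E \<in> ksets X r" using E' k assms(2) by (auto simp: shift_set_def ksets_def)
qed

text \<open>A shift acts separately on each pair of sets that differ by exchanging \<open>a\<close>
  and \<open>b\<close>: if only one of the two is present, it becomes the one with \<open>a\<close>.
  So the set with \<open>a\<close> survives if either was there, the set with \<open>b\<close> only
  if both were, and sets containing both or neither are untouched.\<close>

lemma mem_shift:
  assumes "a \<noteq> b"
  shows "E \<in> shift a b F \<longleftrightarrow>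
    (if a \<in> E \<and> b \<notin> E then E \<in> F \<or> insert b (E - {a}) \<in> F
     else if b \<in> E \<and> a \<notin> E then E \<in> F \<and> insert a (E - {b}) \<in> F
     else E \<in> F)"
proof -
  have rev: "insert b (insert a (E - {b}) - {a}) = E" if "b \<in> E" "a \<notin> E" for E :: "'a set"
    using that by auto
  have rev': "insert a (insert b (E - {a}) - {b}) = E" if "a \<in> E" "b \<notin> E" for E :: "'a set"
    using that by auto
  have "E \<in> shift a b F" if "insert b (E - {a}) \<in> F" "a \<in> E" "b \<notin> E" "E \<notin> F"
    unfolding shift_def
    by (rule image_eqI[of _ _ "insert b (E - {a})"]) (use that rev' assms in \<open>auto simp: shift_set_def\<close>)
  moreover have "E \<in> shift a b F" if "E \<in> F" "\<not> (b \<in> E \<and> a \<notin> E \<and> insert a (E - {b}) \<notin> F)"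
    unfolding shift_def by (rule image_eqI[of _ _ E]) (use that in \<open>auto simp: shift_set_def\<close>)
  moreover have "E \<in> F \<and> \<not> (b \<in> E \<and> a \<notin> E \<and> insert a (E - {b}) \<notin> F) \<or>
      (a \<in> E \<and> b \<notin> E \<and> E \<notin> F \<and> insert b (E - {a}) \<in> F)" if EE: "E \<in> shift a b F"
  proof -
    obtain E' where E': "E' \<in> F" "E = shift_set a b F E'" using EE by (auto simp: shift_def)
    show ?thesis
    proof (cases "b \<in> E' \<and> a \<notin> E' \<and> insert a (E' - {b}) \<notin> F")
      case True
      then have "E = insert a (E' - {b})" using E' by (simp add: shift_set_def)
      then show ?thesis using rev[of E'] True E' assms by auto
    next
      case False
      then have "E = E'" using E' by (auto simp: shift_set_def)
      then show ?thesis using False E' by auto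
    qed
  qed
  ultimately show ?thesis by auto
qed

text \<open>A new set \<open>A\<close> comes from its partner with \<open>b\<close> in
  \<open>F\<close>. If a disjoint \<open>B\<close> contains \<open>b\<close>, it stayed in place
  only because its own partner with \<open>a\<close> is in \<open>F\<close>, and the two partners
  would be disjoint members of \<open>F\<close>.\<close>

lemma intersecting_shift:
  assumes "cross F F" "a \<noteq> b" shows "cross (shift a b F) (shift a b F)"
  unfolding cross_def
proof (intro ballI notI)
  fix A B assume AB: "A \<in> shift a b F" "B \<in> shift a b F" "A \<inter> B = {}"
  have F: "C \<inter> D \<noteq> {}" if "C \<in> F" "D \<in> F" for C D using assms that by (auto simp: cross_def)
  have main: False if A: "A \<in> shift a b F" and B: "B \<in> shift a b F" and e: "A \<inter> B = {}" and na: "A \<notin> F" for A B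
  proof -
    have A1: "a \<in> A" "b \<notin> A" "insert b (A - {a}) \<in> F"
      using A na mem_shift[OF assms(2)] by (metis)+
    then have "a \<notin> B" using e by auto
    show False
    proof (cases "b \<in> B")
      case True
      then have "insert a (B - {b}) \<in> F" using B \<open>a \<notin> B\<close> mem_shift[OF assms(2)] by metis
      from F[OF A1(3) this] show False using e A1 assms(2) by auto
    next
      case False
      then have "B \<in> F" using B \<open>a \<notin> B\<close> mem_shift[OF assms(2)] by metis
      from F[OF A1(3) this] show False using e A1 False by auto
    qed
  qed
  show False
  proof (cases "A \<in> F \<and> B \<in> F")
    case True then show False using F AB by blast
  next
    case False then show False using main AB by (metis Int_commute)
  qed
qed

text \<open>Deleting a point other than \<open>a\<close> and \<open>b\<close> commutes with the
  exchange. Deleting \<open>a\<close> or \<open>b\<close> needs separate cases, since both partners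
  then have a common subset in the shadow.\<close>

lemma shadow_shift:
  assumes "a \<noteq> b" shows "shadow (shift a b F) \<subseteq> shift a b (shadow F)"
proof
  fix G assume "G \<in> shadow (shift a b F)"
  then obtain E x where E: "E \<in> shift a b F" "x \<in> E" "G = E - {x}" by (auto simp: shadow_def)
  have I: "C - {y} \<in> shadow F" if "C \<in> F" "y \<in> C" for C y using that by (auto simp: shadow_def)
  show "G \<in> shift a b (shadow F)"
  proof (cases "x = a")
    case xa: True
    show ?thesis
    proof (cases "b \<in> E")
      case True
      then have EF: "E \<in> F" using E xa mem_shift[OF assms] by metis
      have "insert a (G - {b}) = E - {b}" using E xa True assms by auto
      then have "insert a (G - {b}) \<in> shadow F" using I[OF EF True] by simp
      moreover have "G \<in> shadow F" using I[OF EF] E by auto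
      ultimately show ?thesis using mem_shift[OF assms] by metis
    next
      case False
      then have "E \<in> F \<or> insert b (E - {a}) \<in> F" using E xa mem_shift[OF assms] by metis
      moreover have "G = insert b (E - {a}) - {b}" using E False xa by auto
      ultimately have "G \<in> shadow F" using I E xa by (metis insertI1)
      moreover have "a \<notin> G" "b \<notin> G" using E xa False by auto
      ultimately show ?thesis using mem_shift[OF assms] by metis
    qed
  next
    case xa: False
    show ?thesis
    proof (cases "x = b")
      case xb: True
      show ?thesis
      proof (cases "a \<in> E")
        case True
        then have EF: "E \<in> F" using E xb mem_shift[OF assms] by metis
        then have "G \<in> shadow F" using I E by auto
        then show ?thesis using mem_shift[OF assms] True E xb xa by (metis Diff_iff singletonI)
      next
        case False
        then have EF: "E \<in> F" using E xb mem_shift[OF assms] by metis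
        then have "G \<in> shadow F" using I E by auto
        then show ?thesis using mem_shift[OF assms] False E xb by (metis Diff_iff singletonI)
      qed
    next
      case xb: False
      have e1: "insert b (G - {a}) = insert b (E - {a}) - {x}"
           "insert a (G - {b}) = insert a (E - {b}) - {x}" using E xa xb by auto
      have m: "x \<in> insert b (E - {a})" "x \<in> insert a (E - {b})" using E xa xb by auto
      have ab: "a \<in> G \<longleftrightarrow> a \<in> E" "b \<in> G \<longleftrightarrow> b \<in> E" using E xa xb by auto
      show ?thesis
        using E(1) I[OF _ E(2)] I[OF _ m(1)] I[OF _ m(2)] e1 ab E(3)
        unfolding mem_shift[OF assms] by (auto split: if_splits)
    qed
  qed
qed

lemma card_shadow_shift:
  assumes "finite X" "F \<subseteq> ksets X r" "a \<noteq> b"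
  shows "card (shadow (shift a b F)) \<le> card (shadow F)"
proof -
  have "finite (shadow F)" using shadow_ksets[OF assms(1,2)] finite_fam[OF assms(1)] by blast
  then have "finite (shift a b (shadow F))" by (simp add: shift_def)
  then show ?thesis using card_mono[OF _ shadow_shift[OF assms(3)]] card_shift by metis
qed

text \<open>The termination measure for shifting elements into \<open>W\<close>.\<close>

definition mass :: "'a set \<Rightarrow> 'a set set \<Rightarrow> nat" where
  "mass W F = (\<Sum>E\<in>F. card (E \<inter> W))"

lemma mass_shift:
  assumes "finite F" "finite W" "a \<in> W" "b \<notin> W" "shift a b F \<noteq> F"
  shows "mass W F < mass W (shift a b F)"
proof -
  have "mass W (shift a b F) = (\<Sum>E\<in>F. card (shift_set a b F E \<inter> W))"
    unfolding mass_def shift_def by (simp add: sum.reindex[OF inj_on_shift_set])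
  moreover have le: "card (E \<inter> W) \<le> card (shift_set a b F E \<inter> W)" for E
    by (rule card_mono) (use assms in \<open>auto simp: shift_set_def\<close>)
  have ex: "\<exists>E\<in>F. card (E \<inter> W) < card (shift_set a b F E \<inter> W)"
  proof -
    obtain E where E: "E \<in> F" "shift_set a b F E \<noteq> E"
      using assms(5) unfolding shift_def by (metis (no_types, lifting) image_cong image_ident)
    then have h: "a \<notin> E" "shift_set a b F E = insert a (E - {b})"
      by (auto simp: shift_set_def split: if_splits)
    have "card (E \<inter> W) < card (shift_set a b F E \<inter> W)"
      by (rule psubset_card_mono) (use h assms in auto)
    then show ?thesis using E by blast
  qed
  ultimately show ?thesis unfolding mass_def
    using sum_strict_mono_ex1[OF assms(1), of "\<lambda>E. card (E \<inter> W)" "\<lambda>E. card (shift_set a b F E \<inter> W)"] le by auto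
qed

lemma mass_le:
  assumes "finite X" "F \<subseteq> ksets X r" shows "mass W F \<le> card (ksets X r) * r"
proof -
  have fin: "finite F" using assms finite_fam by blast
  have "mass W F \<le> (\<Sum>E\<in>F. r)" unfolding mass_def
  proof (rule sum_mono)
    fix E assume "E \<in> F"
    then have "card E = r" "finite E" using assms by (auto simp: ksets_def intro: finite_subset)
    then show "card (E \<inter> W) \<le> r" by (metis card_mono Int_lower1)
  qed
  also have "\<dots> = card F * r" by simp
  also have "\<dots> \<le> card (ksets X r) * r" using assms finite_ksets by (intro mult_right_mono card_mono) auto
  finally show ?thesis .
qed

text \<open>\<open>Q\<close> is a permitted early stop, for invariants \<open>P\<close> that a shift
  may destroy. The choices of \<open>W\<close> below are a single vertex (shifting towards it) and
  the complement of a vertex (shifting away from it).\<close>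

lemma shift_terminates:
  assumes "finite X" "F \<subseteq> ksets X r" "W \<subseteq> X" "P F"
    and step: "\<And>F' a b. F' \<subseteq> ksets X r \<Longrightarrow> P F' \<Longrightarrow> a \<in> W \<Longrightarrow> b \<in> X - W \<Longrightarrow> \<not> Q F' \<Longrightarrow> P (shift a b F')"
  shows "\<exists>F'. F' \<subseteq> ksets X r \<and> card F' = card F \<and> P F' \<and>
           (Q F' \<or> (\<forall>a\<in>W. \<forall>b\<in>X - W. shift a b F' = F'))"
  using assms(2,4)
proof (induction "card (ksets X r) * r - mass W F" arbitrary: F rule: less_induct)
  case less
  show ?case
  proof (cases "Q F \<or> (\<forall>a\<in>W. \<forall>b\<in>X - W. shift a b F = F)")
    case True then show ?thesis using less by blast
  next
    case False
    then obtain a b where ab: "a \<in> W" "b \<in> X - W" "shift a b F \<noteq> F" "\<not> Q F" by blast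
    have fin: "finite F" "finite W"
      using finite_fam[OF assms(1) less.prems(1)] finite_subset[OF assms(3,1)] by auto
    have k: "shift a b F \<subseteq> ksets X r" using shift_ksets[OF assms(1) _ less.prems(1)] ab assms(3) by blast
    have "mass W F < mass W (shift a b F)" using mass_shift[OF fin] ab by auto
    moreover have "mass W (shift a b F) \<le> card (ksets X r) * r" by (rule mass_le[OF assms(1) k])
    ultimately have "card (ksets X r) * r - mass W (shift a b F) < card (ksets X r) * r - mass W F" by linarith
    from less.hyps[OF this k step[OF less.prems(1,2) ab(1,2,4)]] show ?thesis by (simp add: card_shift)
  qed
qed

lemma stableD:
  assumes "shift a b F = F" "E \<in> F" "b \<in> E" "a \<notin> E" shows "insert a (E - {b}) \<in> F"
proof -
  have "a \<noteq> b" using assms by auto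
  then show ?thesis using mem_shift[of a b E F] assms by auto
qed

section \<open>Shadow theorems obtained by shifting with respect to one vertex\<close>

lemma shadow_nonempty:
  assumes "finite X" "F \<subseteq> ksets X r" "F \<noteq> {}" "r \<ge> 1" shows "card (shadow F) \<ge> 1"
proof -
  obtain E where E: "E \<in> F" using assms by auto
  then have "card E \<ge> 1" using assms by (auto simp: ksets_def)
  then obtain x where "x \<in> E" by fastforce
  then have "shadow F \<noteq> {}" using E by (auto simp: shadow_def)
  then show ?thesis using shadow_ksets[OF assms(1,2)] finite_fam[OF assms(1)] 
    by (metis One_nat_def Suc_leI card_gt_0_iff)
qed

text \<open>Shadow sets through \<open>x\<close> come at least from the shadow of the link, with
  \<open>x\<close> put back; these are disjoint from any \<open>S\<close> of sets avoiding
  \<open>x\<close>. In Kruskal-Katona \<open>S\<close> is the link itself, in Katona's theorem the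
  shadow of the deletion.\<close>

lemma card_shadow_split:
  assumes "finite X" "F \<subseteq> ksets X r" "S \<subseteq> shadow F" "\<And>A. A \<in> S \<Longrightarrow> x \<notin> A"
  shows "card S + card (shadow (link x F)) \<le> card (shadow F)"
proof -
  have fin: "finite (shadow F)" using shadow_ksets[OF assms(1,2)] finite_fam[OF assms(1)] by blast
  have nx: "x \<notin> A" if "A \<in> shadow (link x F)" for A
    using that by (auto simp: shadow_def link_def)
  have sub: "insert x ` shadow (link x F) \<subseteq> shadow F"
  proof
    fix B assume "B \<in> insert x ` shadow (link x F)"
    then obtain E y where E: "insert x E \<in> F" "x \<notin> E" "y \<in> E" "B = insert x (E - {y})"
      by (auto simp: shadow_def link_def)
    then have "B = insert x E - {y}" by auto
    then show "B \<in> shadow F" using E by (auto simp: shadow_def)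
  qed
  have "inj_on (insert x) (shadow (link x F))" 
    by (rule inj_onI) (metis nx insert_ident)
  then have c: "card (insert x ` shadow (link x F)) = card (shadow (link x F))" by (rule card_image)
  have "S \<inter> insert x ` shadow (link x F) = {}" using assms(4) by auto
  then have "card (S \<union> insert x ` shadow (link x F)) = card S + card (shadow (link x F))"
    using c fin finite_subset[OF assms(3)] finite_subset[OF sub] by (simp add: card_Un_disjoint)
  moreover have "card (S \<union> insert x ` shadow (link x F)) \<le> card (shadow F)"
    by (rule card_mono[OF fin]) (use assms sub in auto)
  ultimately show ?thesis by simp
qed

text \<open>The Kruskal--Katona theorem in Lovasz's form, at integer points. After shifting towards a
  single vertex \<open>x\<close> the shadow of the part avoiding \<open>x\<close> lies inside the link of \<open>x\<close>.\<close>

theorem kruskal_katona: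
  assumes "finite X" "F \<subseteq> ksets X r" "1 \<le> r" "r \<le> m" "m choose r \<le> card F"
  shows "m choose (r - 1) \<le> card (shadow F)"
  using assms
proof (induction "card X" arbitrary: X F r m)
  case 0
  then have "F \<subseteq> {{}}" "\<And>E. E \<in> F \<Longrightarrow> card E = r" by (auto simp: ksets_def)
  then have "F = {}" using 0 by force
  moreover have "m choose r > 0" using 0 by simp
  ultimately show ?case using 0 by simp
next
  case (Suc N)
  then obtain x where x: "x \<in> X" by fastforce
  have "\<exists>F'. F' \<subseteq> ksets X r \<and> card F' = card F \<and> card (shadow F') \<le> card (shadow F) \<and>
      (False \<or> (\<forall>a\<in>{x}. \<forall>b\<in>X - {x}. shift a b F' = F'))"
    by (rule shift_terminates[OF Suc.prems(1,2)])
      (use x in \<open>auto intro: order_trans[OF card_shadow_shift[OF Suc.prems(1)]]\<close>)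
  then obtain F' where F': "F' \<subseteq> ksets X r" "card F' = card F" "card (shadow F') \<le> card (shadow F)"
    and st: "\<And>b. b \<in> X - {x} \<Longrightarrow> shift x b F' = F'" by auto
  have fin: "finite F'" using F' Suc.prems finite_fam by blast
  have N: "card (X - {x}) = N" using Suc x by simp
  have lk: "link x F' \<subseteq> ksets (X - {x}) (r - 1)" by (rule link_ksets[OF Suc.prems(1) F'(1)])
  have dk: "del x F' \<subseteq> ksets (X - {x}) r" by (rule del_ksets[OF F'(1)])
  have sub: "shadow (del x F') \<subseteq> link x F'"
  proof
    fix A assume "A \<in> shadow (del x F')"
    then obtain E y where E: "E \<in> F'" "x \<notin> E" "y \<in> E" "A = E - {y}" by (auto simp: shadow_def del_def)
    then have "y \<in> X - {x}" using F' by (auto simp: ksets_def)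
    then show "A \<in> link x F'" using stableD[OF st E(1)] E by (auto simp: link_def)
  qed
  have finl: "finite (link x F')" using finite_fam[OF _ lk] Suc.prems by simp
  have pascal: "m choose r = ((m - 1) choose (r - 1)) + ((m - 1) choose r)"
    using Suc.prems by (metis Suc_diff_1 binomial_Suc_Suc less_le_trans zero_less_one)
  \<comment> \<open>If the link were small, the deletion would be large, and by induction its shadow
    would be too large to fit into the link.\<close>
  have L: "(m - 1) choose (r - 1) \<le> card (link x F')"
  proof (rule ccontr)
    assume small: "\<not> ?thesis"
    then have big: "(m - 1) choose r < card (del x F')"
      using card_link_del[OF fin, of x] F' Suc.prems(5) pascal by linarith
    have "(m - 1) choose (r - 1) \<le> card (shadow (del x F'))"
    proof (cases "r \<le> m - 1")
      case True
      then show ?thesis using Suc.hyps(1)[OF N[symmetric] _ dk] big Suc.prems by simp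
    next
      case False
      \<comment> \<open>Here \<open>(m - 1) choose r\<close> is 0 and the induction hypothesis does
        not apply, but a single member already yields the one required shadow set.\<close>
      then have "m = r" using Suc.prems by simp
      moreover have "del x F' \<noteq> {}" using big by auto
      ultimately show ?thesis using shadow_nonempty[OF _ dk] Suc.prems by simp
    qed
    also have "\<dots> \<le> card (link x F')" by (rule card_mono[OF finl sub])
    finally show False using small by simp
  qed
  have S: "link x F' \<subseteq> shadow F'" 
  proof
    fix A assume "A \<in> link x F'"
    then have "insert x A \<in> F'" "A = insert x A - {x}" by (auto simp: link_def)
    then show "A \<in> shadow F'" unfolding shadow_def by blast
  qed
  have sp: "card (link x F') + card (shadow (link x F')) \<le> card (shadow F')"
    by (rule card_shadow_split[OF Suc.prems(1) F'(1) S]) (auto simp: link_def)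
  show ?case
  proof (cases "r = 1")
    case True
    have "card (link x F') \<ge> 1" using L True by simp
    then show ?thesis using sp F' True by simp
  next
    case False
    have "(m - 1) choose (r - 1 - 1) \<le> card (shadow (link x F'))"
      by (rule Suc.hyps(1)[OF N[symmetric] _ lk]) (use Suc.prems False L in auto)
    moreover have "m choose (r - 1) = ((m - 1) choose (r - 1)) + ((m - 1) choose (r - 1 - 1))"
      using Suc.prems False binomial_Suc_Suc[of "m - 1" "r - 2"]
      by (simp add: numeral_2_eq_2 Suc_diff_Suc)
    ultimately show ?thesis using sp L F' by linarith
  qed
qed

text \<open>Double counting of pairs: deleting \<open>x\<close> from \<open>E\<close> gives a shadow
  set together with a point outside it, and the pair determines \<open>E\<close>.\<close>

lemma local_lym:
  assumes "finite X" "F \<subseteq> ksets X r" "1 \<le> r" 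
  shows "r * card F \<le> (card X - r + 1) * card (shadow F)"
proof -
  have fin: "finite F" using assms finite_fam by blast
  have fins: "finite (shadow F)" using shadow_ksets[OF assms(1,2)] finite_fam[OF assms(1)] by blast
  let ?P = "Sigma F (\<lambda>E. E)" and ?Q = "Sigma (shadow F) (\<lambda>A. X - A)"
  have fE: "finite E" "card E = r" "E \<subseteq> X" if "E \<in> F" for E
    using that assms by (auto simp: ksets_def intro: finite_subset)
  have P: "card ?P = r * card F" using fin fE by simp
  have "card (X - A) = card X - r + 1" if "A \<in> shadow F" for A
  proof -
    have "\<exists>E x. E \<in> F \<and> x \<in> E \<and> A = E - {x}" using that by (auto simp: shadow_def)
    then obtain E x where E: "E \<in> F" "x \<in> E" "A = E - {x}" by blast
    have "card A = r - 1" "A \<subseteq> X" "finite A" using E fE by auto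
    moreover have "r \<le> card X" using fE[OF E(1)] assms(1) card_mono by metis
    ultimately show ?thesis using assms by (simp add: card_Diff_subset)
  qed
  then have Q: "card ?Q = (card X - r + 1) * card (shadow F)" using fins assms(1) by simp
  have "card ?P \<le> card ?Q"
  proof (rule card_inj_on_le[of "\<lambda>(E, x). (E - {x}, x)"])
    show "inj_on (\<lambda>(E, x). (E - {x}, x)) ?P" by (auto simp: inj_on_def)
    show "(\<lambda>(E, x). (E - {x}, x)) ` ?P \<subseteq> ?Q" using fE by (auto simp: shadow_def)
    show "finite ?Q" using fins assms(1) by auto
  qed
  then show ?thesis using P Q by simp
qed

lemma crossD: "cross F G \<Longrightarrow> A \<in> F \<Longrightarrow> B \<in> G \<Longrightarrow> A \<inter> B \<noteq> {}"
  by (auto simp: cross_def)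

text \<open>Katona's shadow theorem. Shifting \<^emph>\<open>away\<close> from a vertex makes its link intersecting as soon
  as two members cannot cover the ground set.\<close>

theorem card_le_shadow:
  assumes "finite X" "F \<subseteq> ksets X r" "1 \<le> r" "cross F F"
  shows "card F \<le> card (shadow F)"
  using assms
proof (induction "card X" arbitrary: X F r)
  case 0
  then have "F \<subseteq> {{}}" "\<And>E. E \<in> F \<Longrightarrow> card E = r" by (auto simp: ksets_def)
  then have "F = {}" using 0 by force
  then show ?case by simp
next
  case (Suc N)
  consider (a) "card X \<le> 2 * r - 1" | (b) "r = 1" | (c) "2 * r \<le> card X" "r \<ge> 2" using Suc.prems by linarith
  then show ?case
  proof cases
    case a
    \<comment> \<open>On so small a ground set the local inequality suffices; this also frees the
      last case to find a point outside two members.\<close>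
    then have "card X - r + 1 \<le> r" using Suc.prems by linarith
    then have "(card X - r + 1) * card (shadow F) \<le> r * card (shadow F)" by (rule mult_right_mono) simp
    then have "r * card F \<le> r * card (shadow F)" 
      using local_lym[OF Suc.prems(1-3)] by linarith
    then show ?thesis using Suc.prems by simp
  next
    case b
    have "\<And>A B. A \<in> F \<Longrightarrow> B \<in> F \<Longrightarrow> A = B"
    proof -
      fix A B assume AB: "A \<in> F" "B \<in> F"
      then have "card A = 1" "card B = 1" using Suc.prems b by (auto simp: ksets_def)
      then show "A = B" using crossD[OF Suc.prems(4) AB] by (auto simp: card_1_singleton_iff)
    qed
    then have "card F \<le> 1" using card_le_Suc0_iff_eq[OF finite_fam[OF Suc.prems(1,2)]] by auto
    then show ?thesis using shadow_nonempty[OF Suc.prems(1,2)] b by (cases "F = {}") auto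
  next
    case c
    obtain y where y: "y \<in> X" using Suc by fastforce
    have "\<exists>F'. F' \<subseteq> ksets X r \<and> card F' = card F \<and> (card (shadow F') \<le> card (shadow F) \<and> cross F' F') \<and>
        (False \<or> (\<forall>a\<in>X - {y}. \<forall>b\<in>X - (X - {y}). shift a b F' = F'))"
      by (rule shift_terminates[OF Suc.prems(1,2)])
        (use y Suc.prems in
          \<open>auto intro: order_trans[OF card_shadow_shift[OF Suc.prems(1)]] intersecting_shift\<close>)
    then obtain F' where F': "F' \<subseteq> ksets X r" "card F' = card F" "card (shadow F') \<le> card (shadow F)" "cross F' F'"
      and st: "\<And>a. a \<in> X - {y} \<Longrightarrow> shift a y F' = F'" using y by auto
    have fin: "finite F'" using F' Suc.prems finite_fam by blast
    have N: "card (X - {y}) = N" using Suc y by simp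
    have lk: "link y F' \<subseteq> ksets (X - {y}) (r - 1)" by (rule link_ksets[OF Suc.prems(1) F'(1)])
    have dk: "del y F' \<subseteq> ksets (X - {y}) r" by (rule del_ksets[OF F'(1)])
    have "cross (link y F') (link y F')"
      unfolding cross_def
    proof (intro ballI notI)
      fix A B assume AB: "A \<in> link y F'" "B \<in> link y F'" "A \<inter> B = {}"
      have AB1: "insert y A \<in> F'" "insert y B \<in> F'" "y \<notin> A" "y \<notin> B" using AB by (auto simp: link_def)
      have AB2: "A \<in> ksets (X - {y}) (r - 1)" "B \<in> ksets (X - {y}) (r - 1)" using AB lk by auto
      \<comment> \<open>The bound is 2(r - 1) + 1 = 2r - 1, so some \<open>a\<close> lies outside.
        Stability lets \<open>a\<close> replace \<open>y\<close> in one of the two members, which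
        makes them disjoint.\<close>
      have "card (insert y (A \<union> B)) \<le> Suc (card A + card B)"
        using card_insert_le_m1[of "Suc (card A + card B)" "A \<union> B" y] card_Un_le[of A B] by simp
      also have "\<dots> < card X" using AB2 c by (auto simp: ksets_def)
      finally have lt: "card (insert y (A \<union> B)) < card X" .
      have finAB: "finite (insert y (A \<union> B))"
        using AB2 Suc.prems(1) by (auto simp: ksets_def intro: finite_subset[of _ "X - {y}"])
      have "\<not> X \<subseteq> insert y (A \<union> B)"
        using card_mono[OF finAB] lt by (metis linorder_not_le)
      then obtain a where a: "a \<in> X - {y}" "a \<notin> A" "a \<notin> B" by auto
      have "insert a (insert y A - {y}) \<in> F'" by (rule stableD[OF st[OF a(1)] AB1(1)]) (use a in auto)
      from crossD[OF F'(4) this AB1(2)] show False using a AB1 AB(3) by auto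
    qed
    then have 1: "card (link y F') \<le> card (shadow (link y F'))"
      using Suc.hyps(1)[OF N[symmetric] _ lk] c Suc.prems by simp
    have "cross (del y F') (del y F')" using F'(4) by (auto simp: cross_def del_def)
    then have 2: "card (del y F') \<le> card (shadow (del y F'))"
      using Suc.hyps(1)[OF N[symmetric] _ dk] Suc.prems by simp
    have "card (shadow (del y F')) + card (shadow (link y F')) \<le> card (shadow F')"
      by (rule card_shadow_split[OF Suc.prems(1) F'(1)]) (auto simp: shadow_def del_def)
    then show ?thesis using card_link_del[OF fin, of y] 1 2 F' by linarith
  qed
qed

section \<open>Cross-intersecting families\<close>

text \<open>An \<open>i\<close>-set is disjoint from \<open>E\<close> exactly if it lies in the
  complement of \<open>E\<close>, so Kruskal-Katona is iterated downwards from the family of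
  complements. The threshold is the size of the family of all \<open>b\<close>-sets through a fixed
  \<open>j\<close>-set, for which the bound is sharp.\<close>

lemma disjoint_shadow_aux:
  assumes X: "finite X" and B: "B \<subseteq> ksets X b" and j: "j \<le> b" "b \<le> card X"
    and big: "(card X - j) choose (b - j) \<le> card B" and i: "i \<le> card X - b"
  shows "(card X - j) choose i \<le> card {A \<in> ksets X i. \<exists>E\<in>B. A \<inter> E = {}}"
  using i
proof (induction rule: inc_induct)
  case base
  let ?D = "{A \<in> ksets X (card X - b). \<exists>E\<in>B. A \<inter> E = {}}"
  have "(\<lambda>E. X - E) ` B \<subseteq> ?D"
    using B X by (auto simp: ksets_def card_Diff_subset finite_subset)
  moreover have "inj_on (\<lambda>E. X - E) B"
  proof (rule inj_onI)
    fix E E' assume "E \<in> B" "E' \<in> B" "X - E = X - E'"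
    moreover then have "E \<subseteq> X" "E' \<subseteq> X" using B by (auto simp: ksets_def)
    ultimately show "E = E'" by blast
  qed
  moreover have "finite ?D" using X by simp
  ultimately have "card B \<le> card ?D" by (intro card_inj_on_le)
  moreover have "(card X - j) choose (card X - b) = (card X - j) choose (b - j)"
    using j by (subst binomial_symmetric) auto
  ultimately show ?case using big by simp
next
  case (step i)
  let ?D = "\<lambda>i. {A \<in> ksets X i. \<exists>E\<in>B. A \<inter> E = {}}"
  have "(card X - j) choose (Suc i - 1) \<le> card (shadow (?D (Suc i)))"
    by (rule kruskal_katona[OF X]) (use step j in auto)
  also have "\<dots> \<le> card (?D i)"
  proof (rule card_mono)
    show "finite (?D i)" using X by simp
    show "shadow (?D (Suc i)) \<subseteq> ?D i"
      using X by (auto simp: shadow_def ksets_def card_Diff_singleton intro: finite_subset)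
  qed
  finally show ?case by simp
qed

text \<open>The induction removes \<open>z\<close> from \<open>X\<close>: by Pascal's rule either the members of \<open>B\<close> avoiding \<open>z\<close> or
  those through \<open>z\<close> are still numerous enough.\<close>

lemma disjoint_shadow:
  assumes "finite Z" "finite X" "Z \<subseteq> X" "B \<subseteq> ksets X b" "j \<le> b" "a + b + card Z \<le> card X"
    and "(card X - j) choose (b - j) \<le> card B"
  shows "(card X - card Z - j) choose a \<le> card {A \<in> ksets (X - Z) a. \<exists>E\<in>B. A \<inter> E = {}}"
  using assms
proof (induction Z arbitrary: X B b rule: finite_induct)
  case empty
  then show ?case using disjoint_shadow_aux[of X B b j a] by simp
next
  case (insert z Z)
  let ?N = "card X"
  have N: "card (X - {z}) = ?N - 1" "Z \<subseteq> X - {z}" using insert by auto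
  have eq: "X - {z} - Z = X - insert z Z" by auto
  have szs: "?N - 1 - card Z - j = ?N - card (insert z Z) - j" using insert by simp
  have fin: "finite B" by (rule finite_fam[OF insert.prems(1,3)])
  have finR: "finite {A \<in> ksets (X - insert z Z) a. \<exists>E\<in>B. A \<inter> E = {}}"
    using insert.prems by simp
  show ?case
  proof (cases "j = b")
    case True
    \<comment> \<open>The threshold is now 1, and the sets avoiding a single member are
      enough.\<close>
    then have "B \<noteq> {}" using insert.prems by auto
    then obtain E where E: "E \<in> B" by auto
    have Ek: "finite E" "card E = b" "E \<subseteq> X" 
      using E insert.prems by (auto simp: ksets_def intro: finite_subset)
    have "ksets (X - insert z Z - E) a \<subseteq> {A \<in> ksets (X - insert z Z) a. \<exists>E\<in>B. A \<inter> E = {}}"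
      using E by (auto simp: ksets_def)
    from card_mono[OF finR this] have "card (X - insert z Z - E) choose a \<le> card {A \<in> ksets (X - insert z Z) a. \<exists>E\<in>B. A \<inter> E = {}}"
      using card_ksets[of "X - insert z Z - E" a] insert.prems(1) by simp
    moreover have "?N - card (insert z Z) - j \<le> card (X - insert z Z - E)"
    proof -
      have "card (X - insert z Z) = ?N - card (insert z Z)"
        using insert.prems insert.hyps by (intro card_Diff_subset) auto
      moreover have "card (X - insert z Z) - card E \<le> card (X - insert z Z - E)"
        using Ek by (rule_tac diff_card_le_card_Diff)
      ultimately show ?thesis using Ek True by simp
    qed
    ultimately show ?thesis using binomial_mono binomial_le_pow
      by (meson dual_order.trans binomial_right_mono)
  next
    case False
    then have jb: "j < b" using insert.prems by simp
    have "?N - j \<ge> 1" using insert.prems jb by simp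
    then have P: "(?N - j) choose (b - j) = ((?N - 1 - j) choose (b - 1 - j)) + ((?N - 1 - j) choose (b - j))"
      using choose_reduce_nat[of "?N - j" "b - j"] jb by simp
    have c: "card B = card (link z B) + card (del z B)" by (rule card_link_del[OF fin])
    consider (1) "(?N - 1 - j) choose (b - j) \<le> card (del z B)"
      | (2) "(?N - 1 - j) choose (b - 1 - j) \<le> card (link z B)"
      using P c insert.prems by linarith
    then show ?thesis
    proof cases
      case 1
      have "(?N - 1 - card Z - j) choose a \<le> card {A \<in> ksets (X - {z} - Z) a. \<exists>E\<in>del z B. A \<inter> E = {}}"
        using insert.IH[OF _ N(2) del_ksets[OF insert.prems(3)] insert.prems(4)] 1 insert.prems insert.hyps
        unfolding N(1) by simp
      also have "\<dots> \<le> card {A \<in> ksets (X - insert z Z) a. \<exists>E\<in>B. A \<inter> E = {}}"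
        unfolding eq by (rule card_mono[OF finR]) (auto simp: del_def)
      finally show ?thesis unfolding szs .
    next
      case 2
      have "(?N - 1 - card Z - j) choose a \<le> card {A \<in> ksets (X - {z} - Z) a. \<exists>E\<in>link z B. A \<inter> E = {}}"
        using insert.IH[OF _ N(2) link_ksets[OF insert.prems(1,3)]] 2 insert.prems insert.hyps jb
        unfolding N(1) by simp
      also have "\<dots> \<le> card {A \<in> ksets (X - insert z Z) a. \<exists>E\<in>B. A \<inter> E = {}}"
        unfolding eq
      proof (rule card_mono[OF finR], rule subsetI)
        fix A assume "A \<in> {A \<in> ksets (X - insert z Z) a. \<exists>E\<in>link z B. A \<inter> E = {}}"
        then obtain E where "A \<in> ksets (X - insert z Z) a" "insert z E \<in> B" "A \<inter> E = {}"
          by (auto simp: link_def)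
        moreover have "A \<inter> insert z E = {}" using calculation by (auto simp: ksets_def)
        ultimately show "A \<in> {A \<in> ksets (X - insert z Z) a. \<exists>E\<in>B. A \<inter> E = {}}" by blast
      qed
      finally show ?thesis unfolding szs .
    qed
  qed
qed

text \<open>Sets disjoint from some member of \<open>B\<close> are excluded from \<open>A\<close>.
  The result is as if \<open>B\<close> consisted of all sets through one \<open>j\<close>-set, which
  \<open>A\<close> would have to meet.\<close>

lemma cross_bound:
  assumes "finite X" "Z \<subseteq> X" "A \<subseteq> ksets (X - Z) a" "B \<subseteq> ksets X b" "cross A B" "j \<le> b"
    "a + b + card Z \<le> card X" "(card X - j) choose (b - j) \<le> card B"
  shows "card A + ((card X - card Z - j) choose a) \<le> (card X - card Z) choose a"
proof -
  let ?R = "{A \<in> ksets (X - Z) a. \<exists>E\<in>B. A \<inter> E = {}}"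
  have Z: "finite Z" using assms finite_subset by blast
  have fin: "finite (ksets (X - Z) a)" using assms(1) by (intro finite_ksets) auto
  have "A \<inter> ?R = {}" using assms(5) by (auto simp: cross_def)
  then have "card A + card ?R = card (A \<union> ?R)"
    using fin assms(3) by (intro card_Un_disjoint[symmetric]) (auto intro: finite_subset)
  also have "\<dots> \<le> card (ksets (X - Z) a)" by (rule card_mono[OF fin]) (use assms in auto)
  also have "\<dots> = (card X - card Z) choose a"
    using assms Z by (simp add: card_ksets card_Diff_subset)
  finally show ?thesis using disjoint_shadow[OF Z assms(1,2,4,6,7,8)] by simp
qed

section \<open>Binomial differences and the relative bound for cross-intersecting families\<close>

lemma binomial_diff_mono:
  assumes "s \<le> M" "M \<le> M'"
  shows "int (M choose a) - int ((M - s) choose a) \<le> int (M' choose a) - int ((M' - s) choose a)"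
  using assms(2)
proof (induction rule: dec_induct)
  case (step n)
  show ?case
  proof (cases a)
    case (Suc a')
    have "int (Suc n choose a) = int (n choose a') + int (n choose a)"
      "int ((Suc n - s) choose a) = int ((n - s) choose a') + int ((n - s) choose a)"
      using step assms Suc by (simp_all add: Suc_diff_le)
    moreover have "(n - s) choose a' \<le> n choose a'" by (rule binomial_right_mono) simp
    ultimately show ?thesis using step.IH by linarith
  qed simp
qed simp

text \<open>Turns the telescoped sum of \<open>relative_bound_aux\<close> into \<open>j\<close>
  copies of its largest contribution, by Pascal's rule and monotonicity of the first
  difference.\<close>

lemma binomial_second_diff:
  assumes "s + j \<le> N"
  shows "int (N choose Suc a) - int ((N - s) choose Suc a)
           - (int ((N - j) choose Suc a) - int ((N - j - s) choose Suc a))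
         \<le> int j * (int ((N - 1) choose a) - int ((N - 1 - s) choose a))"
  using assms
proof (induction j)
  case (Suc j)
  have 1: "N - j = Suc (N - Suc j)" "N - j - s = Suc (N - Suc j - s)" using Suc.prems by auto
  have "int ((N - Suc j) choose a) - int ((N - Suc j - s) choose a)
      \<le> int ((N - 1) choose a) - int ((N - 1 - s) choose a)"
    by (rule binomial_diff_mono) (use Suc.prems in auto)
  moreover have "int ((N - j) choose Suc a) = int ((N - Suc j) choose a) + int ((N - Suc j) choose Suc a)"
    "int ((N - j - s) choose Suc a) = int ((N - Suc j - s) choose a) + int ((N - Suc j - s) choose Suc a)"
    using 1 by (metis binomial_Suc_Suc of_nat_add)+
  moreover define x where "x = int ((N - 1) choose a) - int ((N - 1 - s) choose a)"
  moreover have "int (Suc j) * x = int j * x + x" by (simp add: algebra_simps)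
  ultimately show ?case using Suc.IH Suc.prems by simp
qed simp

text \<open>The members of \<open>A\<close> are sorted by the first element of \<open>D\<close> which they contain. That element
  \<open>d\<close> either costs \<open>H\<close>, or enough members of \<open>B\<close> avoid \<open>d\<close> for \<open>cross_bound\<close> to apply to the link of
  \<open>d\<close>.\<close>

lemma relative_bound_aux:
  assumes "finite D" "finite X" "A \<subseteq> ksets X (Suc a)" "B \<subseteq> ksets X b" "cross A B" "j \<le> b"
    and "\<And>d. d \<in> D \<Longrightarrow> card (del d B) < (card X - 1 - j) choose (b - j) \<Longrightarrow> card {E \<in> A. d \<in> E} \<le> H"
    and "Z \<subseteq> X" "D \<subseteq> X" "Z \<inter> D = {}" "a + b + card Z + card D \<le> card X"
  shows "int (card {E \<in> A. E \<inter> Z = {} \<and> E \<inter> D \<noteq> {}})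
    \<le> int (card {d \<in> D. card (del d B) < (card X - 1 - j) choose (b - j)}) * int H
      + (int ((card X - card Z) choose Suc a) - int ((card X - card Z - card D) choose Suc a)
         - (int ((card X - card Z - j) choose Suc a) - int ((card X - card Z - j - card D) choose Suc a)))"
  using assms
proof (induction D arbitrary: Z rule: finite_induct)
  case empty
  then show ?case by simp
next
  case (insert d D)
  let ?pop = "\<lambda>d. card (del d B) < (card X - 1 - j) choose (b - j)"
  let ?z = "card Z" and ?N = "card X" and ?s = "card D"
  have finA: "finite A" by (rule finite_fam[OF insert.prems(1,2)])
  have Z: "finite Z" by (rule finite_subset[OF insert.prems(7,1)])
  have zd: "card (insert d Z) = Suc ?z" using Z insert by simp
  have sz: "?N - Suc ?z = ?N - ?z - 1" "?N - ?z \<ge> 1" "?N - ?z - j \<ge> 1" using insert by auto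
  \<comment> \<open>Members through \<open>d\<close> are bounded directly, and for the others
    \<open>d\<close> joins \<open>Z\<close>. Each step lowers the top of the binomials by one, so
    the bounds telescope by Pascal's rule.\<close>
  let ?S1 = "{E \<in> A. E \<inter> Z = {} \<and> d \<in> E}"
  let ?S2 = "{E \<in> A. E \<inter> insert d Z = {} \<and> E \<inter> D \<noteq> {}}"
  have "{E \<in> A. E \<inter> Z = {} \<and> E \<inter> insert d D \<noteq> {}} = ?S1 \<union> ?S2" by auto
  moreover have "?S1 \<inter> ?S2 = {}" by auto
  ultimately have c: "card {E \<in> A. E \<inter> Z = {} \<and> E \<inter> insert d D \<noteq> {}} = card ?S1 + card ?S2"
    using finA by (simp add: card_Un_disjoint)
  have IH: "int (card ?S2) \<le> int (card {d \<in> D. ?pop d}) * int H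
      + (int ((?N - Suc ?z) choose Suc a) - int ((?N - Suc ?z - ?s) choose Suc a)
         - (int ((?N - Suc ?z - j) choose Suc a) - int ((?N - Suc ?z - j - ?s) choose Suc a)))"
    using insert.IH[of "insert d Z", unfolded zd] insert.prems insert.hyps by auto
  have S1: "int (card ?S1) \<le> (if ?pop d then int H else 0)
      + (int ((?N - ?z - 1) choose a) - int ((?N - ?z - 1 - j) choose a))"
  proof (cases "?pop d")
    case True
    have "card ?S1 \<le> card {E \<in> A. d \<in> E}" by (rule card_mono) (use finA in auto)
    also have "\<dots> \<le> H" using insert.prems(6) True by simp
    finally have "card ?S1 \<le> H" .
    moreover have "((?N - ?z - 1 - j) choose a) \<le> ((?N - ?z - 1) choose a)"
      by (rule binomial_right_mono) simp
    ultimately show ?thesis using True by simp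
  next
    case False
    have S1k: "{E \<in> A. E \<inter> Z = {}} \<subseteq> ksets (X - Z) (Suc a)" using insert.prems by (auto simp: ksets_def)
    have eq: "link d {E \<in> A. E \<inter> Z = {}} \<subseteq> ksets (X - {d} - Z) a"
    proof -
      have "X - Z - {d} = X - {d} - Z" by auto
      then show ?thesis using link_ksets[OF _ S1k, of d] insert.prems(1) by simp
    qed
    have "cross (link d {E \<in> A. E \<inter> Z = {}}) (del d B)"
      using insert.prems(4) unfolding cross_def link_def del_def by fastforce
    from cross_bound[OF _ _ eq del_ksets[OF insert.prems(3)] this insert.prems(5)]
    have "card (link d {E \<in> A. E \<inter> Z = {}}) + ((card (X - {d}) - ?z - j) choose a) \<le> (card (X - {d}) - ?z) choose a"
      using False insert.prems(1,5,7-10) insert.hyps by (simp add: subset_Diff_insert)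
    moreover have "card (link d {E \<in> A. E \<inter> Z = {}}) = card ?S1"
      unfolding card_link by (rule arg_cong[of _ _ card]) auto
    moreover have "card (X - {d}) - ?z = ?N - ?z - 1" using insert.prems by simp
    ultimately show ?thesis using False by simp
  qed
  have pop: "card {e \<in> insert d D. ?pop e} = card {e \<in> D. ?pop e} + (if ?pop d then 1 else 0)"
  proof (cases "?pop d")
    case True
    then have "{e \<in> insert d D. ?pop e} = insert d {e \<in> D. ?pop e}" by auto
    then show ?thesis using True insert.hyps by simp
  next
    case False
    then have "{e \<in> insert d D. ?pop e} = {e \<in> D. ?pop e}" by auto
    then show ?thesis using False by simp
  qed
  have q1: "?N - ?z = Suc (?N - ?z - 1)" "?N - ?z - j = Suc (?N - ?z - 1 - j)" using sz by auto
  have p1: "int ((?N - ?z) choose Suc a) = int ((?N - ?z - 1) choose a) + int ((?N - ?z - 1) choose Suc a)"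
    "int ((?N - ?z - j) choose Suc a) = int ((?N - ?z - 1 - j) choose a) + int ((?N - ?z - 1 - j) choose Suc a)"
    using q1 by (metis binomial_Suc_Suc of_nat_add)+
  have q2: "card (insert d D) = Suc ?s" "?N - ?z - Suc ?s = ?N - ?z - 1 - ?s"
    "?N - ?z - j - Suc ?s = ?N - ?z - 1 - j - ?s" "?N - Suc ?z - j = ?N - ?z - 1 - j" using insert.hyps by auto
  show ?case unfolding c pop q2 p1 using IH S1 unfolding sz(1) by (simp add: algebra_simps split: if_splits)
qed

text \<open>In the main application \<open>X\<close> is the vertex set without \<open>c\<close>,
  \<open>a\<close> is k - 2 and \<open>D\<close> is a member of \<open>B\<close>. Then the last
  bracket is exactly \<open>pair_bound n k\<close>, and each of the \<open>j\<close> units and each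
  popular element costs one such bound.\<close>

lemma relative_bound:
  assumes "finite X" "A \<subseteq> ksets X (Suc a)" "B \<subseteq> ksets X b" "cross A B" "j \<le> b" "D \<subseteq> X"
    and "\<And>d. d \<in> D \<Longrightarrow> card (del d B) < (card X - 1 - j) choose (b - j) \<Longrightarrow> card {E \<in> A. d \<in> E} \<le> H"
    and "a + b + card D \<le> card X" "\<And>E. E \<in> A \<Longrightarrow> E \<inter> D \<noteq> {}"
  shows "card A \<le> card {d \<in> D. card (del d B) < (card X - 1 - j) choose (b - j)} * H
      + j * (((card X - 1) choose a) - ((card X - 1 - card D) choose a))"
proof -
  have fD: "finite D" using assms finite_subset by blast
  have eq: "{E \<in> A. E \<inter> {} = {} \<and> E \<inter> D \<noteq> {}} = A" using assms(9) by auto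
  have "int (card A) \<le> int (card {d \<in> D. card (del d B) < (card X - 1 - j) choose (b - j)}) * int H
     + (int (card X choose Suc a) - int ((card X - card D) choose Suc a)
         - (int ((card X - j) choose Suc a) - int ((card X - j - card D) choose Suc a)))"
    using relative_bound_aux[OF fD assms(1-5) assms(7), of "{}"] assms eq by simp
  also have "\<dots> \<le> int (card {d \<in> D. card (del d B) < (card X - 1 - j) choose (b - j)}) * int H
     + int j * (int ((card X - 1) choose a) - int ((card X - 1 - card D) choose a))"
    using binomial_second_diff[of "card D" j "card X" a] assms by simp
  also have "\<dots> = int (card {d \<in> D. card (del d B) < (card X - 1 - j) choose (b - j)} * H
      + j * (((card X - 1) choose a) - ((card X - 1 - card D) choose a)))"
    by (simp add: of_nat_diff binomial_right_mono)
  finally show ?thesis by linarith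
qed

lemma card_hitting:
  assumes "finite X" "P \<subseteq> X"
  shows "card {A \<in> ksets X a. A \<inter> P \<noteq> {}} = (card X choose a) - ((card X - card P) choose a)"
proof -
  have "{A \<in> ksets X a. A \<inter> P \<noteq> {}} = ksets X a - ksets (X - P) a" by (auto simp: ksets_def)
  moreover have "ksets (X - P) a \<subseteq> ksets X a" by (auto simp: ksets_def)
  ultimately show ?thesis
    using assms by (simp add: card_Diff_subset card_ksets finite_ksets finite_subset)
qed

section \<open>Concentration on a star\<close>

text \<open>No cover by two points, phrased without a ground set: \<open>u\<close> and
  \<open>v\<close> may coincide or lie outside it, which also rules out a single covering
  point.\<close>

definition tau3 :: "'a set set \<Rightarrow> bool" where
  "tau3 F \<longleftrightarrow> (\<forall>u v. \<exists>E\<in>F. u \<notin> E \<and> v \<notin> E)"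

text \<open>The number of k-subsets of an n-set through two given points that meet a fixed k-set
  containing neither point.\<close>

definition pair_bound :: "nat \<Rightarrow> nat \<Rightarrow> nat" where
  "pair_bound n k = ((n - 2) choose (k - 2)) - ((n - 2 - k) choose (k - 2))"

lemma ksetsD: "A \<in> ksets X r \<Longrightarrow> A \<subseteq> X" "A \<in> ksets X r \<Longrightarrow> card A = r"
  by (auto simp: ksets_def)

lemma ksets_finiteD: "finite X \<Longrightarrow> A \<in> ksets X r \<Longrightarrow> finite A"
  by (auto simp: ksets_def intro: finite_subset)

lemma card_le_supersets:
  assumes "finite X" "B \<subseteq> {E \<in> ksets X b. P \<subseteq> E}" "P \<subseteq> X"
    and "\<And>E. E \<in> B \<Longrightarrow> Q (E - P)"
  shows "card B \<le> card {E \<in> ksets (X - P) (b - card P). Q E}"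
proof (rule card_inj_on_le[of "\<lambda>E. E - P"])
  have sub: "P \<subseteq> E" if "E \<in> B" for E using assms(2) that by blast
  show "inj_on (\<lambda>E. E - P) B"
  proof (rule inj_onI)
    fix E E' assume EE: "E \<in> B" "E' \<in> B" "E - P = E' - P"
    then have "P \<subseteq> E" "P \<subseteq> E'" using sub by auto
    then show "E = E'" using EE(3) by blast
  qed
  show "finite {E \<in> ksets (X - P) (b - card P). Q E}" using assms(1) by simp
  have fP: "finite P" using assms finite_subset by blast
  show "(\<lambda>E. E - P) ` B \<subseteq> {E \<in> ksets (X - P) (b - card P). Q E}"
  proof
    fix G assume "G \<in> (\<lambda>E. E - P) ` B"
    then obtain E where E: "E \<in> B" "G = E - P" by auto
    then have "E \<in> ksets X b" "P \<subseteq> E" using assms(2) by auto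
    then show "G \<in> {E \<in> ksets (X - P) (b - card P). Q E}"
      using E assms(4) card_Diff_subset[OF fP, of E] by (auto simp: ksets_def)
  qed
qed

lemma card_supersets:
  assumes "finite X" "B \<subseteq> ksets X b" "P \<subseteq> X"
  shows "card {E \<in> B. P \<subseteq> E} \<le> (card X - card P) choose (b - card P)"
proof -
  have fP: "finite P" using assms finite_subset by blast
  have "card {E \<in> B. P \<subseteq> E} \<le> card {E \<in> ksets (X - P) (b - card P). True}"
    by (rule card_le_supersets[OF assms(1) _ assms(3)]) (use assms(2) in auto)
  also have "\<dots> = (card X - card P) choose (b - card P)"
    using assms(1) card_Diff_subset[OF fP assms(3)] by (simp add: card_ksets)
  finally show ?thesis .
qed

lemma card_two_hitting:
  assumes "finite V" "F \<subseteq> ksets V k" "cross F F" "tau3 F" "u \<noteq> v"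
  shows "card {E \<in> F. u \<in> E \<and> v \<in> E} \<le> pair_bound (card V) k"
proof (cases "u \<in> V \<and> v \<in> V")
  case True
  obtain E0 where E0: "E0 \<in> F" "u \<notin> E0" "v \<notin> E0" using assms(4) by (auto simp: tau3_def)
  have E0k: "E0 \<subseteq> V" "card E0 = k" using E0 assms(2) by (auto simp: ksets_def)
  have c2: "card {u, v} = 2" using assms(5) by simp
  have "card {E \<in> F. u \<in> E \<and> v \<in> E} \<le> card {A \<in> ksets (V - {u, v}) (k - card {u, v}). A \<inter> E0 \<noteq> {}}"
  proof (rule card_le_supersets[OF assms(1)])
    show "{E \<in> F. u \<in> E \<and> v \<in> E} \<subseteq> {E \<in> ksets V k. {u, v} \<subseteq> E}" using assms(2) by auto
    show "{u, v} \<subseteq> V" using True by simp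
    fix E assume "E \<in> {E \<in> F. u \<in> E \<and> v \<in> E}"
    then have "E \<inter> E0 \<noteq> {}" using crossD[OF assms(3)] E0 by blast
    then show "(E - {u, v}) \<inter> E0 \<noteq> {}" using E0 by auto
  qed
  also have "\<dots> = pair_bound (card V) k"
    using True assms E0 E0k c2 by (subst card_hitting) (auto simp: pair_bound_def card_Diff_subset numeral_2_eq_2)
  finally show ?thesis .
next
  case False
  then have e: "{E \<in> F. u \<in> E \<and> v \<in> E} = {}" using assms(2) by (auto simp: ksets_def)
  show ?thesis unfolding e by simp
qed

text \<open>Suppose shifting \<open>b\<close> to \<open>c\<close> creates a cover of size two. If it
  avoids \<open>c\<close> it already covered the old family, because a shift adds no point other
  than \<open>c\<close>. If it is \<open>{c, w}\<close>, then \<open>{c, b, w}\<close> covers the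
  old family, and the process may stop there.\<close>

lemma stable_or_cover:
  assumes "finite V" "c \<in> V" "F \<subseteq> ksets V k" "cross F F" "tau3 F"
  shows "\<exists>F'. F' \<subseteq> ksets V k \<and> card F' = card F \<and> (cross F' F' \<and> tau3 F') \<and>
    ((\<exists>x y z. \<forall>E\<in>F'. x \<in> E \<or> y \<in> E \<or> z \<in> E) \<or> (\<forall>a\<in>{c}. \<forall>b\<in>V - {c}. shift a b F' = F'))"
proof (rule shift_terminates[OF assms(1,3)])
  fix F' a b
  assume F': "F' \<subseteq> ksets V k" "cross F' F' \<and> tau3 F'" "a \<in> {c}" "b \<in> V - {c}"
    and nc: "\<not> (\<exists>x y z. \<forall>E\<in>F'. x \<in> E \<or> y \<in> E \<or> z \<in> E)"
  then have ab: "a = c" "c \<noteq> b" by auto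
  have "tau3 (shift c b F')"
  proof (rule ccontr)
    assume "\<not> tau3 (shift c b F')"
    then obtain u v where "\<forall>E\<in>shift c b F'. u \<in> E \<or> v \<in> E"
      unfolding tau3_def by blast
    then have uv: "\<And>E. E \<in> F' \<Longrightarrow> u \<in> shift_set c b F' E \<or> v \<in> shift_set c b F' E"
      by (simp add: shift_def)
    have im: "shift_set c b F' E = E \<or> (b \<in> E \<and> shift_set c b F' E = insert c (E - {b}))" for E
      by (simp add: shift_set_def)
    show False
    proof (cases "u = c \<or> v = c")
      case True
      then obtain w where w: "\<And>E. E \<in> F' \<Longrightarrow> c \<in> shift_set c b F' E \<or> w \<in> shift_set c b F' E"
        using uv by blast
      have "\<forall>E\<in>F'. c \<in> E \<or> b \<in> E \<or> w \<in> E" using w im by metis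
      then show False using nc by blast
    next
      case False
      have "u \<in> E \<or> v \<in> E" if "E \<in> F'" for E
        using uv[OF that] im[of E] False by auto
      then show False using F'(2) unfolding tau3_def by blast
    qed
  qed
  then show "cross (shift a b F') (shift a b F') \<and> tau3 (shift a b F')"
    using F'(2) ab(1) intersecting_shift[OF _ ab(2)] by simp
qed (use assms in auto)

lemma card_le_popular:
  assumes "finite B" "finite P" "\<And>d. d \<in> P \<Longrightarrow> card (del d B) \<le> t"
  shows "card B \<le> card P * t + card {E \<in> B. P \<subseteq> E}"
proof -
  have "B \<subseteq> (\<Union>d\<in>P. del d B) \<union> {E \<in> B. P \<subseteq> E}" by (auto simp: del_def)
  moreover have fd: "finite (\<Union>d\<in>P. del d B)" using assms by (auto simp: del_def)
  ultimately have "card B \<le> card ((\<Union>d\<in>P. del d B) \<union> {E \<in> B. P \<subseteq> E})"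
    using assms by (intro card_mono) auto
  also have "\<dots> \<le> card (\<Union>d\<in>P. del d B) + card {E \<in> B. P \<subseteq> E}" by (rule card_Un_le)
  also have "card (\<Union>d\<in>P. del d B) \<le> (\<Sum>d\<in>P. card (del d B))" by (rule card_UN_le[OF assms(2)])
  also have "\<dots> \<le> (\<Sum>d\<in>P. t)" by (rule sum_mono) (use assms in auto)
  finally show ?thesis by simp
qed

text \<open>The bound \<open>p < j\<close>: if \<open>j\<close> elements were each avoided by few members of \<open>del c F\<close>, then almost
  all of \<open>del c F\<close> would contain all \<open>j\<close> of them, which is too few.\<close>

lemma star_bound:
  assumes "finite V" "F \<subseteq> ksets V k" "cross F F" "tau3 F" "c \<in> V" "1 \<le> j" "j \<le> k" "2 \<le> k"
    and n: "card V = n" "3 * k \<le> n"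
    and big: "(j + 1) * ((n - 1 - j) choose (k - j)) \<le> card (del c F)"
  obtains p where "p < j" "card {E \<in> F. c \<in> E} \<le> (p + j) * pair_bound n k"
    "2 \<le> p \<Longrightarrow> card (del c F) \<le> 2 * ((n - 2 - j) choose (k - j)) + pair_bound n k"
proof -
  let ?B = "del c F" and ?X = "V - {c}" and ?t = "(n - 2 - j) choose (k - j)"
  have fF: "finite F" by (rule finite_fam[OF assms(1,2)])
  have fB: "finite ?B" using fF by (simp add: del_def)
  have N: "card ?X = n - 1" using assms by simp
  have lk: "link c F \<subseteq> ksets ?X (Suc (k - 2))"
    using link_ksets[OF assms(1,2), of c] assms(8) by (simp add: numeral_2_eq_2 Suc_diff_Suc)
  have dk: "?B \<subseteq> ksets ?X k" by (rule del_ksets[OF assms(2)])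
  obtain D where D: "D \<in> ?B" using assms(4) unfolding tau3_def del_def by blast
  have Dk: "D \<subseteq> ?X" "card D = k" "finite D" using D dk assms(1) by (auto simp: ksets_def intro: finite_subset)
  have cr: "cross (link c F) ?B"
    unfolding cross_def
  proof (intro ballI notI)
    fix A E assume AE: "A \<in> link c F" "E \<in> ?B" "A \<inter> E = {}"
    then have "insert c A \<inter> E = {}" "insert c A \<in> F" "E \<in> F" by (auto simp: link_def del_def)
    then show False using crossD[OF assms(3)] by blast
  qed
  let ?pop = "{d \<in> D. card (del d ?B) < (card ?X - 1 - j) choose (k - j)}"
  have t: "(card ?X - 1 - j) choose (k - j) = ?t" using N by (simp add: numeral_2_eq_2)
  have deg: "card {E \<in> F. c \<in> E \<and> d \<in> E} \<le> pair_bound n k" if "d \<noteq> c" for d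
    using card_two_hitting[OF assms(1-4), of c d] that n by auto
  have H: "card {E \<in> link c F. d \<in> E} \<le> pair_bound n k" if "d \<in> D" for d
  proof -
    have dc: "d \<noteq> c" using that Dk by auto
    have "{E \<in> link c F. d \<in> E} = link c {E \<in> F. d \<in> E}" using dc by (auto simp: link_def)
    then have "card {E \<in> link c F. d \<in> E} = card {E \<in> {E \<in> F. d \<in> E}. c \<in> E}" by (simp add: card_link)
    also have "{E \<in> {E \<in> F. d \<in> E}. c \<in> E} = {E \<in> F. c \<in> E \<and> d \<in> E}" by auto
    finally show ?thesis using deg[OF dc] by simp
  qed
  have main: "card (link c F) \<le> card ?pop * pair_bound n k
      + j * (((card ?X - 1) choose (k - 2)) - ((card ?X - 1 - card D) choose (k - 2)))"
    by (rule relative_bound[OF _ lk dk cr assms(7) Dk(1)])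
      (use H assms(1) N n Dk assms(8) D crossD[OF cr] in auto)
  have "((card ?X - 1) choose (k - 2)) - ((card ?X - 1 - card D) choose (k - 2)) = pair_bound n k"
    unfolding N Dk pair_bound_def by (simp add: numeral_2_eq_2)
  then have 2: "card {E \<in> F. c \<in> E} \<le> (card ?pop + j) * pair_bound n k"
    using main by (simp add: card_link distrib_right)
  have few: "card ?B \<le> card P * ?t + card {E \<in> ?B. P \<subseteq> E}" if "P \<subseteq> ?pop" for P
    by (rule card_le_popular[OF fB]) (use that Dk(3) t in \<open>auto intro: finite_subset less_imp_le\<close>)
  have 1: "card ?pop < j"
  proof (rule ccontr)
    assume "\<not> ?thesis"
    then have "j \<le> card ?pop" by simp
    then obtain P where P: "P \<subseteq> ?pop" "card P = j" "finite P" by (rule obtain_subset_with_card_n)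
    have PX: "P \<subseteq> ?X" using P Dk by auto
    obtain d where d: "d \<in> P" using P assms(6) by fastforce
    have "1 \<le> ?t" using d P t by (metis (no_types, lifting) One_nat_def Suc_leI gr_zeroI mem_Collect_eq not_less_zero subsetD)
    \<comment> \<open>Popularity is a strict inequality; the saved unit per element makes the final
      comparison with \<open>big\<close> strict.\<close>
    have "card ?B \<le> j * (?t - 1) + card {E \<in> ?B. P \<subseteq> E}"
    proof -
      have "card (del d ?B) \<le> ?t - 1" if "d \<in> P" for d
      proof -
        have "card (del d ?B) < ?t" using that P(1) t by auto
        then show ?thesis by simp
      qed
      from card_le_popular[OF fB P(3) this] show ?thesis unfolding P(2) .
    qed
    also have "card {E \<in> ?B. P \<subseteq> E} \<le> (n - 1 - j) choose (k - j)"
      using card_supersets[OF _ dk PX] assms(1) P N by simp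
    also have "j * (?t - 1) < j * ?t" using \<open>1 \<le> ?t\<close> assms(6) by simp
    also have "?t \<le> (n - 1 - j) choose (k - j)" by (rule binomial_right_mono) simp
    finally show False using big by simp
  qed
  have 3: "card ?B \<le> 2 * ?t + pair_bound n k" if two: "2 \<le> card ?pop"
  proof -
    obtain P where P: "P \<subseteq> ?pop" "card P = 2" "finite P" by (rule obtain_subset_with_card_n[OF two])
    obtain d e where de: "P = {d, e}" "d \<noteq> e" using P by (auto simp: card_2_iff)
    have "{E \<in> ?B. P \<subseteq> E} \<subseteq> {E \<in> F. d \<in> E \<and> e \<in> E}" using de by (auto simp: del_def)
    then have "card {E \<in> ?B. P \<subseteq> E} \<le> card {E \<in> F. d \<in> E \<and> e \<in> E}" using fF by (intro card_mono) auto
    also have "\<dots> \<le> pair_bound n k" using card_two_hitting[OF assms(1-4) de(2)] n by simp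
    finally show ?thesis using few[OF P(1)] P(2) by simp
  qed
  show ?thesis by (rule that[OF 1 2 3])
qed

text \<open>A popular element for \<open>B\<close>, one that few members of \<open>B\<close> avoid, must be popular for \<open>A\<close> as well,
  because otherwise \<open>cross_bound\<close> makes the link of \<open>B\<close> small.\<close>

lemma popular_transfer:
  assumes "finite Y" "A \<subseteq> ksets Y r" "B \<subseteq> ksets Y r" "cross A B" "2 \<le> r" "3 * r \<le> card Y" "z \<in> Y"
    and u: "u = (card Y - 2) choose (r - 2)"
    and big: "3 * u \<le> card B" and pop: "card (del z B) < (card Y - 3) choose (r - 2)"
  shows "card (del z A) < (card Y - 3) choose (r - 2)"
proof (rule ccontr)
  let ?m = "card Y"
  assume c: "\<not> ?thesis"
  have m: "card (Y - {z}) = ?m - 1" using assms by simp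
  have cr: "cross (link z B) (del z A)" using assms(4) unfolding cross_def link_def del_def by fastforce
  have "card (link z B) + ((card (Y - {z}) - card ({}::'a set) - 2) choose (r - 1)) \<le> (card (Y - {z}) - card ({}::'a set)) choose (r - 1)"
  proof (rule cross_bound[OF _ _ _ del_ksets[OF assms(2)] cr])
    show "r - 1 + r + card ({}::'a set) \<le> card (Y - {z})" using m assms(5,6) by simp
    show "(card (Y - {z}) - 2) choose (r - 2) \<le> card (del z A)"
      using c unfolding m by (simp add: numeral_eq_Suc)
  qed (use assms(1,5) link_ksets[OF assms(1,3), of z] in auto)
  then have 1: "card (link z B) + ((?m - 3) choose (r - 1)) \<le> (?m - 1) choose (r - 1)" using m by (simp add: numeral_eq_Suc)
  have 2: "(?m - 1) choose (r - 1) = ((?m - 2) choose (r - 2)) + ((?m - 2) choose (r - 1))"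
    "(?m - 2) choose (r - 1) = ((?m - 3) choose (r - 2)) + ((?m - 3) choose (r - 1))"
    using choose_reduce_nat[of "?m - 1" "r - 1"] choose_reduce_nat[of "?m - 2" "r - 1"] assms(5,6) by (simp_all add: numeral_eq_Suc)
  have "(?m - 3) choose (r - 2) \<le> u" unfolding u by (rule binomial_right_mono) simp
  then show False using card_link_del[OF finite_fam[OF assms(1,3)], of z] 1 2 big pop u by linarith
qed

text \<open>If some point is popular for one of \<open>A\<close>, \<open>B\<close>, it is popular
  for both, so each has at most H members through it and fewer than \<open>u\<close> others. If
  there is none, \<open>relative_bound\<close> with \<open>j\<close> = 2 and a member of
  \<open>C\<close> as \<open>D\<close> has no popular elements to pay for.\<close>

lemma three_cross_families:
  assumes "finite Y" "A \<subseteq> ksets Y r" "B \<subseteq> ksets Y r" "C \<subseteq> ksets Y r"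
    and "cross A B" "cross A C" "cross B C" "C \<noteq> {}" "2 \<le> r" "3 * r \<le> card Y"
    and "\<And>z. z \<in> Y \<Longrightarrow> card {E \<in> A. z \<in> E} \<le> H" "\<And>z. z \<in> Y \<Longrightarrow> card {E \<in> B. z \<in> E} \<le> H"
    and u: "u = (card Y - 2) choose (r - 2)"
    and "3 * u \<le> card A" "3 * u \<le> card B" "u \<le> H"
    and H: "((card Y - 1) choose (r - 1)) - ((card Y - 1 - r) choose (r - 1)) \<le> H"
  shows "card A \<le> 2 * H \<and> card B \<le> 2 * H"
proof -
  let ?t = "(card Y - 3) choose (r - 2)"
  have tu: "?t \<le> u" unfolding u by (rule binomial_right_mono) simp
  have sym: "cross B A" using assms(5) by (auto simp: cross_def)
  show ?thesis
  proof (cases "\<exists>z\<in>Y. card (del z A) < ?t \<or> card (del z B) < ?t")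
    case True
    then obtain z where z: "z \<in> Y" "card (del z A) < ?t" "card (del z B) < ?t"
      using popular_transfer[OF assms(1,2,3,5,9,10) _ u] popular_transfer[OF assms(1,3,2) sym assms(9,10) _ u] assms(14,15)
      by blast
    have "card A \<le> card {E \<in> A. z \<in> E} + card (del z A)" "card B \<le> card {E \<in> B. z \<in> E} + card (del z B)"
      using card_link_del[OF finite_fam[OF assms(1,2)]] card_link_del[OF finite_fam[OF assms(1,3)]]
      by (simp_all add: card_link)
    then show ?thesis using assms(11,12)[OF z(1)] z tu assms(16) by linarith
  next
    case False
    obtain D where D: "D \<in> C" using assms(8) by auto
    have Dk: "D \<subseteq> Y" "card D = r" using D assms(4) by (auto simp: ksets_def)
    have gen: "card A \<le> 2 * H"
      if A: "A \<subseteq> ksets Y r" "cross A C" "cross A B" "B \<subseteq> ksets Y r" and nb: "\<And>z. z \<in> Y \<Longrightarrow> \<not> card (del z B) < ?t" for A B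
    proof -
      have t: "(card Y - 1 - 2) choose (r - 2) = ?t" by (simp add: numeral_eq_Suc)
      have A': "A \<subseteq> ksets Y (Suc (r - 1))" using A(1) assms(9) by simp
      have "card A \<le> card {d \<in> D. card (del d B) < (card Y - 1 - 2) choose (r - 2)} * H
         + 2 * (((card Y - 1) choose (r - 1)) - ((card Y - 1 - card D) choose (r - 1)))"
        by (rule relative_bound[OF assms(1) A' A(4,3) assms(9) Dk(1)])
          (use nb t Dk assms(9,10) crossD[OF A(2) _ D] in auto)
      moreover have "{d \<in> D. card (del d B) < (card Y - 1 - 2) choose (r - 2)} = {}"
        using nb Dk t by auto
      then have "card {d \<in> D. card (del d B) < (card Y - 1 - 2) choose (r - 2)} = 0" by (simp only: card.empty)
      ultimately show ?thesis using H Dk(2) by simp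
    qed
    show ?thesis using gen[OF assms(2,6,5,3)] gen[OF assms(3,7) sym assms(2)] False by blast
  qed
qed

text \<open>The classes meeting the cover only in \<open>x\<close>, \<open>y\<close> or
  \<open>z\<close> are cross-intersecting outside it. If the middle one is large, all three have
  size at most 2H, and with the three pairs the total is 9H. Otherwise only the class of
  \<open>x\<close> can be large.\<close>

lemma cover_concentration:
  assumes "finite V" "F \<subseteq> ksets V k" "cross F F" "tau3 F" "card V = n" "3 * k \<le> n" "3 \<le> k"
    and xyz: "x \<noteq> y" "x \<noteq> z" "y \<noteq> z" "\<And>E. E \<in> F \<Longrightarrow> x \<in> E \<or> y \<in> E \<or> z \<in> E"
    and T: "T = {x, y, z}"
    and ord: "card {E \<in> F. E \<inter> T = {y}} \<le> card {E \<in> F. E \<inter> T = {x}}"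
      "card {E \<in> F. E \<inter> T = {z}} \<le> card {E \<in> F. E \<inter> T = {y}}"
    and H: "(n - 5) choose (k - 3) \<le> pair_bound n k"
      "((n - 4) choose (k - 2)) - ((n - 3 - k) choose (k - 2)) \<le> pair_bound n k"
  shows "card F \<le> 9 * pair_bound n k \<or>
    card (del x F) \<le> 6 * ((n - 5) choose (k - 3)) + pair_bound n k"
proof -
  let ?H = "pair_bound n k" and ?u = "(n - 5) choose (k - 3)" and ?Y = "V - T"
  define S where "S w = {E \<in> F. E \<inter> T = {w}}" for w
  define L where "L w = (\<lambda>E. E - T) ` S w" for w
  have fF: "finite F" by (rule finite_fam[OF assms(1,2)])
  have fS: "finite (S w)" for w using fF by (simp add: S_def)
  have TV: "T \<subseteq> V"
  proof -
    obtain E1 where "E1 \<in> F" "x \<notin> E1" "y \<notin> E1" using assms(4) unfolding tau3_def by blast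
    moreover obtain E2 where "E2 \<in> F" "x \<notin> E2" "z \<notin> E2" using assms(4) unfolding tau3_def by blast
    moreover obtain E3 where "E3 \<in> F" "y \<notin> E3" "z \<notin> E3" using assms(4) unfolding tau3_def by blast
    ultimately have "z \<in> V" "y \<in> V" "x \<in> V" using xyz(4) assms(2) unfolding ksets_def by blast+
    then show ?thesis using T by auto
  qed
  have cT: "card T = 3" using xyz T by simp
  have m: "card ?Y = n - 3" using TV cT assms(1,5) by (simp add: card_Diff_subset finite_subset[OF TV])
  have inj: "inj_on (\<lambda>E. E - T) (S w)" for w
  proof (rule inj_onI)
    fix E E' assume "E \<in> S w" "E' \<in> S w" "E - T = E' - T"
    then have "E \<inter> T = E' \<inter> T" "E - T = E' - T" by (auto simp: S_def)
    then show "E = E'" by blast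
  qed
  have cL: "card (L w) = card (S w)" for w unfolding L_def by (rule card_image[OF inj])
  have Lk: "L w \<subseteq> ksets ?Y (k - 1)" for w
  proof
    fix A assume "A \<in> L w"
    then obtain E where E: "E \<in> F" "E \<inter> T = {w}" "A = E - T" by (auto simp: L_def S_def)
    then have "E \<in> ksets V k" using assms(2) by auto
    then have Ek: "E \<subseteq> V" "card E = k" "finite E" using ksetsD ksets_finiteD[OF assms(1)] by auto
    have "E - T = E - {w}" using E(2) by auto
    moreover have "w \<in> E" using E(2) by auto
    ultimately have "card A = k - 1" using E(3) Ek by simp
    then show "A \<in> ksets ?Y (k - 1)" using E Ek by (auto simp: ksets_def)
  qed
  have Lcr: "cross (L v) (L w)" if "v \<noteq> w" for v w
    unfolding cross_def
  proof (intro ballI notI)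
    fix A A' assume "A \<in> L v" "A' \<in> L w" "A \<inter> A' = {}"
    then obtain E E' where E: "E \<in> F" "E \<inter> T = {v}" "A = E - T" "E' \<in> F" "E' \<inter> T = {w}" "A' = E' - T"
      by (auto simp: L_def S_def)
    have "(E \<inter> T) \<inter> (E' \<inter> T) = {}" using that unfolding E(2,5) by auto
    moreover have "(E - T) \<inter> (E' - T) = {}" using \<open>A \<inter> A' = {}\<close> E(3,6) by simp
    ultimately have "E \<inter> E' = {}" by blast
    then show False using crossD[OF assms(3)] E by blast
  qed
  have two: "card {E \<in> F. u \<in> E \<and> v \<in> E} \<le> ?H" if "u \<noteq> v" for u v
    using card_two_hitting[OF assms(1-4) that] assms(5) by simp
  have Ldeg: "card {A \<in> L w. q \<in> A} \<le> ?H" if "w \<in> T" "q \<in> ?Y" for w q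
  proof -
    have "{A \<in> L w. q \<in> A} \<subseteq> (\<lambda>E. E - T) ` {E \<in> F. w \<in> E \<and> q \<in> E}" by (auto simp: L_def S_def)
    then have "card {A \<in> L w. q \<in> A} \<le> card {E \<in> F. w \<in> E \<and> q \<in> E}" using fF by (intro surj_card_le) auto
    also have "\<dots> \<le> ?H" by (rule two) (use that in auto)
    finally show ?thesis .
  qed
  have "L z \<noteq> {}"
  proof -
    obtain E where E: "E \<in> F" "x \<notin> E" "y \<notin> E" using assms(4) unfolding tau3_def by blast
    then have "E \<in> S z" using xyz T by (auto simp: S_def)
    then show ?thesis by (auto simp: L_def)
  qed
  have sq: "card ?Y - 2 = n - 5" "k - 1 - 2 = k - 3" "card ?Y - 1 = n - 4" "k - 1 - 1 = k - 2"
    "n - 4 - (k - 1) = n - 3 - k" using m assms(6,7) by auto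
  have dx: "card (del x F) \<le> card (S y) + card (S z) + ?H"
  proof -
    have "del x F \<subseteq> S y \<union> S z \<union> {E \<in> F. y \<in> E \<and> z \<in> E}" using xyz T by (auto simp: del_def S_def)
    then have "card (del x F) \<le> card (S y \<union> S z \<union> {E \<in> F. y \<in> E \<and> z \<in> E})" using fF fS by (intro card_mono) auto
    also have "\<dots> \<le> card (S y \<union> S z) + card {E \<in> F. y \<in> E \<and> z \<in> E}" by (rule card_Un_le)
    also have "card (S y \<union> S z) \<le> card (S y) + card (S z)" by (rule card_Un_le)
    finally show ?thesis using two[OF xyz(3)] by linarith
  qed
  have all: "card F \<le> card (del x F) + card (S x) + 2 * ?H"
  proof -
    have "F \<subseteq> del x F \<union> S x \<union> {E \<in> F. x \<in> E \<and> y \<in> E} \<union> {E \<in> F. x \<in> E \<and> z \<in> E}"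
      using T by (auto simp: del_def S_def)
    then have "card F \<le> card (del x F \<union> S x \<union> {E \<in> F. x \<in> E \<and> y \<in> E} \<union> {E \<in> F. x \<in> E \<and> z \<in> E})"
      using fF fS by (intro card_mono) (auto simp: del_def)
    also have "\<dots> \<le> card (del x F \<union> S x \<union> {E \<in> F. x \<in> E \<and> y \<in> E}) + card {E \<in> F. x \<in> E \<and> z \<in> E}" by (rule card_Un_le)
    also have "card (del x F \<union> S x \<union> {E \<in> F. x \<in> E \<and> y \<in> E}) \<le> card (del x F \<union> S x) + card {E \<in> F. x \<in> E \<and> y \<in> E}" by (rule card_Un_le)
    also have "card (del x F \<union> S x) \<le> card (del x F) + card (S x)" by (rule card_Un_le)
    finally show ?thesis using two[OF xyz(1)] two[OF xyz(2)] by linarith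
  qed
  show ?thesis
  proof (cases "3 * ?u \<le> card (S y)")
    case True
    have "card (L x) \<le> 2 * ?H \<and> card (L y) \<le> 2 * ?H"
    proof (rule three_cross_families[OF _ Lk Lk Lk Lcr Lcr Lcr \<open>L z \<noteq> {}\<close>])
      show "finite ?Y" using assms(1) by simp
      show "2 \<le> k - 1" using assms(7) by simp
      show "3 * (k - 1) \<le> card ?Y" using m assms(6,7) by simp
      show "3 * ?u \<le> card (L x)" using True ord by (simp add: cL S_def)
      show "3 * ?u \<le> card (L y)" using True by (simp add: cL)
      show "?u = (card ?Y - 2) choose (k - 1 - 2)" unfolding sq ..
      show "((card ?Y - 1) choose (k - 1 - 1)) - ((card ?Y - 1 - (k - 1)) choose (k - 1 - 1)) \<le> ?H"
        unfolding sq by (rule H(2))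
    qed (use xyz(1-3) H(1) Ldeg T in auto)
    then have "card (S x) \<le> 2 * ?H" "card (S y) \<le> 2 * ?H" "card (S z) \<le> 2 * ?H"
      using ord by (auto simp: cL S_def)
    then show ?thesis using dx all by linarith
  next
    case False
    then have "card (S z) \<le> 3 * ?u" "card (S y) \<le> 3 * ?u" using ord by (auto simp: S_def)
    then show ?thesis using dx by linarith
  qed
qed

lemma cover_concentration':
  assumes "finite V" "F \<subseteq> ksets V k" "cross F F" "tau3 F" "card V = n" "3 * k \<le> n" "3 \<le> k"
    and cover: "\<And>E. E \<in> F \<Longrightarrow> x \<in> E \<or> y \<in> E \<or> z \<in> E"
    and H: "(n - 5) choose (k - 3) \<le> pair_bound n k"
      "((n - 4) choose (k - 2)) - ((n - 3 - k) choose (k - 2)) \<le> pair_bound n k"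
  shows "card F \<le> 9 * pair_bound n k \<or>
    (\<exists>c\<in>V. card (del c F) \<le> 6 * ((n - 5) choose (k - 3)) + pair_bound n k)"
proof -
  have ne: "x \<noteq> y" "x \<noteq> z" "y \<noteq> z" using assms(4) cover unfolding tau3_def by metis+
  have inV: "c \<in> V \<or> card (del c F) = card F" for c
  proof -
    have "del c F = F" if "c \<notin> V" using that assms(2) by (auto simp: del_def ksets_def)
    then show ?thesis by (cases "c \<in> V") auto
  qed
  define s where "s w = card {E \<in> F. E \<inter> {x, y, z} = {w}}" for w
  have perm: "card F \<le> 9 * pair_bound n k \<or> card (del a F) \<le> 6 * ((n - 5) choose (k - 3)) + pair_bound n k"
    if "{a, b, c} = {x, y, z}" "a \<noteq> b" "a \<noteq> c" "b \<noteq> c" "s b \<le> s a" "s c \<le> s b" for a b c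
  proof (rule cover_concentration[OF assms(1-7) that(2-4) _ that(1)[symmetric]])
    fix E assume "E \<in> F"
    then have "E \<inter> {a, b, c} \<noteq> {}" using cover[of E] unfolding that(1) by auto
    then show "a \<in> E \<or> b \<in> E \<or> c \<in> E" by auto
  qed (use that(5,6) H in \<open>auto simp: s_def\<close>)
  have "card F \<le> 9 * pair_bound n k \<or> (\<exists>c\<in>{x, y, z}. card (del c F) \<le> 6 * ((n - 5) choose (k - 3)) + pair_bound n k)"
  proof -
    consider "s y \<le> s x" "s z \<le> s y" | "s z \<le> s x" "s y \<le> s z" | "s x \<le> s y" "s z \<le> s x"
      | "s z \<le> s y" "s x \<le> s z" | "s x \<le> s z" "s y \<le> s x" | "s y \<le> s z" "s x \<le> s y" by linarith
    then show ?thesis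
    proof cases
      case 1 show ?thesis using perm[OF _ ne(1,2,3) 1] by blast
    next
      case 2 show ?thesis using perm[OF _ ne(2,1) ne(3)[symmetric] 2] by blast
    next
      case 3 show ?thesis using perm[OF _ ne(1)[symmetric] ne(3,2) 3] by blast
    next
      case 4 show ?thesis using perm[OF _ ne(3) ne(1,2)[symmetric] 4] by blast
    next
      case 5 show ?thesis using perm[OF _ ne(2,3)[symmetric] ne(1) 5] by blast
    next
      case 6 show ?thesis using perm[OF _ ne(3,2)[symmetric] ne(1)[symmetric] 6] by blast
    qed
  qed
  moreover have "{x, y, z} \<subseteq> V"
  proof -
    obtain E1 where "E1 \<in> F" "x \<notin> E1" "y \<notin> E1" using assms(4) unfolding tau3_def by blast
    moreover obtain E2 where "E2 \<in> F" "x \<notin> E2" "z \<notin> E2" using assms(4) unfolding tau3_def by blast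
    moreover obtain E3 where "E3 \<in> F" "y \<notin> E3" "z \<notin> E3" using assms(4) unfolding tau3_def by blast
    ultimately have "z \<in> V" "y \<in> V" "x \<in> V" using cover assms(2) unfolding ksets_def by blast+
    then show ?thesis by auto
  qed
  ultimately show ?thesis by blast
qed

text \<open>The two size conditions 4 C(n-4, k-3) and 5 C(n-5, k-4) on the members avoiding
  \<open>c\<close> are those of \<open>star_bound\<close> for \<open>j\<close> = 3 and
  \<open>j\<close> = 4. The stronger \<open>j\<close> = 3 limits the star when many members avoid
  \<open>c\<close>; \<open>j\<close> = 4 suffices when there are fewer.\<close>

theorem concentration:
  assumes "finite V" "F \<subseteq> ksets V k" "cross F F" "tau3 F" "card V = n" "3 * k \<le> n" "4 \<le> k"
    and H: "2 * ((n - 4) choose (k - 3)) \<le> pair_bound n k"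
      "((n - 4) choose (k - 2)) - ((n - 3 - k) choose (k - 2)) \<le> pair_bound n k"
  shows "card F \<le> 9 * pair_bound n k \<or>
    (\<exists>F' c. F' \<subseteq> ksets V k \<and> cross F' F' \<and> tau3 F' \<and> card F' = card F \<and> c \<in> V \<and>
       card (del c F') < 5 * ((n - 5) choose (k - 4)))"
proof -
  let ?H = "pair_bound n k"
  have mono: "(n - 5) choose (k - 3) \<le> (n - 4) choose (k - 3)" by (rule binomial_right_mono) simp
  have "V \<noteq> {}" using assms(5-7) by auto
  then obtain c0 where c0: "c0 \<in> V" by auto
  obtain F' where F': "F' \<subseteq> ksets V k" "card F' = card F" "cross F' F'" "tau3 F'"
    and alt: "(\<exists>x y z. \<forall>E\<in>F'. x \<in> E \<or> y \<in> E \<or> z \<in> E) \<or> (\<forall>b\<in>V - {c0}. shift c0 b F' = F')"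
    using stable_or_cover[OF assms(1) c0 assms(2-4)] by auto
  have fF: "finite F'" by (rule finite_fam[OF assms(1) F'(1)])
  have split: "card F' = card {E \<in> F'. c \<in> E} + card (del c F')" for c
    using card_link_del[OF fF, of c] by (simp add: card_link)
  consider (1) "card F' \<le> 9 * ?H" | (2) c where "c \<in> V"
      "card (del c F') \<le> 6 * ((n - 5) choose (k - 3)) + ?H \<or> card (del c F') \<le> card {E \<in> F'. c \<in> E}"
  proof (cases "\<exists>x y z. \<forall>E\<in>F'. x \<in> E \<or> y \<in> E \<or> z \<in> E")
    case True
    then obtain x y z where "\<And>E. E \<in> F' \<Longrightarrow> x \<in> E \<or> y \<in> E \<or> z \<in> E" by blast
    from cover_concentration'[OF assms(1) F'(1,3,4) assms(5,6) _ this] 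
    show ?thesis using that mono H assms(7) by fastforce
  next
    case False
    then have st: "\<And>b. b \<in> V - {c0} \<Longrightarrow> shift c0 b F' = F'" using alt by blast
    have "shadow (del c0 F') \<subseteq> link c0 F'"
    proof
      fix A assume "A \<in> shadow (del c0 F')"
      then obtain E y where E: "E \<in> F'" "c0 \<notin> E" "y \<in> E" "A = E - {y}" by (auto simp: shadow_def del_def)
      then have "y \<in> V - {c0}" using F' by (auto simp: ksets_def)
      then show "A \<in> link c0 F'" using stableD[OF st E(1)] E by (auto simp: link_def)
    qed
    then have "card (shadow (del c0 F')) \<le> card (link c0 F')"
      using finite_fam[OF _ link_ksets[OF assms(1) F'(1)]] assms(1) by (intro card_mono) auto
    moreover have "card (del c0 F') \<le> card (shadow (del c0 F'))"
      by (rule card_le_shadow[OF _ del_ksets[OF F'(1)]]) (use assms F'(3) in \<open>auto simp: cross_def del_def\<close>)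
    ultimately show ?thesis using that(2)[OF c0] by (simp add: card_link)
  qed
  then show ?thesis
  proof cases
    case 1 then show ?thesis using F' by simp
  next
    case 2
    show ?thesis
    proof (cases "card (del c F') < 5 * ((n - 5) choose (k - 4))")
      case True then show ?thesis using F' 2 by blast
    next
      case False
      have "card F' \<le> 9 * ?H"
      \<comment> \<open>For \<open>j\<close> = 3: with two popular elements at most 5H contain
        \<open>c\<close> and 2H avoid it; with fewer, at most 4H each, since 6 C(n-5, k-3) is at
        most 3H.\<close>
      proof (cases "4 * ((n - 4) choose (k - 3)) \<le> card (del c F')")
        case True
        then have "(3 + 1) * ((n - 1 - 3) choose (k - 3)) \<le> card (del c F')" by (simp add: numeral_eq_Suc)
        from star_bound[OF assms(1) F'(1,3,4) 2(1) _ _ _ assms(5,6) this] 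
        obtain p where p: "p < 3" "card {E \<in> F'. c \<in> E} \<le> (p + 3) * ?H"
          "2 \<le> p \<Longrightarrow> card (del c F') \<le> 2 * ((n - 2 - 3) choose (k - 3)) + ?H" using assms(7) by auto
        have n5: "n - 2 - 3 = n - 5" by simp
        show ?thesis
        proof (cases "2 \<le> p")
          case True
          then have "p = 2" using p by simp
          then show ?thesis using split[of c] p mono H n5 by simp
        next
          case False
          then have "(p + 3) * ?H \<le> 4 * ?H" by (intro mult_right_mono) auto
          then show ?thesis using split[of c] p(2) 2(2) mono H by linarith
        qed
      next
        case small: False
        \<comment> \<open>For \<open>j\<close> = 4: at most three popular elements give 7H through
          \<open>c\<close>, and fewer than 4 C(n-4, k-3), hence at most 2H, avoid
          \<open>c\<close>.\<close>
        have "(4 + 1) * ((n - 1 - 4) choose (k - 4)) \<le> card (del c F')" using False by (simp add: numeral_eq_Suc)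
        from star_bound[OF assms(1) F'(1,3,4) 2(1) _ _ _ assms(5,6) this] 
        obtain p where p: "p < 4" "card {E \<in> F'. c \<in> E} \<le> (p + 4) * ?H" using assms(7) by auto
        have "(p + 4) * ?H \<le> 7 * ?H" using p(1) by (intro mult_right_mono) auto
        then show ?thesis using split[of c] p(2) small H by linarith
      qed
      then show ?thesis using F' by simp
    qed
  qed
qed

section \<open>Transversals of an intersecting family without a common element\<close>

lemma card_hitting_two:
  assumes "finite Y" "P \<subseteq> Y" "Q \<subseteq> Y" "P \<inter> Q = {}"
  shows "int (card {T \<in> ksets Y r. T \<inter> P \<noteq> {} \<and> T \<inter> Q \<noteq> {}})
    = int (card Y choose r) - int ((card Y - card P) choose r) - int ((card Y - card Q) choose r)
      + int ((card Y - card P - card Q) choose r)"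
proof -
  have fin: "finite P" "finite Q" using finite_subset[OF _ assms(1)] assms(2,3) by auto
  let ?H = "{T \<in> ksets Y r. T \<inter> P \<noteq> {} \<and> T \<inter> Q \<noteq> {}}"
  let ?MP = "ksets (Y - P) r" and ?MQ = "ksets (Y - Q) r"
  have un: "ksets Y r = ?H \<union> (?MP \<union> ?MQ)" by (auto simp: ksets_def)
  have dis: "?H \<inter> (?MP \<union> ?MQ) = {}" by (auto simp: ksets_def)
  have f: "finite ?H" "finite ?MP" "finite ?MQ" using assms(1) by auto
  have i: "?MP \<inter> ?MQ = ksets (Y - (P \<union> Q)) r" by (auto simp: ksets_def)
  have c1: "card (ksets Y r) = card ?H + card (?MP \<union> ?MQ)"
    by (subst un, rule card_Un_disjoint) (use f dis in auto)
  have c2: "card ?MP + card ?MQ = card (?MP \<union> ?MQ) + card (?MP \<inter> ?MQ)"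
    by (rule card_Un_Int) (use f in auto)
  have s: "card (Y - P) = card Y - card P" "card (Y - Q) = card Y - card Q"
    "card (Y - (P \<union> Q)) = card Y - card P - card Q"
    using assms fin by (simp_all add: card_Diff_subset card_Un_disjoint)
  have "card (ksets Y r) = card Y choose r" "card ?MP = (card Y - card P) choose r"
    "card ?MQ = (card Y - card Q) choose r" "card (?MP \<inter> ?MQ) = (card Y - card P - card Q) choose r"
    unfolding i using assms(1) s by (simp_all add: card_ksets)
  then show ?thesis using c1 c2 by linarith
qed

text \<open>Supplies the lower bounds for families of lost transversals, and for the corresponding
  part of the extremal family.\<close>

lemma card_through_avoiding:
  assumes "finite Y" "P \<subseteq> Y" "card P \<le> r" "P \<inter> Q = {}" "finite Q"
  shows "(card Y - card P - card Q) choose (r - card P) \<le> card {T \<in> ksets Y r. P \<subseteq> T \<and> T \<inter> Q = {}}"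
proof -
  have fP: "finite P" by (rule finite_subset[OF assms(2,1)])
  have "card (ksets (Y - P - Q) (r - card P)) \<le> card {T \<in> ksets Y r. P \<subseteq> T \<and> T \<inter> Q = {}}"
  proof (rule card_inj_on_le[of "\<lambda>T. T \<union> P"])
    show "inj_on (\<lambda>T. T \<union> P) (ksets (Y - P - Q) (r - card P))"
      by (rule inj_onI) (auto simp: ksets_def)
    show "(\<lambda>T. T \<union> P) ` ksets (Y - P - Q) (r - card P) \<subseteq> {T \<in> ksets Y r. P \<subseteq> T \<and> T \<inter> Q = {}}"
    proof
      fix S assume "S \<in> (\<lambda>T. T \<union> P) ` ksets (Y - P - Q) (r - card P)"
      then obtain T where T: "T \<subseteq> Y - P - Q" "card T = r - card P" "S = T \<union> P" by (auto simp: ksets_def)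
      then have "finite T" using assms(1) finite_subset by blast
      then have "card S = r" using T fP assms(3) by (subst T(3), subst card_Un_disjoint) auto
      then show "S \<in> {T \<in> ksets Y r. P \<subseteq> T \<and> T \<inter> Q = {}}"
        using T assms(2,4) by (auto simp: ksets_def)
    qed
    show "finite {T \<in> ksets Y r. P \<subseteq> T \<and> T \<inter> Q = {}}" using assms(1) by simp
  qed
  moreover have "card Y - card P - card Q \<le> card (Y - P - Q)"
    using diff_card_le_card_Diff[OF assms(5), of "Y - P"] card_Diff_subset[OF fP assms(2)] by simp
  ultimately show ?thesis
    using binomial_right_mono card_ksets[of "Y - P - Q" "r - card P"] assms(1)
    by (metis (no_types, lifting) dual_order.trans finite_Diff)
qed

text \<open>With N = n - 1 this is the sum of two bounds: for transversals meeting the kernel of two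
  members whose intersection has size \<open>t\<close>, and for those missing it. The terms C(N-t,
  k-1) cancel.\<close>

definition transversal_bound :: "nat \<Rightarrow> nat \<Rightarrow> nat \<Rightarrow> int" where
  "transversal_bound N k t = int (N choose (k - 1)) - 3 * int ((N - k) choose (k - 1))
     + int ((N - k - t) choose (k - 1)) + int ((N - 2 * k + t) choose (k - 1))"

text \<open>\<open>relative_bound_aux\<close> with \<open>j = k\<close>: its size condition only asks that some member of \<open>B\<close>
  avoids \<open>d\<close>.\<close>

lemma card_hitting_kernel:
  assumes "finite X" "A \<subseteq> ksets X (k - 1)" "B \<subseteq> ksets X k" "cross A B" "2 \<le> k" "3 * k \<le> card X"
    and "\<And>x. \<exists>E\<in>B. x \<notin> E" "T \<subseteq> X" "card T \<le> k"
  shows "int (card {E \<in> A. E \<inter> T \<noteq> {}}) \<le> int (card X choose (k - 1)) - int ((card X - card T) choose (k - 1))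
         - (int ((card X - k) choose (k - 1)) - int ((card X - k - card T) choose (k - 1)))"
proof -
  have k1: "Suc (k - 2) = k - 1" using assms(5) by simp
  have fT: "finite T" by (rule finite_subset[OF assms(8,1)])
  have ne: "\<not> card (del d B) < (card X - 1 - k) choose (k - k)" for d
  proof -
    have "del d B \<noteq> {}" using assms(7)[of d] by (auto simp: del_def)
    moreover have "finite (del d B)" using finite_fam[OF assms(1,3)] by (simp add: del_def)
    ultimately show ?thesis by (simp add: card_gt_0_iff)
  qed
  have "int (card {E \<in> A. E \<inter> {} = {} \<and> E \<inter> T \<noteq> {}})
    \<le> int (card {d \<in> T. card (del d B) < (card X - 1 - k) choose (k - k)}) * int 0
      + (int ((card X - card ({}::'a set)) choose Suc (k - 2)) - int ((card X - card ({}::'a set) - card T) choose Suc (k - 2))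
         - (int ((card X - card ({}::'a set) - k) choose Suc (k - 2)) - int ((card X - card ({}::'a set) - k - card T) choose Suc (k - 2))))"
  proof (rule relative_bound_aux[OF fT assms(1) _ assms(3,4)])
    show "A \<subseteq> ksets X (Suc (k - 2))" unfolding k1 by (rule assms(2))
    show "card {E \<in> A. d \<in> E} \<le> 0" if "card (del d B) < (card X - 1 - k) choose (k - k)" for d
      using ne that by blast
  qed (use assms(5,6,8,9) in auto)
  moreover have "{d \<in> T. card (del d B) < (card X - 1 - k) choose (k - k)} = {}" using ne by blast
  ultimately show ?thesis unfolding k1 by simp
qed

text \<open>Without the kernel a transversal must hit both differences \<open>P - Q\<close> and
  \<open>Q - P\<close>, which inclusion-exclusion counts. \<open>Lost\<close> collects sets of this
  kind that a further member of \<open>B\<close> is known to exclude.\<close>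

lemma card_missing_kernel_le:
  assumes "finite X" "A \<subseteq> ksets X (k - 1)" "B \<subseteq> ksets X k" "cross A B" "2 \<le> k" "3 * k \<le> card X"
    and "P \<in> B" "Q \<in> B"
    and L: "Lost \<subseteq> {E \<in> ksets (X - (P \<inter> Q)) (k - 1). E \<inter> (P - Q) \<noteq> {} \<and> E \<inter> (Q - P) \<noteq> {}}" "Lost \<inter> A = {}"
  shows "int (card {E \<in> A. E \<inter> (P \<inter> Q) = {}}) + int (card Lost) \<le> int ((card X - card (P \<inter> Q)) choose (k - 1))
    - 2 * int ((card X - k) choose (k - 1)) + int ((card X - 2 * k + card (P \<inter> Q)) choose (k - 1))"
proof -
  let ?N = "card X" and ?t = "card (P \<inter> Q)" and ?Y = "X - (P \<inter> Q)"
  have PQ: "P \<subseteq> X" "Q \<subseteq> X" "card P = k" "card Q = k" "finite P" "finite Q"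
    using assms(1,3,7,8) by (auto simp: ksets_def intro: finite_subset)
  have t: "?t \<le> k" using PQ card_mono[of P "P \<inter> Q"] by auto
  have fA: "finite A" by (rule finite_fam[OF assms(1,2)])
  let ?H = "{E \<in> ksets ?Y (k - 1). E \<inter> (P - Q) \<noteq> {} \<and> E \<inter> (Q - P) \<noteq> {}}"
  have fH: "finite ?H" using assms(1) by simp
  have Y: "card ?Y = ?N - ?t" using PQ by (intro card_Diff_subset) auto
  have pq: "card (P - Q) = k - ?t" "card (Q - P) = k - ?t"
    using PQ card_Diff_subset_Int[of P Q] card_Diff_subset_Int[of Q P] by (auto simp: Int_commute)
  have s: "?N - ?t - (k - ?t) = ?N - k" "?N - k - (k - ?t) = ?N - 2 * k + ?t" using t assms(6) by auto
  have H: "int (card ?H) = int ((?N - ?t) choose (k - 1)) - 2 * int ((?N - k) choose (k - 1))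
      + int ((?N - 2 * k + ?t) choose (k - 1))"
  proof -
    have d: "P - Q \<subseteq> ?Y" "Q - P \<subseteq> ?Y" "(P - Q) \<inter> (Q - P) = {}" "finite ?Y" using PQ assms(1) by auto
    show ?thesis unfolding card_hitting_two[OF d(4,1,2,3)] Y pq s by simp
  qed
  have "{E \<in> A. E \<inter> (P \<inter> Q) = {}} \<subseteq> ?H - Lost"
  proof
    fix E assume "E \<in> {E \<in> A. E \<inter> (P \<inter> Q) = {}}"
    then have E: "E \<in> A" "E \<inter> (P \<inter> Q) = {}" by auto
    have "E \<inter> P \<noteq> {}" "E \<inter> Q \<noteq> {}" using crossD[OF assms(4) E(1)] assms(7,8) by auto
    then have "E \<inter> (P - Q) \<noteq> {}" "E \<inter> (Q - P) \<noteq> {}" using E(2) by blast+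
    moreover have "E \<in> ksets ?Y (k - 1)" using E assms(2) by (auto simp: ksets_def)
    ultimately show "E \<in> ?H - Lost" using E(1) L(2) by blast
  qed
  then have "card {E \<in> A. E \<inter> (P \<inter> Q) = {}} \<le> card (?H - Lost)" using fH by (intro card_mono) auto
  also have "card (?H - Lost) = card ?H - card Lost" using L fH by (intro card_Diff_subset) (auto intro: finite_subset)
  finally have 2: "card {E \<in> A. E \<inter> (P \<inter> Q) = {}} + card Lost \<le> card ?H"
    using card_mono[OF fH L(1)] by linarith
  then show ?thesis using H by linarith
qed

lemma card_transversals_le:
  assumes "finite X" "A \<subseteq> ksets X (k - 1)" "B \<subseteq> ksets X k" "cross A B" "2 \<le> k" "3 * k \<le> card X"
    and "\<And>x. \<exists>E\<in>B. x \<notin> E" "P \<in> B" "Q \<in> B" "P \<noteq> Q"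
    and L: "Lost \<subseteq> {E \<in> ksets (X - (P \<inter> Q)) (k - 1). E \<inter> (P - Q) \<noteq> {} \<and> E \<inter> (Q - P) \<noteq> {}}" "Lost \<inter> A = {}"
  shows "int (card A) \<le> transversal_bound (card X) k (card (P \<inter> Q)) - int (card Lost)"
proof -
  let ?N = "card X" and ?t = "card (P \<inter> Q)"
  have PQ: "P \<subseteq> X" "card P = k" "finite P"
    using assms(1,3,8) by (auto simp: ksets_def intro: finite_subset)
  have t: "?t \<le> k" using PQ card_mono[of P "P \<inter> Q"] by auto
  have 1: "int (card {E \<in> A. E \<inter> (P \<inter> Q) \<noteq> {}}) \<le> int (?N choose (k - 1)) - int ((?N - ?t) choose (k - 1))
         - (int ((?N - k) choose (k - 1)) - int ((?N - k - ?t) choose (k - 1)))"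
    by (rule card_hitting_kernel[OF assms(1-7)]) (use PQ t in auto)
  have "card A \<le> card ({E \<in> A. E \<inter> (P \<inter> Q) \<noteq> {}} \<union> {E \<in> A. E \<inter> (P \<inter> Q) = {}})"
    by (rule card_mono) (use finite_fam[OF assms(1,2)] in auto)
  also have "\<dots> \<le> card {E \<in> A. E \<inter> (P \<inter> Q) \<noteq> {}} + card {E \<in> A. E \<inter> (P \<inter> Q) = {}}"
    by (rule card_Un_le)
  finally show ?thesis using 1 card_missing_kernel_le[OF assms(1-6,8,9) L] unfolding transversal_bound_def by linarith
qed

lemma binomial_convex:
  assumes "u + i \<le> v"
  shows "((u + i) choose r) + ((v - i) choose r) \<le> (u choose r) + (v choose r)"
  using binomial_diff_mono[of i "u + i" v r] assms by simp

text \<open>The bound is convex in \<open>t\<close> and symmetric under \<open>t\<close> to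
  \<open>k - t\<close>, so on the range from 2 to k - 2 it is largest at 2. The step from 1 to 2 is
  a difference of two binomials, and Pascal's rule leaves the stated gain.\<close>

lemma transversal_bound_gap:
  assumes "2 \<le> t" "t + 2 \<le> k" "3 * k \<le> N"
  shows "transversal_bound N k t + int ((N - k - 3) choose (k - 3)) \<le> transversal_bound N k 1"
proof -
  let ?c = "\<lambda>M. M choose (k - 1)"
  have "N - 2 * k + 2 + (t - 2) = N - 2 * k + t" "N - k - 2 - (t - 2) = N - k - t"
    "N - 2 * k + 2 + (t - 2) \<le> N - k - 2" using assms by auto
  then have 1: "?c (N - 2 * k + t) + ?c (N - k - t) \<le> ?c (N - 2 * k + 2) + ?c (N - k - 2)"
    using binomial_convex[of "N - 2 * k + 2" "t - 2" "N - k - 2" "k - 1"] by presburger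
  have s: "N - k - 1 - 1 = N - k - 2" "N - 2 * k + 2 - 1 = N - 2 * k + 1" "N - k - 2 - 1 = N - k - 3"
    "k - 1 - 1 = k - 2" "k - 2 - 1 = k - 3" by (auto simp: numeral_eq_Suc)
  have 2: "?c (N - k - 1) = ((N - k - 2) choose (k - 2)) + ?c (N - k - 2)"
    using choose_reduce_nat[of "N - k - 1" "k - 1"] assms unfolding s by simp
  have 3: "?c (N - 2 * k + 2) = ((N - 2 * k + 1) choose (k - 2)) + ?c (N - 2 * k + 1)"
    using choose_reduce_nat[of "N - 2 * k + 2" "k - 1"] assms unfolding s by simp
  have 4: "(N - k - 2) choose (k - 2) = ((N - k - 3) choose (k - 3)) + ((N - k - 3) choose (k - 2))"
    using choose_reduce_nat[of "N - k - 2" "k - 2"] assms unfolding s by simp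
  have 5: "(N - 2 * k + 1) choose (k - 2) \<le> (N - k - 3) choose (k - 2)"
    by (rule binomial_right_mono) (use assms in auto)
  show ?thesis using 1 2 3 4 5 unfolding transversal_bound_def by linarith
qed

section \<open>The exchange argument when few members avoid the vertex\<close>

lemma binomial_step_le: "(M + s) choose Suc r \<le> (M choose Suc r) + s * ((M + s - 1) choose r)"
proof (induction s)
  case (Suc s)
  have "(M + s - 1) choose r \<le> (M + s) choose r" by (rule binomial_right_mono) simp
  then have "s * ((M + s - 1) choose r) \<le> s * ((M + s) choose r)" by (rule mult_le_mono2)
  then have "(M + s) choose Suc r \<le> (M choose Suc r) + s * ((M + s) choose r)" using Suc by linarith
  then show ?case by simp
qed simp

text \<open>Excluded are the sets missing \<open>W\<close> and, for each of its k + 1 points, the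
  sets meeting \<open>W\<close> in that point alone.\<close>

lemma card_two_in_set_le:
  assumes "finite X" "A \<subseteq> ksets X (k - 1)" "2 \<le> k" "W \<subseteq> X" "card W = k + 1"
    and "\<And>E. E \<in> A \<Longrightarrow> 2 \<le> card (E \<inter> W)"
  shows "card A + ((card X - k - 1) choose (k - 1)) + (k + 1) * ((card X - k - 1) choose (k - 2))
    \<le> card X choose (k - 1)"
proof -
  let ?L = "\<lambda>w. {T \<in> ksets X (k - 1). {w} \<subseteq> T \<and> T \<inter> (W - {w}) = {}}"
  let ?U = "\<Union>w\<in>W. ?L w" and ?M = "ksets (X - W) (k - 1)"
  have fW: "finite W" using assms finite_subset by auto
  have fins: "finite A" "finite ?U" "finite ?M" "\<And>w. finite (?L w)" using assms(1) fW finite_fam[OF assms(1,2)] by auto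
  have "(k + 1) * ((card X - k - 1) choose (k - 2)) = (\<Sum>w\<in>W. (card X - k - 1) choose (k - 2))" using assms(5) by simp
  also have "\<dots> \<le> (\<Sum>w\<in>W. card (?L w))"
  proof (rule sum_mono)
    fix w assume w: "w \<in> W"
    have "card X - card {w} - card (W - {w}) = card X - k - 1" "k - 1 - card {w} = k - 2"
      using w assms(5) fW by auto
    then show "(card X - k - 1) choose (k - 2) \<le> card (?L w)"
      using card_through_avoiding[OF assms(1), of "{w}" "k - 1" "W - {w}"] w assms(3,4) fW by auto
  qed
  also have "\<dots> = card ?U"
    by (rule card_UN_disjoint[symmetric]) (use fW fins in auto)
  finally have 1: "(k + 1) * ((card X - k - 1) choose (k - 2)) \<le> card ?U" .
  have 2: "card ?M = (card X - k - 1) choose (k - 1)"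
    using assms(1,4,5) fW by (simp add: card_ksets card_Diff_subset)
  have le1: "card (T \<inter> W) \<le> 1" if "T \<in> ?U \<union> ?M" for T
  proof -
    have "\<exists>w. T \<inter> W \<subseteq> {w}" using that by (auto simp: ksets_def)
    then obtain w where "T \<inter> W \<subseteq> {w}" by blast
    then have "card (T \<inter> W) \<le> card {w}" by (rule card_mono[rotated]) simp
    then show ?thesis by simp
  qed
  have "A \<inter> (?U \<union> ?M) = {}" using le1 assms(6) by fastforce
  then have "card (A \<union> (?U \<union> ?M)) = card A + card (?U \<union> ?M)" using fins by (intro card_Un_disjoint) auto
  moreover have "?U \<inter> ?M = {}" by (auto simp: ksets_def)
  then have "card (?U \<union> ?M) = card ?U + card ?M" using fins by (intro card_Un_disjoint) auto
  moreover have "card (A \<union> (?U \<union> ?M)) \<le> card (ksets X (k - 1))"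
    by (rule card_mono) (use assms(1,2) in \<open>auto simp: ksets_def\<close>)
  ultimately show ?thesis using 1 2 card_ksets[OF assms(1)] by simp
qed

text \<open>Unless \<open>B\<close> has at most three members and some two meet in one point,
  \<open>A\<close> loses at least C(N-k-3, k-3) sets against the bound at \<open>t\<close> = 1. By
  \<open>small\<close> this covers all members of \<open>B\<close> beyond three.\<close>

lemma near_star_bound:
  assumes "finite X" "A \<subseteq> ksets X (k - 1)" "B \<subseteq> ksets X k" "cross A B" "cross B B" "5 \<le> k" "3 * k \<le> card X"
    and tau2: "\<And>x. \<exists>E\<in>B. x \<notin> E"
    and small: "card B \<le> ((card X - k - 3) choose (k - 3)) + 3"
  shows "int (card A) + int (card B) \<le> transversal_bound (card X) k 1 + 3"
proof -
  let ?N = "card X" and ?L = "(card X - k - 3) choose (k - 3)"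
  have k2: "2 \<le> k" using assms(6) by simp
  have Bk: "E \<subseteq> X" "card E = k" "finite E" if "E \<in> B" for E
    using that assms(1,3) by (auto simp: ksets_def intro: finite_subset)
  have tb: "int (card A) \<le> transversal_bound ?N k (card (P \<inter> Q)) - int (card Lost)"
    if "P \<in> B" "Q \<in> B" "P \<noteq> Q" "Lost \<inter> A = {}"
      "Lost \<subseteq> {E \<in> ksets (X - (P \<inter> Q)) (k - 1). E \<inter> (P - Q) \<noteq> {} \<and> E \<inter> (Q - P) \<noteq> {}}" for P Q Lost
    by (rule card_transversals_le[OF assms(1-4) k2 assms(7) tau2 that(1-3,5,4)])
  consider (1) P Q where "P \<in> B" "Q \<in> B" "P \<noteq> Q" "card (P \<inter> Q) = 1"
    | (2) P Q where "P \<in> B" "Q \<in> B" "P \<noteq> Q" "2 \<le> card (P \<inter> Q)" "card (P \<inter> Q) + 2 \<le> k"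
    | (3) "\<And>P Q. P \<in> B \<Longrightarrow> Q \<in> B \<Longrightarrow> P \<noteq> Q \<Longrightarrow> card (P \<inter> Q) = k - 1"
  proof -
    have "card (P \<inter> Q) = 1 \<or> (2 \<le> card (P \<inter> Q) \<and> card (P \<inter> Q) + 2 \<le> k) \<or> card (P \<inter> Q) = k - 1"
      if "P \<in> B" "Q \<in> B" "P \<noteq> Q" for P Q
    proof -
      have "card (P \<inter> Q) \<noteq> 0" using crossD[OF assms(5) that(1,2)] Bk[OF that(1)] by simp
      moreover have "P \<inter> Q \<noteq> P" using that Bk by (metis Int_lower2 card_subset_eq)
      then have "card (P \<inter> Q) < card P" using Bk[OF that(1)] by (intro psubset_card_mono) auto
      ultimately show ?thesis using Bk[OF that(1)] by linarith
    qed
    then show ?thesis using that by blast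
  qed
  then show ?thesis
  proof cases
    case 2
    have "int (card A) \<le> transversal_bound ?N k (card (P \<inter> Q)) - int (card ({} :: 'a set set))"
      by (rule tb) (use 2 in auto)
    then show ?thesis using transversal_bound_gap[OF 2(4,5) assms(7)] small by simp
  next
    case 3
    obtain P where P: "P \<in> B" using tau2 by blast
    then have "P \<noteq> {}" using crossD[OF assms(5)] by blast
    then obtain x where x: "x \<in> P" by blast
    obtain Q where Q: "Q \<in> B" "x \<notin> Q" using tau2 by blast
    have ne: "P \<noteq> Q" using x Q by auto
    let ?W = "P \<union> Q"
    have i: "card (P \<inter> Q) = k - 1" by (rule 3[OF P Q(1) ne])
    have W: "card ?W = k + 1" "?W \<subseteq> X" "finite ?W"
      using card_Un_Int[OF Bk(3)[OF P] Bk(3)[OF Q(1)]] Bk[OF P] Bk[OF Q(1)] i assms(6) by auto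
    \<comment> \<open>A member avoiding a point \<open>w\<close> common to \<open>P\<close> and
      \<open>Q\<close> meets each of them in k - 1 points, so it contains the rest of both. Hence
      \<open>B\<close> contains all k-subsets of \<open>W\<close>, and every transversal meets
      \<open>W\<close> twice.\<close>
    have mem: "?W - {w} \<in> B" if w: "w \<in> ?W" for w
    proof -
      have cw: "card (?W - {w}) = k" using w W by simp
      have full: "E = ?W - {w}" if "E \<in> B" "E \<subseteq> ?W" "w \<notin> E" for E
        using that W cw Bk[OF that(1)] by (intro card_subset_eq) auto
      show ?thesis
      proof (cases "w \<in> P \<inter> Q")
        case False
        then consider "w \<notin> P" | "w \<notin> Q" by blast
        then show ?thesis
        proof cases
          case 1 then show ?thesis using full[OF P] P by simp
        next
          case 2 then show ?thesis using full[OF Q(1)] Q(1) by simp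
        qed
      next
        case True
        obtain D where D: "D \<in> B" "w \<notin> D" using tau2 by blast
        have sub: "E - {w} \<subseteq> D" if E: "E \<in> B" "w \<in> E" for E
        proof -
          have "card (E \<inter> D) = k - 1" using 3[OF E(1) D(1)] D(2) E(2) by auto
          moreover have "card (E - {w}) = k - 1" using E Bk[OF E(1)] by simp
          moreover have "E \<inter> D \<subseteq> E - {w}" using D(2) by auto
          ultimately have "E \<inter> D = E - {w}" using Bk(3)[OF E(1)] by (intro card_subset_eq) auto
          then show ?thesis by auto
        qed
        have "?W - {w} \<subseteq> D" using sub[OF P] sub[OF Q(1)] True by auto
        then have "?W - {w} = D" using cw Bk[OF D(1)] by (intro card_subset_eq) auto
        then show ?thesis using D by simp
      qed
    qed
    have two: "2 \<le> card (E \<inter> ?W)" if E: "E \<in> A" for E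
    proof -
      obtain w where w: "w \<in> E" "w \<in> P" using crossD[OF assms(4) E P] by blast
      have "?W - {w} \<in> B" using mem w by auto
      then obtain v where v: "v \<in> E" "v \<in> ?W - {w}" using crossD[OF assms(4) E] by blast
      have "card {v, w} \<le> card (E \<inter> ?W)" by (rule card_mono) (use v w W in auto)
      then show ?thesis using v by simp
    qed
    let ?c = "\<lambda>M. M choose (k - 1)" and ?q = "(?N - k - 1) choose (k - 2)"
    let ?y = "(?N - k - 2) choose (k - 3)" and ?z = "(?N - k - 2) choose (k - 2)"
    have 1: "card A + ?c (?N - k - 1) + (k + 1) * ?q \<le> ?c ?N"
      by (rule card_two_in_set_le[OF assms(1,2) k2 W(2,1) two])
    have 2: "?c (?N - k) = ?q + ?c (?N - k - 1)"
      using choose_reduce_nat[of "?N - k" "k - 1"] assms(6,7) by (simp add: numeral_2_eq_2)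
    have s: "?N - 2 * k + 1 + (k - 2) = ?N - k - 1" "?N - k - 1 - 1 = ?N - k - 2" "Suc (k - 2) = k - 1" 
      "k - 2 - 1 = k - 3" using assms(6,7) by auto
    have 3: "?c (?N - k - 1) \<le> ?c (?N - 2 * k + 1) + (k - 2) * ?z"
      using binomial_step_le[of "?N - 2 * k + 1" "k - 2" "k - 2"] unfolding s .
    have 4: "?q = ?y + ?z" using choose_reduce_nat[of "?N - k - 1" "k - 2"] assms(6,7) unfolding s by simp
    have 5: "?L \<le> ?y" by (rule binomial_right_mono) simp
    have "1 \<le> k - 2" using assms(6) by simp
    from mult_le_mono1[OF this, of ?y] have "?y \<le> (k - 2) * ?y" by simp
    moreover have "(k + 1) * ?q = 3 * ?q + ((k - 2) * ?y + (k - 2) * ?z)"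
    proof -
      have "k + 1 = 3 + (k - 2)" using assms(6) by simp
      then have "(k + 1) * ?q = 3 * ?q + (k - 2) * ?q" by (metis distrib_right)
      then show ?thesis using 4 by (simp add: distrib_left)
    qed
    ultimately have "card A + ?L + 3 * ?c (?N - k) \<le> ?c ?N + ?c (?N - k - 1) + ?c (?N - 2 * k + 1)"
      using 1 2 3 5 by linarith
    then show ?thesis using small unfolding transversal_bound_def by linarith
  next
    case 1
    then obtain x where x: "P \<inter> Q = {x}" by (metis card_1_singletonE)
    have xP: "x \<in> P" "x \<in> Q" using x by auto
    have PQ: "P - Q = P - {x}" "Q - P = Q - {x}" using x by auto
    have xX: "x \<in> X" using xP Bk[OF 1(1)] by auto
    have Xx: "card (X - {x}) = ?N - 1" using xX assms(1) by simp
    show ?thesis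
    proof (cases "card B \<le> 3")
      case True
      have "int (card A) \<le> transversal_bound ?N k (card (P \<inter> Q)) - int (card ({} :: 'a set set))"
        by (rule tb) (use 1 in auto)
      then show ?thesis using True 1(4) by simp
    next
      case big: False
      have "int (card A) + int ?L \<le> transversal_bound ?N k 1"
      proof (cases "\<exists>E\<in>B. \<not> P - {x} \<subseteq> E \<and> \<not> Q - {x} \<subseteq> E")
        case True
        \<comment> \<open>Sets containing \<open>a\<close> and \<open>b\<close> but missing
          \<open>x\<close> and \<open>E\<close> hit both differences, yet are no transversals of
          \<open>E\<close>.\<close>
        then obtain E a b where E: "E \<in> B" "a \<in> P - {x}" "a \<notin> E" "b \<in> Q - {x}" "b \<notin> E" by blast
        let ?Lost = "{T \<in> ksets (X - {x}) (k - 1). {a, b} \<subseteq> T \<and> T \<inter> (E - {x}) = {}}"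
        have ab: "a \<noteq> b" using E PQ by auto
        have abX: "{a, b} \<subseteq> X - {x}" using E Bk[OF 1(1)] Bk[OF 1(2)] by auto
        have lost: "(card (X - {x}) - card {a, b} - card (E - {x})) choose (k - 1 - card {a, b}) \<le> card ?Lost"
          by (rule card_through_avoiding) (use assms(1,6) ab abX E Bk[OF E(1)] in auto)
        have "?N - k - 3 \<le> card (X - {x}) - card {a, b} - card (E - {x})"
        proof -
          have "card (E - {x}) \<le> k" using card_mono[of E "E - {x}"] Bk[OF E(1)] by auto
          then show ?thesis using Xx ab by simp
        qed
        moreover have "k - 1 - card {a, b} = k - 3" using ab by simp
        ultimately have L: "?L \<le> card ?Lost"
          using le_trans[OF binomial_right_mono lost] by simp
        have "int (card A) \<le> transversal_bound ?N k (card (P \<inter> Q)) - int (card ?Lost)"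
        proof (rule tb[OF 1(1-3)])
          have "T \<notin> A" if "T \<in> ?Lost" for T
          proof -
            have "T \<inter> E = {}" using that by (auto simp: ksets_def)
            then show ?thesis using crossD[OF assms(4) _ E(1)] by auto
          qed
          then show "?Lost \<inter> A = {}" by auto
          show "?Lost \<subseteq> {E \<in> ksets (X - (P \<inter> Q)) (k - 1). E \<inter> (P - Q) \<noteq> {} \<and> E \<inter> (Q - P) \<noteq> {}}"
            unfolding PQ x using E by auto
        qed
        then show ?thesis using L 1(4) by simp
      next
        case contains: False
        \<comment> \<open>A member through \<open>x\<close> now equals \<open>P\<close> or
          \<open>Q\<close> by cardinality, so among at least four members two avoid
          \<open>x\<close>.\<close>
        have "\<exists>E\<in>B. \<exists>E'\<in>B. E \<noteq> E' \<and> x \<notin> E \<and> x \<notin> E'"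
        proof (rule ccontr)
          assume n: "\<not> ?thesis"
          obtain D where D: "D \<in> B" "x \<notin> D" using tau2 by blast
          have "B \<subseteq> {P, Q, D}"
          proof
            fix E assume E: "E \<in> B"
            show "E \<in> {P, Q, D}"
            proof (cases "x \<in> E")
              case True
              then have "P \<subseteq> E \<or> Q \<subseteq> E" using contains E by blast
              then have "P = E \<or> Q = E" using Bk[OF E] Bk[OF 1(1)] Bk[OF 1(2)] card_subset_eq by metis
              then show ?thesis by auto
            next
              case False then show ?thesis using n D E by blast
            qed
          qed
          then have "card B \<le> card {P, Q, D}" by (intro card_mono) auto
          also have "\<dots> \<le> 3" by (simp add: card_insert_if)
          finally show False using big by simp
        qed
        then obtain E E' where E: "E \<in> B" "E' \<in> B" "E \<noteq> E'" "x \<notin> E" "x \<notin> E'" by blast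
        have "\<not> E' \<subseteq> E" using E Bk[OF E(1)] Bk[OF E(2)] card_subset_eq by metis
        then obtain e where e: "e \<in> E'" "e \<notin> E" by blast
        let ?Y = "X - {x}"
        \<comment> \<open>Here the loss occurs among transversals through \<open>x\<close>: these
          must meet both \<open>E\<close> and \<open>E'\<close>, while the kernel bound already
          counts only meeting one k-set. Lost are those that contain \<open>e\<close> and miss
          \<open>E\<close>.\<close>
        let ?H = "{T \<in> ksets ?Y (k - 2). T \<inter> E' \<noteq> {}}" and ?Lost = "{T \<in> ksets ?Y (k - 2). {e} \<subseteq> T \<and> T \<inter> E = {}}"
        have fH: "finite ?H" using assms(1) by simp
        have sub: "?Lost \<subseteq> ?H" using e by auto
        have "link x A \<subseteq> ?H - ?Lost"
        proof
          fix T assume T: "T \<in> link x A"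
          have "k - 1 - 1 = k - 2" by simp
          then have "T \<in> ksets ?Y (k - 2)" using link_ksets[OF assms(1,2), of x] T by auto
          moreover have "insert x T \<in> A" using T by (auto simp: link_def)
          then have "insert x T \<inter> E \<noteq> {}" "insert x T \<inter> E' \<noteq> {}" using crossD[OF assms(4)] E by auto
          ultimately show "T \<in> ?H - ?Lost" using E by auto
        qed
        then have "card (link x A) \<le> card (?H - ?Lost)" using fH by (intro card_mono) auto
        also have "\<dots> = card ?H - card ?Lost" using sub fH by (intro card_Diff_subset) (auto intro: finite_subset)
        finally have l1: "card (link x A) + card ?Lost \<le> card ?H" using card_mono[OF fH sub] by linarith
        have lost: "(card ?Y - card {e} - card E) choose (k - 2 - card {e}) \<le> card ?Lost"
          by (rule card_through_avoiding) (use assms(1,6) E e Bk[OF E(1)] Bk[OF E(2)] in auto)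
        have "?N - k - 3 \<le> card ?Y - card {e} - card E" using Xx Bk[OF E(1)] by simp
        moreover have "k - 2 - card {e} = k - 3" by simp
        ultimately have l2: "?L \<le> card ?Lost"
          using le_trans[OF binomial_right_mono lost] by simp
        have "card ?H = (card ?Y choose (k - 2)) - ((card ?Y - card E') choose (k - 2))"
          by (rule card_hitting) (use assms(1) E Bk[OF E(2)] in auto)
        have s: "?N - 1 - k = ?N - k - 1" "k - 1 - 1 = k - 2" by auto
        have l3: "int (card ?H) = int ((?N - 1) choose (k - 2)) - int ((?N - k - 1) choose (k - 2))"
        proof -
          have "(?N - k - 1) choose (k - 2) \<le> (?N - 1) choose (k - 2)" by (rule binomial_right_mono) simp
          then show ?thesis using \<open>card ?H = _\<close> unfolding Xx Bk(2)[OF E(2)] s(1) by (simp only: of_nat_diff)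
        qed
        have p: "?N choose (k - 1) = ((?N - 1) choose (k - 2)) + ((?N - 1) choose (k - 1))"
          "(?N - k) choose (k - 1) = ((?N - k - 1) choose (k - 2)) + ((?N - k - 1) choose (k - 1))"
          using choose_reduce_nat[of ?N "k - 1"] choose_reduce_nat[of "?N - k" "k - 1"] assms(6,7) unfolding s by auto
        have "int (card {E \<in> A. E \<inter> (P \<inter> Q) = {}}) + int (card ({} :: 'a set set)) \<le> int ((?N - card (P \<inter> Q)) choose (k - 1))
            - 2 * int ((?N - k) choose (k - 1)) + int ((?N - 2 * k + card (P \<inter> Q)) choose (k - 1))"
          by (rule card_missing_kernel_le[OF assms(1-4) k2 assms(7) 1(1,2)]) auto
        moreover have "{E \<in> A. E \<inter> (P \<inter> Q) = {}} = del x A" unfolding x del_def by auto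
        ultimately have "int (card (del x A)) \<le> int ((?N - 1) choose (k - 1))
            - 2 * int ((?N - k) choose (k - 1)) + int ((?N - 2 * k + 1) choose (k - 1))"
          using 1(4) by simp
        then show ?thesis using card_link_del[OF finite_fam[OF assms(1,2)], of x] l1 l2 l3 p
          unfolding transversal_bound_def by linarith
      qed
      then show ?thesis using small by linarith
    qed
  qed
qed

section \<open>Estimates for binomial coefficients\<close>

lemma pair_bound_int:
  "int (pair_bound n k) = int ((n - 2) choose (k - 2)) - int ((n - 2 - k) choose (k - 2))"
  unfolding pair_bound_def by (simp add: of_nat_diff binomial_right_mono)

lemma twice_binomial_le_pair_bound:
  assumes "4 \<le> k" "3 * k \<le> n"
  shows "2 * ((n - 4) choose (k - 3)) \<le> pair_bound n k"
proof -
  have s: "n - 2 - 1 = n - 3" "k - 2 - 1 = k - 3" "n - 3 - 1 = n - 4" by auto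
  have 1: "(n - 2) choose (k - 2) = ((n - 3) choose (k - 3)) + ((n - 3) choose (k - 2))"
    "(n - 3) choose (k - 2) = ((n - 4) choose (k - 3)) + ((n - 4) choose (k - 2))"
    using choose_reduce_nat[of "n - 2" "k - 2"] choose_reduce_nat[of "n - 3" "k - 2"] assms unfolding s by auto
  have 2: "(n - 4) choose (k - 3) \<le> (n - 3) choose (k - 3)" by (rule binomial_right_mono) simp
  have 3: "(n - 2 - k) choose (k - 2) \<le> (n - 4) choose (k - 2)"
    by (rule binomial_right_mono) (use assms in auto)
  show ?thesis using 1 2 3 pair_bound_int[of n k] by linarith
qed

lemma link_bound_le_pair_bound:
  assumes "4 \<le> k" "3 * k \<le> n"
  shows "((n - 4) choose (k - 2)) - ((n - 3 - k) choose (k - 2)) \<le> pair_bound n k"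
proof -
  have s: "n - 4 - (k - 1) = n - 3 - k" using assms by auto
  have 1: "int ((n - 4) choose (k - 2)) - int ((n - 3 - k) choose (k - 2))
      \<le> int ((n - 2) choose (k - 2)) - int ((n - 2 - (k - 1)) choose (k - 2))"
    using binomial_diff_mono[of "k - 1" "n - 4" "n - 2" "k - 2"] assms unfolding s by simp
  have 2: "(n - 2 - k) choose (k - 2) \<le> (n - 2 - (k - 1)) choose (k - 2)"
    by (rule binomial_right_mono) simp
  show ?thesis using 1 2 pair_bound_int[of n k] unfolding le_diff_conv by linarith
qed

lemma transversal_bound_closed_form:
  assumes "4 \<le> k" "3 * k \<le> n"
  shows "transversal_bound (n - 1) k 1 =
    int ((n - 1) choose (k - 1)) - int ((n - k) choose (k - 1))
           - int ((n - k - 1) choose (k - 1)) + int ((n - 2 * k) choose (k - 1))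
           + int ((n - k - 2) choose (k - 3))"
proof -
  have s: "n - 1 - k = n - k - 1" "n - k - 1 - 1 = n - k - 2" "n - 1 - 2 * k + 1 = n - 2 * k"
    "k - 1 - 1 = k - 2" "k - 2 - 1 = k - 3" using assms by auto
  have "(n - k) choose (k - 1) = ((n - k - 1) choose (k - 2)) + ((n - k - 1) choose (k - 1))"
    "(n - k - 1) choose (k - 2) = ((n - k - 2) choose (k - 3)) + ((n - k - 2) choose (k - 2))"
    "(n - k - 1) choose (k - 1) = ((n - k - 2) choose (k - 2)) + ((n - k - 2) choose (k - 1))"
    using choose_reduce_nat[of "n - k" "k - 1"] choose_reduce_nat[of "n - k - 1" "k - 2"] choose_reduce_nat[of "n - k - 1" "k - 1"] assms
    unfolding s by auto
  then show ?thesis unfolding transversal_bound_def s by linarith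
qed

text \<open>Lowering the top from m to m - 1 multiplies by 1 - r/m; the hypothesis says that this is
  at least \<open>b\<close> at the smallest top reached, hence at every step.\<close>

lemma binomial_top_ge:
  fixes b :: real
  assumes "0 \<le> b" "s \<le> M" "real r + b * real (M - s + 1) \<le> real (M - s + 1)" "b \<le> 1"
  shows "b ^ s * (M choose r) \<le> ((M - s) choose r)"
  using assms(2,3)
proof (induction s)
  case (Suc s)
  let ?m = "M - s"
  have m: "1 \<le> ?m" "real (M - Suc s + 1) = real ?m" using Suc.prems by auto
  have "real (?m + 1) * (1 - b) \<ge> real ?m * (1 - b)" using assms(4) by (intro mult_right_mono) auto
  moreover have "r \<le> real ?m * (1 - b)" using Suc.prems(2) m by (simp add: algebra_simps)
  ultimately have "b ^ s * (M choose r) \<le> (?m choose r)"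
    using Suc m by (simp add: algebra_simps)
  then have "b * (b ^ s * (M choose r)) \<le> b * (?m choose r)" using assms(1) by (rule mult_left_mono)
  then have "b ^ Suc s * (M choose r) \<le> b * (?m choose r)" by (simp only: power_Suc mult.assoc)
  moreover have "b * (?m choose r) \<le> ((?m - 1) choose r)"
  proof -
    have rm: "r \<le> ?m"
    proof -
      have "real r \<le> real ?m * 1" using \<open>r \<le> real ?m * (1 - b)\<close> assms(1)
        by (meson dual_order.trans diff_le_self mult_left_mono of_nat_0_le_iff le_diff_eq add_increasing2 le_add_same_cancel1 order_refl diff_left_mono)
      then show ?thesis by simp
    qed
    have "real ((?m - r) * (?m choose r)) = real (?m * ((?m - 1) choose r))"
      by (simp only: binomial_absorb_comp)
    then have e: "(real ?m - r) * (?m choose r) = ?m * ((?m - 1) choose r)"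
      by (simp only: of_nat_mult of_nat_diff[OF rm])
    have "b * ?m \<le> real ?m - r" using \<open>r \<le> real ?m * (1 - b)\<close> by (simp add: algebra_simps)
    then have "b * ?m * (?m choose r) \<le> (real ?m - r) * (?m choose r)" by (intro mult_right_mono) auto
    then have "real ?m * (b * (?m choose r)) \<le> real ?m * ((?m - 1) choose r)" using e by (simp add: mult_ac)
    then show ?thesis using m(1) by (simp add: mult_le_cancel_left)
  qed
  ultimately show ?case by simp
qed simp

text \<open>The factor 1 - r/m is largest at the initial top \<open>M\<close>, where the hypothesis
  bounds it by \<open>a\<close>.\<close>

lemma binomial_top_le:
  fixes a :: real
  assumes "s \<le> M" "M \<le> r + a * M" "r \<le> M - s" "a \<le> 1"
  shows "((M - s) choose r) \<le> a ^ s * (M choose r)"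
  using assms(1,3)
proof (induction s)
  case (Suc s)
  let ?m = "M - s"
  have m: "1 \<le> ?m" "r \<le> ?m" using Suc.prems by auto
  have a0: "0 \<le> a"
  proof -
    have "0 \<le> a * M" using assms(2) Suc.prems by linarith
    then show ?thesis using Suc.prems by (simp add: zero_le_mult_iff)
  qed
  have IH: "(?m choose r) \<le> a ^ s * (M choose r)" using Suc by simp
  have "real ((?m - r) * (?m choose r)) = real (?m * ((?m - 1) choose r))"
    by (simp only: binomial_absorb_comp)
  then have e: "(real ?m - r) * (?m choose r) = ?m * ((?m - 1) choose r)"
    by (simp only: of_nat_mult of_nat_diff[OF m(2)])
  have "real ?m * (1 - a) \<le> real M * (1 - a)" using assms(4) by (intro mult_right_mono) auto
  then have "real ?m - r \<le> a * ?m" using assms(2) by (simp add: algebra_simps)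
  then have "(real ?m - r) * (?m choose r) \<le> a * ?m * (?m choose r)" by (intro mult_right_mono) auto
  then have "real ?m * ((?m - 1) choose r) \<le> real ?m * (a * (?m choose r))" using e by (simp add: mult_ac)
  then have "((?m - 1) choose r) \<le> a * (?m choose r)" using m(1) by (simp add: mult_le_cancel_left)
  also have "\<dots> \<le> a * (a ^ s * (M choose r))" using IH a0 by (rule mult_left_mono)
  finally show ?case by (simp add: mult_ac)
qed simp

text \<open>The ratio of consecutive coefficients is (M - r)/(r + 1); the hypothesis makes it at
  least \<open>c\<close> at the last step, where it is smallest.\<close>

lemma binomial_bottom_le:
  assumes "c * (r + i) + r + i \<le> M + 1"
  shows "c ^ i * (M choose r) \<le> M choose (r + i)"
  using assms
proof (induction i)
  case (Suc i)
  let ?r = "r + i"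
  have IH: "c ^ i * (M choose r) \<le> M choose ?r" using Suc by (simp add: algebra_simps)
  have "Suc ?r * (M choose Suc ?r) = (M - ?r) * (M choose ?r)"
    by (metis binomial_absorption binomial_absorb_comp)
  moreover have "c * Suc ?r \<le> M - ?r" using Suc.prems by simp
  then have "(c * Suc ?r) * (M choose ?r) \<le> (M - ?r) * (M choose ?r)" by (rule mult_le_mono1)
  ultimately have "Suc ?r * (c * (M choose ?r)) \<le> Suc ?r * (M choose Suc ?r)" by (simp only: mult_ac)
  then have "c * (M choose ?r) \<le> M choose Suc ?r" by (simp only: Suc_mult_le_cancel1)
  with mult_le_mono2[OF IH, of c] have "c * (c ^ i * (M choose r)) \<le> M choose Suc ?r" by (rule le_trans)
  then show ?case by (simp only: power_Suc mult.assoc add_Suc_right)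
qed simp

text \<open>\<open>gap k M\<close> counts the \<open>(k - 2)\<close>-subsets of an \<open>M\<close>-set that meet a fixed \<open>(k - 1)\<close>-set.\<close>

definition gap :: "nat \<Rightarrow> nat \<Rightarrow> real" where
  "gap k M = (\<Sum>l<k - 1. real ((M - 1 - l) choose (k - 3)))"

lemma binomial_diff_sum:
  "s \<le> M \<Longrightarrow> real (M choose Suc r) - real ((M - s) choose Suc r) = (\<Sum>l<s. real ((M - 1 - l) choose r))"
proof (induction s)
  case (Suc s)
  have "M - s = Suc (M - Suc s)" using Suc.prems by simp
  then have "real ((M - s) choose Suc r) = real ((M - Suc s) choose r) + real ((M - Suc s) choose Suc r)"
    by (metis binomial_Suc_Suc of_nat_add)
  then show ?case using Suc by simp
qed simp

lemma gap_ge: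
  fixes b :: real
  assumes "0 \<le> b" "b \<le> 1" "s + k \<le> M" "real (k - 3) + b * real (M - s - k + 2) \<le> real (M - s - k + 2)"
  shows "b ^ s * gap k M \<le> gap k (M - s)"
  unfolding gap_def sum_distrib_left
proof (rule sum_mono)
  fix l assume "l \<in> {..<k - 1}"
  then have l: "l + 2 \<le> k" by auto
  have s: "M - s - 1 - l = M - 1 - l - s" by simp
  show "b ^ s * real ((M - 1 - l) choose (k - 3)) \<le> real ((M - s - 1 - l) choose (k - 3))"
    unfolding s
  proof (rule binomial_top_ge[OF assms(1) _ _ assms(2)])
    show "s \<le> M - 1 - l" using l assms(3) by linarith
    have "(1 - b) * real (M - s - k + 2) \<le> (1 - b) * real (M - 1 - l - s + 1)"
    proof (rule mult_left_mono)
      have "M - s - k + 2 \<le> M - 1 - l - s + 1" using l assms(3) by linarith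
      then show "real (M - s - k + 2) \<le> real (M - 1 - l - s + 1)" by (rule of_nat_mono)
    qed (use assms(2) in simp)
    then show "real (k - 3) + b * real (M - 1 - l - s + 1) \<le> real (M - 1 - l - s + 1)"
      using assms(4) by (simp add: algebra_simps)
  qed
qed

text \<open>Let \<open>G M\<close> count the (k-1)-subsets of an M-set that meet a fixed (k-1)-set.
  Adding a point outside increases it by \<open>gap k M\<close>, and the right-hand side equals
  \<open>G (n - 2) - G (n - 1 - k)\<close>, a sum of k - 1 gaps.\<close>

lemma transversal_bound_ge_gaps:
  assumes "4 \<le> k" "3 * k \<le> n" "I \<le> k - 1"
  shows "(\<Sum>i<I. gap k (n - 3 - i)) \<le> real_of_int (transversal_bound (n - 1) k 1) - real (pair_bound n k)"
proof -
  define G where "G M = real (M choose (k - 1)) - real ((M - (k - 1)) choose (k - 1))" for M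
  have gap_eq: "gap k M = real (M choose (k - 2)) - real ((M - (k - 1)) choose (k - 2))" if "k - 1 \<le> M" for M
  proof -
    have "k - 2 = Suc (k - 3)" using assms by simp
    then show ?thesis unfolding gap_def using binomial_diff_sum[OF that, of "k - 3"] by simp
  qed
  have G1: "G (Suc M) = G M + gap k M" if "k - 1 \<le> M" for M
  proof -
    have "k - 1 = Suc (k - 2)" "Suc M - (k - 1) = Suc (M - (k - 1))" using assms that by auto
    then have "real (Suc M choose (k - 1)) = real (M choose (k - 2)) + real (M choose (k - 1))"
      "real ((Suc M - (k - 1)) choose (k - 1)) = real ((M - (k - 1)) choose (k - 2)) + real ((M - (k - 1)) choose (k - 1))"
      by (metis binomial_Suc_Suc of_nat_add)+
    then show ?thesis unfolding G_def gap_eq[OF that] by linarith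
  qed
  have sum: "(\<Sum>i<I. gap k (n - 3 - i)) = G (n - 2) - G (n - 2 - I)" if "I \<le> k - 1" for I
    using that
  proof (induction I)
    case (Suc I)
    have "n - 2 - I = Suc (n - 2 - Suc I)" "n - 3 - I = n - 2 - Suc I" using Suc.prems assms by auto
    then show ?case using Suc G1[of "n - 2 - Suc I"] assms by simp
  qed simp
  have gap0: "0 \<le> gap k M" for M unfolding gap_def by (intro sum_nonneg) simp
  have "(\<Sum>i<I. gap k (n - 3 - i)) \<le> (\<Sum>i<k - 1. gap k (n - 3 - i))"
    by (rule sum_mono2) (use assms gap0 in auto)
  also have "\<dots> = G (n - 2) - G (n - 2 - (k - 1))" by (rule sum) simp
  also have "\<dots> = real_of_int (transversal_bound (n - 1) k 1) - real (pair_bound n k)"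
  proof -
    have s: "n - 2 - (k - 1) = n - 1 - k" "n - 1 - k - (k - 1) = n - 2 * k" "n - 1 - 2 * k + 1 = n - 2 * k"
      "n - 1 - 1 = n - 2" "n - 1 - k - 1 = n - 2 - k" "k - 1 - 1 = k - 2" using assms by auto
    have "(n - 1) choose (k - 1) = ((n - 2) choose (k - 2)) + ((n - 2) choose (k - 1))"
      "(n - 1 - k) choose (k - 1) = ((n - 2 - k) choose (k - 2)) + ((n - 2 - k) choose (k - 1))"
      using choose_reduce_nat[of "n - 1" "k - 1"] choose_reduce_nat[of "n - 1 - k" "k - 1"] assms unfolding s by auto
    moreover have "real (pair_bound n k) = real ((n - 2) choose (k - 2)) - real ((n - 2 - k) choose (k - 2))"
      using pair_bound_int[of n k] by linarith
    ultimately show ?thesis unfolding G_def transversal_bound_def s by simp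
  qed
  finally show ?thesis .
qed

text \<open>Both sides sum the same decreasing sequence, over k and over k - 1 terms, and the extra
  last term is at most the average of the others.\<close>

lemma pair_bound_le_gap:
  assumes "4 \<le> k" "3 * k \<le> n"
  shows "real (k - 1) * real (pair_bound n k) \<le> real k * gap k (n - 2)"
proof -
  let ?last = "real ((n - 2 - k) choose (k - 3))"
  have k: "k - 2 = Suc (k - 3)" "k = Suc (k - 1)" using assms by auto
  have "real (pair_bound n k) = real ((n - 2) choose (k - 2)) - real ((n - 2 - k) choose (k - 2))"
    using pair_bound_int[of n k] by linarith
  also have "\<dots> = (\<Sum>l<k. real ((n - 2 - 1 - l) choose (k - 3)))"
    using binomial_diff_sum[of k "n - 2" "k - 3"] assms unfolding k(1)[symmetric] by simp
  also have "\<dots> = gap k (n - 2) + real ((n - 2 - 1 - (k - 1)) choose (k - 3))"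
    unfolding gap_def by (subst k(2)) (simp only: sum.lessThan_Suc)
  also have "n - 2 - 1 - (k - 1) = n - 2 - k" using assms by simp
  finally have 1: "real (pair_bound n k) = gap k (n - 2) + ?last" .
  have "(\<Sum>l<k - 1. ?last) \<le> gap k (n - 2)"
    unfolding gap_def by (intro sum_mono of_nat_mono binomial_right_mono) auto
  then have "real (k - 1) * ?last \<le> gap k (n - 2)" by simp
  moreover have "real k = real (k - 1) + 1" using assms by simp
  ultimately show ?thesis unfolding 1 distrib_left by (simp only: distrib_right)
qed

lemma nine_pair_bounds:
  assumes "13 \<le> k" "18 * k \<le> n"
  shows "9 * int (pair_bound n k) \<le> transversal_bound (n - 1) k 1"
proof -
  have k4: "4 \<le> k" "3 * k \<le> n" using assms by auto
  \<comment> \<open>One of the nine bounds is set aside; the remaining eight are compared with gaps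
    that decay at worst like powers of \<open>b\<close>.\<close>
  let ?W = "real_of_int (transversal_bound (n - 1) k 1) - real (pair_bound n k)"
  have main: "8 * real (pair_bound n k) \<le> ?W"
    if I: "I \<le> k - 1" and b: "0 \<le> b" "b \<le> 1" "real (k - 3) + b * real (n - k - I) \<le> real (n - k - I)"
      and num: "8 * real k \<le> real (k - 1) * (\<Sum>i<I. b ^ Suc i)" for I and b :: real
  proof -
    have g0: "0 \<le> gap k (n - 2)" unfolding gap_def by (intro sum_nonneg) simp
    have "(\<Sum>i<I. b ^ Suc i * gap k (n - 2)) \<le> (\<Sum>i<I. gap k (n - 3 - i))"
    proof (rule sum_mono)
      fix i assume "i \<in> {..<I}"
      then have i: "i < I" by simp
      have "b ^ Suc i * gap k (n - 2) \<le> gap k (n - 2 - Suc i)"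
      proof (rule gap_ge[OF b(1,2)])
        show "Suc i + k \<le> n - 2" using i I assms by linarith
        have "(1 - b) * real (n - k - I) \<le> (1 - b) * real (n - 2 - Suc i - k + 2)"
          using b(2) i I assms by (intro mult_left_mono) auto
        then show "real (k - 3) + b * real (n - 2 - Suc i - k + 2) \<le> real (n - 2 - Suc i - k + 2)"
          using b(3) by (simp add: algebra_simps)
      qed
      moreover have "n - 2 - Suc i = n - 3 - i" by simp
      ultimately show "b ^ Suc i * gap k (n - 2) \<le> gap k (n - 3 - i)" by simp
    qed
    then have "(\<Sum>i<I. b ^ Suc i) * gap k (n - 2) \<le> ?W"
      using transversal_bound_ge_gaps[OF k4 I] unfolding sum_distrib_right by linarith
    then have W: "real (k - 1) * (\<Sum>i<I. b ^ Suc i) * gap k (n - 2) \<le> real (k - 1) * ?W"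
      by (metis mult.assoc mult_left_mono of_nat_0_le_iff)
    have "real (k - 1) * (8 * real (pair_bound n k)) \<le> 8 * real k * gap k (n - 2)"
      using pair_bound_le_gap[OF k4] by simp
    also have "\<dots> \<le> real (k - 1) * (\<Sum>i<I. b ^ Suc i) * gap k (n - 2)" by (rule mult_right_mono[OF num g0])
    also note W
    finally show ?thesis using assms by (simp add: mult_le_cancel_left)
  qed
  have "8 * real (pair_bound n k) \<le> ?W"
  proof (cases "k = 13")
    case True
    show ?thesis
    \<comment> \<open>For k = 13 only twelve gaps exist, and twelve powers of 16/17 sum to less than
      the required 104/12. The better ratio 1 - 10/207 is available because n - 25 is at least
      209.\<close>
    proof (rule main[of 12 "197 / 207"])
      have "real (n - k - 12) \<ge> 207" using True assms by simp
      moreover have "real (k - 3) = 10" using True by simp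
      ultimately show "real (k - 3) + 197 / 207 * real (n - k - 12) \<le> real (n - k - 12)" by argo
      show "8 * real k \<le> real (k - 1) * (\<Sum>i<12. (197 / 207) ^ Suc i)"
        using True by (simp add: eval_nat_numeral lessThan_Suc)
    qed (use True in auto)
  next
    case False
    then have k14: "14 \<le> k" using assms by simp
    show ?thesis
    proof (rule main[of 13 "16 / 17"])
      have "17 * (k - 3) \<le> n - k - 13" using assms by linarith
      then have "17 * real (k - 3) \<le> real (n - k - 13)" by (metis of_nat_le_iff of_nat_mult of_nat_numeral)
      then show "real (k - 3) + 16 / 17 * real (n - k - 13) \<le> real (n - k - 13)" by simp
      \<comment> \<open>The required factor 8k/(k - 1) decreases in k, so its value at 14 is the one
        to beat.\<close>
      have "(\<Sum>i<13. (16 / 17 :: real) ^ Suc i) \<ge> 8 * 14 / 13"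
        by (simp add: eval_nat_numeral lessThan_Suc)
      then have "real (k - 1) * (8 * 14 / 13) \<le> real (k - 1) * (\<Sum>i<13. (16 / 17) ^ Suc i)"
        by (intro mult_left_mono) auto
      moreover have "8 * real k \<le> real (k - 1) * (8 * 14 / 13)" using k14 by (simp add: field_simps)
      ultimately show "8 * real k \<le> real (k - 1) * (\<Sum>i<13. (16 / 17) ^ Suc i)" by linarith
    qed (use k14 in auto)
  qed
  then show ?thesis by linarith
qed

section \<open>Estimates for the window between the exchange argument and concentration\<close>

text \<open>Raising the bottom by one gains 17, and lowering the top by k - 1 keeps at least 5/17,
  because the loss is at most exp((k-1)(k-3)/(n-2k)) <= exp(6/5) <= 17/5. Beyond \<open>x\<close>
  the window is empty.\<close>

lemma five_binomials_le:
  assumes "13 \<le> k" "18 * k \<le> n" and x: "10 * ((k - 1) * (k - 3)) \<le> 12 * (n - 2 * k)"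
  shows "5 * ((n - 5) choose (k - 4)) \<le> (n - k - 4) choose (k - 3)"
proof -
  define u v w where "u = real (n - 2 * k)" and "v = real (n - k - 3)" and "w = real (k - 3)"
  \<comment> \<open>The factor 1 - (k-3)/(n-k-3) of the last of the k - 1 steps that lower the
    top.\<close>
  define b where "b = u / v"
  have sp: "v = u + w"
  proof -
    have "k + k = 2 * k" "3 \<le> k" "2 * k \<le> n" using assms(1,2) by auto
    then have "n - k - 3 = (n - 2 * k) + (k - 3)" by arith
    then show ?thesis unfolding u_def v_def w_def by (simp only: of_nat_add)
  qed
  have pos: "0 < u" "0 < v" "0 \<le> w" using assms by (auto simp: u_def v_def w_def)
  have b: "0 \<le> b" "b \<le> 1" using pos sp by (auto simp: b_def)
  have inv: "1 / b \<le> exp (w / u)"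
  proof -
    have "1 / b = 1 + w / u" using pos sp by (simp add: b_def field_simps)
    then show ?thesis using exp_ge_add_one_self by metis
  qed
  have e: "exp (6 / 5 :: real) \<le> 17 / 5"
  proof -
    have "exp (1 / 40 :: real) \<le> 1 + 1 / 40 + (1 / 40)\<^sup>2" by (rule exp_bound) auto
    then have "exp (1 / 40 :: real) ^ 48 \<le> (1 + 1 / 40 + (1 / 40)\<^sup>2) ^ 48" by (rule power_mono) simp
    also have "\<dots> \<le> 17 / 5" by (simp add: power2_eq_square field_simps)
    also have "exp (1 / 40 :: real) ^ 48 = exp (48 * (1 / 40))" by (simp only: exp_of_nat_mult[symmetric] of_nat_numeral)
    finally show ?thesis by simp
  qed
  have "(1 / b) ^ (k - 1) \<le> exp (w / u) ^ (k - 1)"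
    by (rule power_mono[OF inv]) (use b in auto)
  also have "\<dots> = exp (real (k - 1) * (w / u))" by (simp only: exp_of_nat_mult)
  also have "\<dots> \<le> exp (6 / 5)"
  proof -
    have "real (10 * ((k - 1) * (k - 3))) \<le> real (12 * (n - 2 * k))" using x by (simp only: of_nat_le_iff)
    then have "10 * (real (k - 1) * w) \<le> 12 * u" unfolding u_def w_def by (simp only: of_nat_mult of_nat_numeral)
    then show ?thesis using pos by (simp add: field_simps)
  qed
  also note e
  finally have "(1 / b) ^ (k - 1) \<le> 17 / 5" .
  moreover have b0: "0 < b" using pos by (simp add: b_def)
  ultimately have bk: "5 / 17 \<le> b ^ (k - 1)" by (simp add: power_divide field_simps)
  have "b ^ (k - 1) * ((n - 5) choose (k - 3)) \<le> ((n - 5 - (k - 1)) choose (k - 3))"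
  proof (rule binomial_top_ge[OF b(1) _ _ b(2)])
    show "k - 1 \<le> n - 5" using assms by simp
    have "n - 5 - (k - 1) + 1 = n - k - 3" using assms by simp
    then show "real (k - 3) + b * real (n - 5 - (k - 1) + 1) \<le> real (n - 5 - (k - 1) + 1)"
    proof -
      have "b * v = u" using pos by (simp add: b_def)
      then show ?thesis unfolding \<open>n - 5 - (k - 1) + 1 = n - k - 3\<close> v_def[symmetric] w_def[symmetric]
        using sp by simp
    qed
  qed
  moreover have "n - 5 - (k - 1) = n - k - 4" using assms by simp
  moreover have "5 / 17 * real ((n - 5) choose (k - 3)) \<le> b ^ (k - 1) * ((n - 5) choose (k - 3))"
    using bk by (intro mult_right_mono) auto
  ultimately have 1: "5 / 17 * real ((n - 5) choose (k - 3)) \<le> real ((n - k - 4) choose (k - 3))" by simp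
  have "17 ^ 1 * ((n - 5) choose (k - 4)) \<le> (n - 5) choose (k - 4 + 1)"
    by (rule binomial_bottom_le) (use assms(1,2) in presburger)
  moreover have "k - 4 + 1 = k - 3" using assms by simp
  ultimately have "17 * ((n - 5) choose (k - 4)) \<le> (n - 5) choose (k - 3)" by simp
  then have "17 * real ((n - 5) choose (k - 4)) \<le> real ((n - 5) choose (k - 3))" by linarith
  then show ?thesis using 1 by linarith
qed

lemma large_k:
  fixes n k :: nat
  assumes "18 * k \<le> n" and x: "12 * (n - 2 * k) < 10 * ((k - 1) * (k - 3))"
  shows "24 \<le> k"
proof (rule ccontr)
  assume "\<not> ?thesis"
  then have k: "k \<le> 23" by simp
  have "12 * (16 * k) \<le> 12 * (n - 2 * k)" using assms(1) by simp
  then have "192 * k < 10 * ((k - 1) * (k - 3))" using x by linarith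
  moreover have "(k - 1) * (k - 3) \<le> k * (k - 3)" by (rule mult_le_mono1) simp
  moreover have "k * (k - 3) \<le> k * 20" using k by (intro mult_le_mono2) simp
  moreover have "(k - 1) * (k - 3) \<le> (k - 1) * 20" using k by (intro mult_le_mono2) simp
  ultimately show False using k by linarith
qed

text \<open>The exponent is at least (3/4)(6/5)(8/9) = 4/5: the first factor stems from
  \<open>k div 4\<close>, the second from \<open>x\<close>, the third from n >= 18k. The value 49
  rather than 50 leaves room for the members avoiding \<open>c\<close>.\<close>

lemma shrink_star:
  assumes "24 \<le> k" "18 * k \<le> n" and x: "12 * (n - 2 * k) < 10 * ((k - 1) * (k - 3))"
  shows "100 * ((n - k) choose (k - 1)) \<le> 49 * ((n - 1 - k div 4) choose (k - 1))"
proof -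
  define J where "J = k div 4"
  have J: "4 * J \<le> k" by (simp add: J_def)
  let ?s = "k - 1 - J"
  define a where "a = 1 - real (k - 1) / real (n - 1)"
  have n1: "0 < real (n - 1)" using assms by simp
  have s: "n - 1 - J - ?s = n - k" using assms(1,2) J by linarith
  have 1: "real ((n - k) choose (k - 1)) \<le> a ^ ?s * real ((n - 1 - J) choose (k - 1))"
  proof (subst s[symmetric], rule binomial_top_le)
    show "?s \<le> n - 1 - J" using assms(1,2) J by linarith
    show "k - 1 \<le> n - 1 - J - ?s" using assms(1,2) J by linarith
    show "a \<le> 1" by (simp add: a_def)
    define q where "q = real (k - 1) / real (n - 1)"
    have "real (n - 1 - J) * q \<le> real (n - 1) * q" by (intro mult_right_mono) (auto simp: q_def)
    moreover have "real (n - 1) * q = real (k - 1)" using n1 by (simp add: q_def)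
    moreover have "a * real (n - 1 - J) = real (n - 1 - J) - real (n - 1 - J) * q"
      unfolding a_def q_def[symmetric] by (simp only: left_diff_distrib mult_1 mult.commute)
    ultimately show "real (n - 1 - J) \<le> real (k - 1) + a * real (n - 1 - J)" by linarith
  qed
  have a0: "0 \<le> a" using assms by (simp add: a_def field_simps)
  have "a \<le> exp (- (real (k - 1) / real (n - 1)))"
    using exp_ge_add_one_self[of "- (real (k - 1) / real (n - 1))"] by (simp add: a_def)
  then have "a ^ ?s \<le> exp (- (real (k - 1) / real (n - 1))) ^ ?s" by (rule power_mono[OF _ a0])
  also have "\<dots> = exp (real ?s * (- (real (k - 1) / real (n - 1))))" by (simp only: exp_of_nat_mult)
  also have "\<dots> \<le> exp (- (4 / 5))"
  proof -
    have s4: "3 * (k - 3) \<le> 4 * ?s" using J assms(1) by linarith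
    have n: "8 * (n - 1) \<le> 9 * (n - 2 * k)" using assms(1,2) J by linarith
    have "12 * (n - 2 * k) * 3 < 10 * ((k - 1) * (k - 3)) * 3" using x by linarith
    also have "\<dots> = 10 * ((k - 1) * (3 * (k - 3)))" by (simp only: mult_ac)
    also have "\<dots> \<le> 10 * ((k - 1) * (4 * ?s))" using s4 by (intro mult_le_mono2)
    finally have "36 * (n - 2 * k) \<le> 40 * ((k - 1) * ?s)" by simp
    then have "32 * (n - 1) \<le> 40 * ((k - 1) * ?s)" using n by linarith
    then have "real (32 * (n - 1)) \<le> real (40 * ((k - 1) * ?s))" by (simp only: of_nat_le_iff)
    then have "32 * real (n - 1) \<le> 40 * (real (k - 1) * real ?s)" by (simp only: of_nat_mult of_nat_numeral)
    then have "4 / 5 \<le> real ?s * (real (k - 1) / real (n - 1))" 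
    proof -
      have "real ?s * (real (k - 1) / real (n - 1)) = real (k - 1) * real ?s / real (n - 1)" by simp
      moreover have "4 / 5 * real (n - 1) \<le> real (k - 1) * real ?s"
        using \<open>32 * real (n - 1) \<le> 40 * (real (k - 1) * real ?s)\<close> by argo
      ultimately show ?thesis using n1 by (simp only: pos_le_divide_eq)
    qed
    then show ?thesis by simp
  qed
  also have "\<dots> \<le> 49 / 100"
  proof -
    have "(1 + 1 / 5 :: real) ^ 4 \<le> exp (1 / 5) ^ 4" by (rule power_mono) (rule exp_ge_add_one_self, simp)
    also have "exp (1 / 5 :: real) ^ 4 = exp (4 * (1 / 5))" by (simp only: exp_of_nat_mult[symmetric] of_nat_numeral)
    finally have "100 / 49 \<le> exp (4 / 5 :: real)" by (simp add: field_simps)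
    then show ?thesis by (simp add: exp_minus field_simps)
  qed
  finally have "a ^ ?s * real ((n - 1 - J) choose (k - 1)) \<le> 49 / 100 * real ((n - 1 - J) choose (k - 1))"
    by (intro mult_right_mono) auto
  then show ?thesis using 1 unfolding J_def by linarith
qed

text \<open>With J = k div 4, lowering the top by k + 3 - J <= 3J + 6 loses at most 17/16 per step,
  while raising the bottom gains 15 in each of J - 3 steps. This guarantees an admissible
  \<open>j\<close> in \<open>card_tau3_le\<close>.\<close>

lemma star_size_le:
  assumes "24 \<le> k" "18 * k \<le> n"
  shows "(n - 1 - k div 4) choose (k - k div 4) \<le> (n - k - 4) choose (k - 3)"
proof -
  define J where "J = k div 4"
  let ?s = "k + 3 - J"
  have J: "6 \<le> J" "k \<le> 4 * J + 3" "4 * J \<le> k" using assms(1) by (auto simp: J_def)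
  have s: "n - 1 - J - ?s = n - k - 4" using assms J by linarith
  have "(16 / 17) ^ ?s * real ((n - 1 - J) choose (k - J)) \<le> real ((n - 1 - J - ?s) choose (k - J))"
  proof (rule binomial_top_ge)
    have "17 * (k - J) \<le> n - 1 - J - ?s + 1" using assms J by linarith
    then have "17 * real (k - J) \<le> real (n - 1 - J - ?s + 1)"
      by (metis of_nat_le_iff of_nat_mult of_nat_numeral)
    then show "real (k - J) + 16 / 17 * real (n - 1 - J - ?s + 1) \<le> real (n - 1 - J - ?s + 1)" by argo
  qed (use assms J in linarith)+
  then have 1: "(16 / 17) ^ ?s * real ((n - 1 - J) choose (k - J)) \<le> real ((n - k - 4) choose (k - J))"
    unfolding s .
  have "15 ^ (J - 3) * ((n - k - 4) choose (k - J)) \<le> (n - k - 4) choose (k - J + (J - 3))"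
  proof (rule binomial_bottom_le)
    have e: "k - J + (J - 3) = k - 3" using J by simp
    then have "15 * (k - J + (J - 3)) + (k - J) + (J - 3) = 16 * (k - 3)" by simp
    also have "\<dots> \<le> n - k - 4 + 1" using assms by linarith
    finally show "15 * (k - J + (J - 3)) + (k - J) + (J - 3) \<le> n - k - 4 + 1" .
  qed
  moreover have "k - J + (J - 3) = k - 3" using J by simp
  ultimately have "real (15 ^ (J - 3) * ((n - k - 4) choose (k - J))) \<le> real ((n - k - 4) choose (k - 3))"
    by (simp only: of_nat_le_iff)
  then have 2: "15 ^ (J - 3) * real ((n - k - 4) choose (k - J)) \<le> real ((n - k - 4) choose (k - 3))" by simp
  have "(17 / 16 :: real) ^ ?s \<le> (17 / 16) ^ (24 + 3 * (J - 6))" using J by (intro power_increasing) auto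
  also have "\<dots> = (17 / 16) ^ 24 * ((17 / 16) ^ 3) ^ (J - 6)" by (simp only: power_add power_mult)
  also have "\<dots> \<le> 15 ^ 3 * 15 ^ (J - 6)"
    by (intro mult_mono power_mono) (auto simp: field_simps)
  also have "\<dots> = 15 ^ (J - 3)" using J by (simp only: power_add[symmetric]) simp
  finally have 3: "(17 / 16 :: real) ^ ?s \<le> 15 ^ (J - 3)" .
  have "real ((n - 1 - J) choose (k - J)) = (17 / 16) ^ ?s * ((16 / 17) ^ ?s * real ((n - 1 - J) choose (k - J)))"
    by (simp only: mult.assoc[symmetric] power_mult_distrib[symmetric]) simp
  also have "\<dots> \<le> (17 / 16) ^ ?s * real ((n - k - 4) choose (k - J))" by (rule mult_left_mono[OF 1]) simp
  also have "\<dots> \<le> 15 ^ (J - 3) * real ((n - k - 4) choose (k - J))" by (rule mult_right_mono[OF 3]) simp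
  also note 2
  finally show ?thesis unfolding J_def by simp
qed

text \<open>Lowering the top by one costs at most 2, raising the bottom to k - 3 costs nothing, and
  the two further steps to k - 1 gain at least 10 each.\<close>

lemma fifty_binomials_le:
  assumes "24 \<le> k" "18 * k \<le> n" "4 \<le> j" "j \<le> k div 4"
  shows "50 * ((n - j) choose (k - j + 1)) \<le> (n - 1 - j) choose (k - 1)"
proof -
  let ?M = "n - 1 - j" and ?r = "k - j + 1"
  have j: "4 * j \<le> k" using assms(4) by simp
  have M: "n - j = Suc ?M" "?r \<le> ?M" using assms by auto
  have "(Suc ?M - ?r) * (Suc ?M choose ?r) = Suc ?M * (?M choose ?r)"
    using binomial_absorb_comp[of "Suc ?M" ?r] by simp
  moreover have "Suc ?M * (?M choose ?r) \<le> (2 * (Suc ?M - ?r)) * (?M choose ?r)"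
    by (rule mult_le_mono1) (use assms(1-3) j in linarith)
  ultimately have "(Suc ?M - ?r) * (Suc ?M choose ?r) \<le> (Suc ?M - ?r) * (2 * (?M choose ?r))" by simp
  then have 1: "(n - j) choose ?r \<le> 2 * (?M choose ?r)" unfolding M(1) using M(2) by simp
  have "1 ^ (j - 4) * (?M choose ?r) \<le> ?M choose (?r + (j - 4))"
  proof (rule binomial_bottom_le)
    have "?r + (j - 4) = k - 3" using assms by simp
    then have "1 * (?r + (j - 4)) + ?r + (j - 4) = 2 * (k - 3)" by simp
    also have "\<dots> \<le> ?M + 1" using assms(1,2) j by linarith
    finally show "1 * (?r + (j - 4)) + ?r + (j - 4) \<le> ?M + 1" .
  qed
  moreover have "?r + (j - 4) = k - 3" using assms by simp
  ultimately have 2: "?M choose ?r \<le> ?M choose (k - 3)" by (simp only: power_one mult_1)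
  have "10 ^ 2 * (?M choose (k - 3)) \<le> ?M choose (k - 3 + 2)"
  proof (rule binomial_bottom_le)
    have e: "k - 3 + 2 = k - 1" using assms(1) by simp
    then have "10 * (k - 3 + 2) + (k - 3) + 2 = 11 * (k - 1)" by simp
    also have "\<dots> \<le> ?M + 1" using assms(1,2) j by linarith
    finally show "10 * (k - 3 + 2) + (k - 3) + 2 \<le> ?M + 1" .
  qed
  moreover have "k - 3 + 2 = k - 1" using assms by simp
  ultimately have "100 * (?M choose (k - 3)) \<le> ?M choose (k - 1)" by simp
  then show ?thesis using 1 2 by linarith
qed

section \<open>The upper bound and the extremal family\<close>

theorem card_tau3_le:
  assumes "finite V" "card V = n" "F \<subseteq> ksets V k" "cross F F" "tau3 F" "13 \<le> k" "18 * k \<le> n"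
  shows "int (card F) \<le> transversal_bound (n - 1) k 1 + 3"
proof -
  let ?g = "transversal_bound (n - 1) k 1 + 3"
  have k: "4 \<le> k" "3 * k \<le> n" "5 \<le> k" "2 \<le> k" using assms(6,7) by auto
  consider (1) "card F \<le> 9 * pair_bound n k"
    | (2) F' c where "F' \<subseteq> ksets V k" "cross F' F'" "tau3 F'" "card F' = card F" "c \<in> V"
       "card (del c F') < 5 * ((n - 5) choose (k - 4))"
    using concentration[OF assms(1,3,4,5,2) k(2,1) twice_binomial_le_pair_bound[OF k(1,2)]
      link_bound_le_pair_bound[OF k(1,2)]] by blast
  then show ?thesis
  proof cases
    case 1
    then show ?thesis using nine_pair_bounds[OF assms(6,7)] by linarith
  next
    case 2
    let ?X = "V - {c}" and ?A = "link c F'" and ?B = "del c F'"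
    have X: "finite ?X" "card ?X = n - 1" using assms(1,2) 2(5) by auto
    have Ak: "?A \<subseteq> ksets ?X (k - 1)" by (rule link_ksets[OF assms(1) 2(1)])
    have Bk: "?B \<subseteq> ksets ?X k" by (rule del_ksets[OF 2(1)])
    have cr: "cross ?A ?B"
      unfolding cross_def
    proof (intro ballI notI)
      fix A E assume AE: "A \<in> ?A" "E \<in> ?B" "A \<inter> E = {}"
      then have "insert c A \<inter> E = {}" "insert c A \<in> F'" "E \<in> F'" by (auto simp: link_def del_def)
      then show False using crossD[OF 2(2)] by blast
    qed
    have F: "card F = card ?A + card ?B"
      using card_link_del[OF finite_fam[OF assms(1) 2(1)], of c] 2(4) by simp
    show ?thesis
    proof (cases "card ?B \<le> ((card ?X - k - 3) choose (k - 3)) + 3")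
      case True
      have BB: "cross ?B ?B" using 2(2) by (auto simp: cross_def del_def)
      have "\<exists>E\<in>?B. x \<notin> E" for x using 2(3) unfolding tau3_def del_def by blast
      then have "int (card ?A) + int (card ?B) \<le> transversal_bound (card ?X) k 1 + 3"
        using near_star_bound[OF X(1) Ak Bk cr BB k(3) _ _ True] X(2) assms(6,7) by simp
      then show ?thesis using F X(2) by simp
    next
      case False
      have s: "card ?X - k - 3 = n - k - 4" using X(2) by simp
      have big: "(n - k - 4) choose (k - 3) < card ?B" using False unfolding s by simp
      then have "(n - k - 4) choose (k - 3) < 5 * ((n - 5) choose (k - 4))" using 2(6) by linarith
      then have x: "12 * (n - 2 * k) < 10 * ((k - 1) * (k - 3))"
        using five_binomials_le[OF assms(6,7)] by linarith
      have k24: "24 \<le> k" by (rule large_k[OF assms(7) x])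
      \<comment> \<open>\<open>j\<close> will be the least size from 4 on for which \<open>B\<close>
        is at least as large as the family of k-sets through a fixed \<open>j\<close>-set. Attaining
        the threshold bounds \<open>A\<close> through \<open>cross_bound\<close>, and minimality
        bounds \<open>B\<close> from above.\<close>
      define P where "P j \<longleftrightarrow> 4 \<le> j \<and> (n - 1 - j) choose (k - j) \<le> card ?B" for j
      define j where "j = (LEAST j. P j)"
      have PJ: "P (k div 4)" unfolding P_def
        using star_size_le[OF k24 assms(7)] big k24 by linarith
      have Pj: "P j" unfolding j_def by (rule LeastI[of P, OF PJ])
      have jJ: "j \<le> k div 4" unfolding j_def by (rule Least_le[of P, OF PJ])
      have j4: "4 \<le> j" "j \<le> k" using Pj jJ by (auto simp: P_def)
      have upper: "card ?B < (n - j) choose (k - j + 1)"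
      proof (cases "j = 4")
        case True
        \<comment> \<open>At \<open>j\<close> = 4 minimality says nothing; instead the concentration
          bound on \<open>B\<close> lies below C(n-4, k-3), as (n-4)/(k-3) is at least 5.\<close>
        have "(k - 3) * ((n - 4) choose (k - 3)) = (n - 4) * ((n - 5) choose (k - 4))"
          using binomial_absorption[of "k - 4" "n - 4"] k(1) by (simp add: Suc_diff_le[symmetric] numeral_eq_Suc)
        moreover have "((k - 3) * 5) * ((n - 5) choose (k - 4)) \<le> (n - 4) * ((n - 5) choose (k - 4))"
          by (rule mult_le_mono1) (use assms(6,7) in linarith)
        ultimately have "(k - 3) * (5 * ((n - 5) choose (k - 4))) \<le> (k - 3) * ((n - 4) choose (k - 3))"
          by (simp only: mult.assoc)
        then have "5 * ((n - 5) choose (k - 4)) \<le> (n - 4) choose (k - 3)" using k24 by simp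
        moreover have "k - j + 1 = k - 3" "n - j = n - 4" using True k24 by auto
        ultimately show ?thesis using 2(6) by simp
      next
        case False
        have "\<not> P (j - 1)" using not_less_Least[of "j - 1" P] j4(1) by (simp add: j_def[symmetric])
        then have "card ?B < (n - 1 - (j - 1)) choose (k - (j - 1))" using False j4 by (auto simp: P_def)
        moreover have "n - 1 - (j - 1) = n - j" "k - (j - 1) = k - j + 1" using j4 by auto
        ultimately show ?thesis by (simp only:)
      qed
      have thr: "(card ?X - j) choose (k - j) \<le> card ?B" using Pj X(2) by (simp add: P_def)
      have "card ?A + ((card ?X - card ({} :: 'a set) - j) choose (k - 1)) \<le> (card ?X - card ({} :: 'a set)) choose (k - 1)"
        by (rule cross_bound[OF X(1) _ _ Bk cr j4(2) _ thr]) (use Ak X(2) assms(6,7) in auto)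
      then have A: "card ?A + ((n - 1 - j) choose (k - 1)) \<le> (n - 1) choose (k - 1)" using X(2) by simp
      have 50: "50 * ((n - j) choose (k - j + 1)) \<le> (n - 1 - j) choose (k - 1)"
        by (rule fifty_binomials_le[OF k24 assms(7) j4(1) jJ])
      have shr: "100 * ((n - k) choose (k - 1)) \<le> 49 * ((n - 1 - k div 4) choose (k - 1))"
        by (rule shrink_star[OF k24 assms(7) x])
      have "(n - 1 - k div 4) choose (k - 1) \<le> (n - 1 - j) choose (k - 1)"
        by (rule binomial_right_mono) (use jJ in simp)
      moreover have "(n - k - 1) choose (k - 1) \<le> (n - k) choose (k - 1)" by (rule binomial_right_mono) simp
      \<comment> \<open>With S = C(n-1-j, k-1): \<open>A\<close> loses S, \<open>B\<close> has fewer
        than S/50 members, and 2 C(n-k, k-1) is at most 98S/100, so the subtracted terms of the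
        formula are covered even without its positive ones.\<close>
      ultimately have "int (card F) \<le> int ((n - 1) choose (k - 1)) - int ((n - k) choose (k - 1))
           - int ((n - k - 1) choose (k - 1))"
        using A F upper 50 shr by linarith
      then show ?thesis unfolding transversal_bound_closed_form[OF k(1,2)] by linarith
    qed
  qed
qed

section \<open>Translation from covering numbers, and the extremal family\<close>

lemma k_subsets_eq_ksets: "k_subsets n k = ksets {1..n} k"
  by (simp add: k_subsets_def ksets_def)

lemma intersecting_iff_cross: "intersecting F \<longleftrightarrow> cross F F"
  by (simp add: intersecting_def cross_def)

lemma covering_number_ge_3_imp_tau3:
  assumes "F \<subseteq> ksets {1..n} k" "3 \<le> covering_number n F"
  shows "tau3 F"
  unfolding tau3_def
proof (intro allI)
  fix u v
  let ?T = "{u, v} \<inter> {1..n}"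
  show "\<exists>E\<in>F. u \<notin> E \<and> v \<notin> E"
  proof (rule ccontr)
    assume n: "\<not> ?thesis"
    have "?T \<inter> E \<noteq> {}" if "E \<in> F" for E
    proof -
      have "E \<subseteq> {1..n}" "u \<in> E \<or> v \<in> E" using that assms(1) n by (auto simp: ksets_def)
      then show ?thesis by auto
    qed
    then have "covering_number n F \<le> card ?T"
      unfolding covering_number_def by (intro Least_le exI[of _ ?T]) auto
    also have "\<dots> \<le> card {u, v}" by (rule card_mono) auto
    also have "\<dots> \<le> 2" by (simp add: card_insert_if)
    finally show False using assms(2) by simp
  qed
qed

lemma tau3_imp_covering_number_ge_3:
  assumes "F \<subseteq> ksets {1..n} k" "1 \<le> k" "tau3 F"
  shows "3 \<le> covering_number n F"
proof -
  let ?P = "\<lambda>s. \<exists>T. T \<subseteq> {1..n} \<and> card T = s \<and> (\<forall>A\<in>F. T \<inter> A \<noteq> {})"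
  have "{1..n} \<inter> A \<noteq> {}" if "A \<in> F" for A
  proof -
    have "A \<subseteq> {1..n}" "card A = k" using that assms(1) by (auto simp: ksets_def)
    then have "A \<noteq> {}" using assms(2) by auto
    then show ?thesis using \<open>A \<subseteq> {1..n}\<close> by auto
  qed
  then have "?P (card {1..n})" by blast
  then have "?P (covering_number n F)" unfolding covering_number_def by (rule LeastI)
  then obtain T where T: "T \<subseteq> {1..n}" "card T = covering_number n F" "\<forall>A\<in>F. T \<inter> A \<noteq> {}" by blast
  have fT: "finite T" by (rule finite_subset[OF T(1)]) simp
  have "\<not> card T \<le> 2"
  proof
    assume "card T \<le> 2"
    then obtain u v where "T \<subseteq> {u, v}"
    proof -
      consider "card T = 0" | "card T = 1" | "card T = 2" using \<open>card T \<le> 2\<close> by linarith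
      then show ?thesis
      proof cases
        case 1 then show ?thesis using that[of 0 0] fT by simp
      next
        case 2 then show ?thesis using that by (auto simp: card_1_singleton_iff)
      next
        case 3 then show ?thesis using that by (auto simp: card_2_iff)
      qed
    qed
    moreover obtain E where "E \<in> F" "u \<notin> E" "v \<notin> E" using assms(3) unfolding tau3_def by blast
    ultimately show False using T(3) by blast
  qed
  then show ?thesis using T(2) by simp
qed

lemma G_fam_properties:
  assumes "13 \<le> k" "18 * k \<le> n"
  shows "G_fam n k \<subseteq> ksets {1..n} k" "cross (G_fam n k) (G_fam n k)" "tau3 (G_fam n k)"
proof -
  let ?B1 = "{2..k+1}" and ?C = "{k+2..2*k}"
  have Bk: "B_fam k \<subseteq> ksets {1..n} k"
    using assms by (auto simp: B_fam_def ksets_def)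
  have Ak: "A_fam n k \<subseteq> ksets {1..n} k" by (auto simp: A_fam_def k_subsets_eq_ksets)
  show Gk: "G_fam n k \<subseteq> ksets {1..n} k" using Ak Bk by (auto simp: G_fam_def)
  have "2 * k \<in> ?C" "2 \<in> ?B1" "3 \<in> ?B1" using assms by auto
  then have BB: "E \<inter> E' \<noteq> {}" if "E \<in> B_fam k" "E' \<in> B_fam k" for E E'
    using that unfolding B_fam_def by blast
  show "cross (G_fam n k) (G_fam n k)"
    unfolding cross_def G_fam_def
  proof (intro ballI)
    fix E E' assume EE: "E \<in> A_fam n k \<union> B_fam k" "E' \<in> A_fam n k \<union> B_fam k"
    have "1 \<in> E" if "E \<in> A_fam n k" for E using that by (simp add: A_fam_def)
    moreover have "E \<inter> E' \<noteq> {}" if "E \<in> A_fam n k" "E' \<in> B_fam k" for E E' using that by (simp add: A_fam_def)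
    ultimately show "E \<inter> E' \<noteq> {}" using EE BB by blast
  qed
  show "tau3 (G_fam n k)"
    unfolding tau3_def
  proof (intro allI)
    fix u v :: nat
    show "\<exists>E\<in>G_fam n k. u \<notin> E \<and> v \<notin> E"
    proof (cases "u = 1 \<or> v = 1")
      case True
      then obtain w where w: "{u, v} = {1, w}" by auto
      have "\<exists>E\<in>B_fam k. w \<notin> E"
      proof -
        consider "w \<notin> ?B1" | "w \<in> ?B1" "w \<noteq> 2" | "w = 2" by blast
        then show ?thesis
        proof cases
          case 1 then show ?thesis by (intro bexI[of _ ?B1]) (auto simp: B_fam_def)
        next
          case 2 then show ?thesis by (intro bexI[of _ "insert 2 ?C"]) (auto simp: B_fam_def)
        next
          case 3 then show ?thesis using assms by (intro bexI[of _ "insert 3 ?C"]) (auto simp: B_fam_def)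
        qed
      qed
      then obtain E where E: "E \<in> B_fam k" "w \<notin> E" by blast
      moreover have "1 \<notin> E" using E(1) assms by (auto simp: B_fam_def)
      ultimately have "E \<inter> {u, v} = {}" unfolding w by auto
      then show ?thesis using E by (intro bexI[of _ E]) (auto simp: G_fam_def)
    next
      case False
      \<comment> \<open>Two members of \<open>B_fam k\<close> contain \<open>?C\<close>, so a point
        of \<open>?B1\<close> and a point of \<open>?C\<close> together meet all three. Adding 1 and
        filling up away from \<open>u\<close> and \<open>v\<close> gives a member of
        \<open>A_fam n k\<close>.\<close>
      have "\<not> ?B1 \<subseteq> {u, v}"
      proof
        assume "?B1 \<subseteq> {u, v}"
        then have "card ?B1 \<le> card {u, v}" by (intro card_mono) auto
        also have "\<dots> \<le> 2" by (simp add: card_insert_if)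
        finally show False using assms by simp
      qed
      then obtain a where a: "a \<in> ?B1" "a \<notin> {u, v}" by blast
      have "\<not> ?C \<subseteq> {u, v}"
      proof
        assume "?C \<subseteq> {u, v}"
        then have "card ?C \<le> card {u, v}" by (intro card_mono) auto
        also have "\<dots> \<le> 2" by (simp add: card_insert_if)
        finally show False using assms by simp
      qed
      then obtain c where c: "c \<in> ?C" "c \<notin> {u, v}" by blast
      have ac: "a \<noteq> c" "a \<noteq> 1" "c \<noteq> 1" using a c by auto
      let ?R = "{1..n} - {1, a, c, u, v}"
      have "card {1..n} - card {1, a, c, u, v} \<le> card ?R" by (rule diff_card_le_card_Diff) simp
      moreover have "card {1, a, c, u, v} \<le> 5" by (simp add: card_insert_if)
      ultimately have "k - 3 \<le> card ?R" using assms by simp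
      then obtain S where S: "S \<subseteq> ?R" "card S = k - 3" "finite S" by (rule obtain_subset_with_card_n)
      let ?E = "{1, a, c} \<union> S"
      have "card ?E = card {1, a, c} + card S" by (rule card_Un_disjoint) (use S in auto)
      then have "card ?E = k" using S ac assms by simp
      moreover have "?E \<subseteq> {1..n}" using S a c assms by auto
      ultimately have "?E \<in> A_fam n k"
        using a c by (auto simp: A_fam_def B_fam_def k_subsets_def)
      moreover have "u \<notin> ?E" "v \<notin> ?E" using S a c False by auto
      ultimately show ?thesis by (intro bexI[of _ ?E]) (auto simp: G_fam_def)
    qed
  qed
qed

text \<open>Sets through 1 either meet both \<open>?B1\<close> and \<open>?C\<close>, or miss
  \<open>?C\<close>, in which case containing 2 and 3 makes them meet all of \<open>B_fam k\<close>.
  Only the lower bound is counted here; equality follows by applying \<open>card_tau3_le\<close> to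
  the family itself.\<close>

lemma card_G_fam_ge:
  assumes "13 \<le> k" "18 * k \<le> n"
  shows "transversal_bound (n - 1) k 1 + 3 \<le> int (card (G_fam n k))"
proof -
  let ?Y = "{1..n} - {1}" and ?B1 = "{2..k+1}" and ?C = "{k+2..2*k}"
  let ?H = "{T \<in> ksets ?Y (k - 1). T \<inter> ?B1 \<noteq> {} \<and> T \<inter> ?C \<noteq> {}}"
  let ?K = "{T \<in> ksets ?Y (k - 1). {2, 3} \<subseteq> T \<and> T \<inter> ?C = {}}"
  have Y: "finite ?Y" "card ?Y = n - 1" using assms by auto
  have cs: "card ?B1 = k" "card ?C = k - 1" by auto
  have s: "n - 1 - k = n - k - 1" "n - 1 - (k - 1) = n - k" "n - k - 1 - (k - 1) = n - 2 * k"
    "n - 1 - 2 - (k - 1) = n - k - 2" "k - 1 - 2 = k - 3" using assms by auto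
  have H: "int (card ?H) = int ((n - 1) choose (k - 1)) - int ((n - k - 1) choose (k - 1))
      - int ((n - k) choose (k - 1)) + int ((n - 2 * k) choose (k - 1))"
  proof -
    have "?B1 \<subseteq> ?Y" "?C \<subseteq> ?Y" "?B1 \<inter> ?C = {}" using assms by auto
    from card_hitting_two[OF Y(1) this] show ?thesis unfolding Y(2) cs s .
  qed
  have K: "(n - k - 2) choose (k - 3) \<le> card ?K"
  proof -
    have c2: "card {2, 3 :: nat} = 2" by simp
    have "(card ?Y - card {2, 3 :: nat} - card ?C) choose (k - 1 - card {2, 3 :: nat}) \<le> card ?K"
      by (rule card_through_avoiding[OF Y(1)]) (use assms in auto)
    then show ?thesis unfolding Y(2) cs c2 s .
  qed
  have fin: "finite ?H" "finite ?K" using Y(1) by auto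
  have HK: "card (?H \<union> ?K) = card ?H + card ?K" using fin by (intro card_Un_disjoint) auto
  have "insert 1 ` (?H \<union> ?K) \<subseteq> A_fam n k"
  proof
    fix E assume "E \<in> insert 1 ` (?H \<union> ?K)"
    then obtain T where T: "T \<in> ?H \<union> ?K" "E = insert 1 T" by auto
    then have Tk: "T \<in> ksets ?Y (k - 1)" by auto
    then have "finite T" using ksets_finiteD[OF Y(1)] by blast
    moreover have "1 \<notin> T" "T \<subseteq> {1..n}" "card T = k - 1" using Tk by (auto simp: ksets_def)
    ultimately have "E \<in> k_subsets n k" using T(2) assms by (auto simp: k_subsets_def)
    moreover have "E \<inter> B \<noteq> {}" if "B \<in> B_fam k" for B
      using that T assms unfolding B_fam_def by auto
    ultimately show "E \<in> A_fam n k" using T(2) by (auto simp: A_fam_def)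
  qed
  moreover have "inj_on (insert 1) (?H \<union> ?K)"
  proof (rule inj_onI)
    fix T T' assume TT: "T \<in> ?H \<union> ?K" "T' \<in> ?H \<union> ?K" "insert 1 T = insert 1 T'"
    then have "T \<in> ksets ?Y (k - 1)" "T' \<in> ksets ?Y (k - 1)" by auto
    then have "1 \<notin> T" "1 \<notin> T'" by (auto simp: ksets_def)
    then show "T = T'" using TT(3) by (metis insert_ident)
  qed
  moreover have fG: "finite (G_fam n k)" using finite_fam[OF _ G_fam_properties(1)[OF assms]] by simp
  then have fA: "finite (A_fam n k)" "finite (B_fam k)" by (auto simp: G_fam_def)
  ultimately have A: "card (?H \<union> ?K) \<le> card (A_fam n k)" by (intro card_inj_on_le[of "insert 1"])
  have B: "card (B_fam k) = 3"
  proof -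
    have "2 \<in> ?B1" "2 * k \<notin> ?B1" "2 * k \<in> insert 2 ?C" "2 * k \<in> insert 3 ?C" "2 \<notin> insert 3 ?C" "2 \<in> insert 2 ?C"
      using assms by auto
    then have "?B1 \<noteq> insert 2 ?C" "?B1 \<noteq> insert 3 ?C" "insert 2 ?C \<noteq> insert 3 ?C" by metis+
    then show ?thesis unfolding B_fam_def by simp
  qed
  have "A_fam n k \<inter> B_fam k = {}" using assms by (auto simp: A_fam_def B_fam_def)
  then have "card (G_fam n k) = card (A_fam n k) + card (B_fam k)"
    unfolding G_fam_def using fA by (intro card_Un_disjoint)
  moreover have "4 \<le> k" "3 * k \<le> n" using assms by auto
  ultimately show ?thesis using A B HK H K unfolding transversal_bound_closed_form[OF \<open>4 \<le> k\<close> \<open>3 * k \<le> n\<close>] by linarith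
qed

theorem mainTheorem4:
  fixes n k :: nat
  assumes "k \<ge> 13" and "n \<ge> 18 * k"
  shows "f_max n k 3 = card (G_fam n k) \<and>
         int (card (G_fam n k)) =
           int ((n - 1) choose (k - 1)) - int ((n - k) choose (k - 1))
           - int ((n - k - 1) choose (k - 1)) + int ((n - 2 * k) choose (k - 1))
           + int ((n - k - 2) choose (k - 3)) + 3"
proof -
  note G = G_fam_properties[OF assms]
  have up: "int (card F) \<le> transversal_bound (n - 1) k 1 + 3"
    if "F \<subseteq> ksets {1..n} k" "cross F F" "tau3 F" for F :: "nat set set"
    by (rule card_tau3_le[OF _ _ that assms]) auto
  have eq: "int (card (G_fam n k)) = transversal_bound (n - 1) k 1 + 3"
    using up[OF G] card_G_fam_ge[OF assms] by simp
  have "f_max n k 3 = card (G_fam n k)"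
    unfolding f_max_def
  proof (rule Max_eqI)
    have "{card F |F. F \<subseteq> k_subsets n k \<and> intersecting F \<and> 3 \<le> covering_number n F}
        \<subseteq> card ` Pow (k_subsets n k)" by auto
    then show "finite {card F |F. F \<subseteq> k_subsets n k \<and> intersecting F \<and> 3 \<le> covering_number n F}"
      by (rule finite_subset) (simp add: k_subsets_eq_ksets)
    show "card (G_fam n k) \<in> {card F |F. F \<subseteq> k_subsets n k \<and> intersecting F \<and> 3 \<le> covering_number n F}"
      using G tau3_imp_covering_number_ge_3[OF G(1) _ G(3)] assms
      by (auto simp: k_subsets_eq_ksets intersecting_iff_cross)
  next
    fix m assume "m \<in> {card F |F. F \<subseteq> k_subsets n k \<and> intersecting F \<and> 3 \<le> covering_number n F}"
    then obtain F where F: "m = card F" "F \<subseteq> ksets {1..n} k" "cross F F" "3 \<le> covering_number n F"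
      by (auto simp: k_subsets_eq_ksets intersecting_iff_cross)
    have "int m \<le> transversal_bound (n - 1) k 1 + 3"
      unfolding F(1) by (rule up[OF F(2,3) covering_number_ge_3_imp_tau3[OF F(2,4)]])
    then show "m \<le> card (G_fam n k)" using eq by simp
  qed
  then show ?thesis
    using eq transversal_bound_closed_form[of k n] assms by simp
qed

end
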